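(* Let $d\ge 3$, $m<1$, $\alpha\ge 1$, $R>0$, $p_c=d(1-m)/2$, and let $p>\max\{p_c,1\}$. Let $u\ge0$ be the solution of the Dirichlet problem $$u_t=\tfrac1m\Delta(u^m)\ \text{ in }(0,T)\times B_{\alpha R},\qquad u(0,\cdot)=u_0\ \text{ in }B_{\alpha R},\ \ \mathrm{supp}(u_0)\subseteq B_R,\qquad u=0\ \text{ on }\partial B_{\alpha R}\text{ for }t>0,$$ with $0\le u_0\in L^p(B_{\alpha R})$, where $T$ is the extinction time of $u$. Then for any $0\le s\le t\le T$ $$\|u(t)\|_p^{1-m}-\|u(s)\|_p^{1-m}\le-\mathcal{K}_p\,(t-s),$$ where $\|\cdot\|_p$ is the norm of $L^p(B_{\alpha R})$ and $$\mathcal{K}_p=\frac{4(1-m)(p-1)}{[p+m-1]^2}\,\big[\mathcal{P}\,\alpha R\big]^{-2\left(1-\frac{p_c}{p}\right)}\,\mathcal{S}_2^{-\frac{2p_c}{p}}>0.$$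
   Context: $B_r$ denotes the ball of radius $r$ centered at a fixed point. $\mathcal{S}_2$ is the optimal Sobolev constant of $\mathbb{R}^d$: $\|f\|_{2^*}\le\mathcal{S}_2\|\nabla f\|_2$, $2^*=2d/(d-2)$. $\mathcal{P}$ is the Poincaré constant of the unit ball: $\|f\|_2\le\mathcal{P}\|\nabla f\|_2$ for $f\in W^{1,2}_0(B_1)$. The extinction time $T$ is the first time at which $u$ vanishes identically. For $m=0$ the expression $u^m/m$ is read as $\log u$. By existing theory, solutions are assumed positive and smooth as long as they do not extinguish identically. *)

theory Defs
  imports "HOL-Analysis.Analysis"
begin

subsection \<open>Partial derivatives and smoothness\<close>

definition dir_deriv :: "'a::euclidean_space \<Rightarrow> ('a \<Rightarrow> real) \<Rightarrow> 'a \<Rightarrow> real" where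
  "dir_deriv b f x = deriv (\<lambda>h. f (x + h *\<^sub>R b)) 0"

definition grad :: "('a::euclidean_space \<Rightarrow> real) \<Rightarrow> 'a \<Rightarrow> 'a" where
  "grad f x = (\<Sum>b\<in>Basis. dir_deriv b f x *\<^sub>R b)"

definition laplacian :: "('a::euclidean_space \<Rightarrow> real) \<Rightarrow> 'a \<Rightarrow> real" where
  "laplacian f x = (\<Sum>b\<in>Basis. dir_deriv b (dir_deriv b f) x)"

text \<open>The class $C^k(S)$. It is meant for open \<open>S\<close> only.\<close>

primrec Ck_on :: "nat \<Rightarrow> 'a::euclidean_space set \<Rightarrow> ('a \<Rightarrow> real) \<Rightarrow> bool" where
  "Ck_on 0 S f \<longleftrightarrow> continuous_on S f"
| "Ck_on (Suc k) S f \<longleftrightarrow> continuous_on S f \<and>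
     (\<forall>b\<in>Basis. \<exists>g. (\<forall>x\<in>S. ((\<lambda>h. f (x + h *\<^sub>R b)) has_real_derivative g x) (at 0)) \<and> Ck_on k S g)"

definition smooth_on :: "'a::euclidean_space set \<Rightarrow> ('a \<Rightarrow> real) \<Rightarrow> bool" where
  "smooth_on S f \<longleftrightarrow> (\<forall>k. Ck_on k S f)"

subsection \<open>Lebesgue spaces\<close>

definition Lp_space :: "real \<Rightarrow> 'a::euclidean_space set \<Rightarrow> ('a \<Rightarrow> 'b::euclidean_space) set" where
  "Lp_space p S = {f. set_borel_measurable lebesgue S f \<and>
     set_integrable lebesgue S (\<lambda>x. norm (f x) powr p)}"

text \<open>For functions outside \<open>Lp_space p S\<close> the value carries no meaning.\<close>

definition Lp_norm :: "real \<Rightarrow> 'a::euclidean_space set \<Rightarrow> ('a \<Rightarrow> 'b::euclidean_space) \<Rightarrow> real" where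
  "Lp_norm p S f = (set_lebesgue_integral lebesgue S (\<lambda>x. norm (f x) powr p)) powr (1 / p)"

subsection \<open>Sobolev and Poincare constants\<close>

definition test_function :: "'a::euclidean_space set \<Rightarrow> ('a \<Rightarrow> real) \<Rightarrow> bool" where
  "test_function S f \<longleftrightarrow> Ck_on 1 UNIV f \<and>
     compact (closure {x. f x \<noteq> 0}) \<and> closure {x. f x \<noteq> 0} \<subseteq> S"

text \<open>\<open>W12_0 S f g\<close> says that \<open>f\<close> belongs to $W^{1,2}_0(S)$, the closure of the compactly
  supported $C^1$ functions in the $W^{1,2}$ norm, and that \<open>g\<close> is its weak gradient.\<close>

definition W12_0 :: "'a::euclidean_space set \<Rightarrow> ('a \<Rightarrow> real) \<Rightarrow> ('a \<Rightarrow> 'a) \<Rightarrow> bool" where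
  "W12_0 S f g \<longleftrightarrow> f \<in> Lp_space 2 S \<and> g \<in> Lp_space 2 S \<and>
     (\<exists>\<phi>. (\<forall>n. test_function S (\<phi> n)) \<and>
       (\<lambda>n. Lp_norm 2 S (\<lambda>x. \<phi> n x - f x)) \<longlonglongrightarrow> 0 \<and>
       (\<lambda>n. Lp_norm 2 S (\<lambda>x. grad (\<phi> n) x - g x)) \<longlonglongrightarrow> 0)"

definition poincare_const :: "'a::euclidean_space set \<Rightarrow> real" where
  "poincare_const S = Inf {C. 0 \<le> C \<and>
     (\<forall>f g. W12_0 S f g \<longrightarrow> Lp_norm 2 S f \<le> C * Lp_norm 2 S g)}"

text \<open>The optimal constant in the Sobolev inequality between the $L^{2^*}$ norm of \<open>f\<close> and the
  $L^2$ norm of its gradient on the whole space, with $2^* = 2d/(d-2)$ and $d \ge 3$.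
  By density the compactly supported $C^1$ functions give the
  same constant as the larger Sobolev classes. The argument only carries the type of the space.\<close>

definition sobolev_const :: "'a::euclidean_space itself \<Rightarrow> real" where
  "sobolev_const _ = Inf {C. 0 \<le> C \<and>
     (\<forall>f::'a \<Rightarrow> real. test_function UNIV f \<longrightarrow>
        Lp_norm (2 * real DIM('a) / (real DIM('a) - 2)) UNIV f \<le> C * Lp_norm 2 UNIV (grad f))}"

subsection \<open>The Dirichlet problem\<close>

text \<open>The nonlinearity $u^m/m$, read as $\log u$ for $m = 0$.\<close>

definition fde_nonlin :: "real \<Rightarrow> real \<Rightarrow> real" where
  "fde_nonlin m r = (if m = 0 then ln r else r powr m / m)"

definition vanishes_on :: "'a::euclidean_space set \<Rightarrow> ('a \<Rightarrow> real) \<Rightarrow> bool" where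
  "vanishes_on S f \<longleftrightarrow> (AE x in lebesgue. x \<in> S \<longrightarrow> f x = 0)"

text \<open>\<open>T\<close> is the first time at which \<open>u\<close> vanishes identically in \<open>S\<close>, and \<open>\<infinity>\<close> if there is none.\<close>

definition extinction_time :: "'a::euclidean_space set \<Rightarrow> (real \<Rightarrow> 'a \<Rightarrow> real) \<Rightarrow> ereal \<Rightarrow> bool" where
  "extinction_time S u T \<longleftrightarrow> 0 \<le> T \<and>
     (\<forall>t\<ge>0. ereal t < T \<longrightarrow> \<not> vanishes_on S (u t)) \<and>
     (\<forall>t. T = ereal t \<longrightarrow> vanishes_on S (u t))"

text \<open>Positive smooth solutions on $(0,T) \times S$, continuous up to the lateral boundary, where
  they vanish. As functions of time they belong to $C([0,T]; L^1(S))$, which is the sense in which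
  the initial datum is attained.\<close>

definition fde_dirichlet_solution ::
  "real \<Rightarrow> 'a::euclidean_space set \<Rightarrow> ereal \<Rightarrow> ('a \<Rightarrow> real) \<Rightarrow> (real \<Rightarrow> 'a \<Rightarrow> real) \<Rightarrow> bool" where
  "fde_dirichlet_solution m S T u0 u \<longleftrightarrow>
     (let I = {t. 0 < t \<and> ereal t < T}; J = {t. 0 \<le> t \<and> ereal t \<le> T} in
       smooth_on (I \<times> S) (\<lambda>(t, x). u t x) \<and>
       (\<forall>t\<in>I. \<forall>x\<in>S. 0 < u t x) \<and>
       (\<forall>t\<in>I. \<forall>x\<in>S.
          ((\<lambda>\<tau>. u \<tau> x) has_real_derivative laplacian (\<lambda>y. fde_nonlin m (u t y)) x) (at t)) \<and>
       continuous_on (I \<times> closure S) (\<lambda>(t, x). u t x) \<and>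
       (\<forall>t\<in>I. \<forall>x\<in>frontier S. u t x = 0) \<and>
       (\<forall>t\<in>J. u t \<in> Lp_space 1 S) \<and>
       (\<forall>t\<in>J. ((\<lambda>\<tau>. Lp_norm 1 S (\<lambda>x. u \<tau> x - u t x)) \<longlongrightarrow> 0) (at t within J)) \<and>
       (AE x in lebesgue. x \<in> S \<longrightarrow> u 0 x = u0 x))"

end

theory Submission
  imports Defs
begin

text \<open>
Formally, \<open>d/dt \<integral>u^p = - 4 p (p - 1) / (p + m - 1)^2 \<integral>|\<nabla>v|^2\<close> with
\<open>v = u^((p + m - 1) / 2)\<close>. The function \<open>v\<close> vanishes on the boundary, and \<open>\<integral>u^p\<close> is the integral of
\<open>v^q\<close> with \<open>q = 2 p / (p + m - 1)\<close>, an exponent above \<open>2\<close> because \<open>m < 1\<close>, and below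
\<open>2* = 2 d / (d - 2)\<close> because \<open>p > p_c\<close>. Interpolation between \<open>L^2\<close> and \<open>L^2*\<close>, with
the Poincare inequality at weight \<open>1 - p_c / p\<close> and the Sobolev inequality at weight \<open>p_c / p\<close>,
bounds \<open>(\<integral>u^p)^(2 / q)\<close> by a multiple of \<open>\<integral>|\<nabla>v|^2\<close> (\<open>gagliardo_nirenberg_ball\<close>). Hence
\<open>y = \<integral>u^p\<close> satisfies \<open>y' \<le> - k y^(1 - \<delta>)\<close> with \<open>\<delta> = (1 - m) / p\<close>, and \<open>y^\<delta>\<close>, which is the
power of the norm in question, decreases at least at the rate \<open>k \<delta>\<close>.

Nothing is known about the gradient of \<open>u\<close> near the boundary, and the powers above may be singular
at \<open>u = 0\<close>. Therefore \<open>r^p\<close> and \<open>r^((p + m - 1) / 2)\<close> are replaced by functions \<open>entropy0\<close> and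
\<open>cutpow\<close> that vanish for \<open>r \<le> 1 / N\<close>. As \<open>u\<close> is continuous up to the boundary and vanishes there,
composition with \<open>u\<close> produces functions with compact support in the ball, to which classical
calculus applies. The two truncations are matched so that the dissipation of the truncated entropy
is exactly a multiple of the Dirichlet energy of a test function (\<open>integral_entropy1_flux_div\<close>), and
the limit \<open>N \<longlonglongrightarrow> \<infinity>\<close> is taken after integration over a time step (\<open>moment_step_inequality\<close>). The
truncated entropies are also Lipschitz, which makes the continuity of \<open>u\<close> in \<open>L^1\<close> at time \<open>0\<close>
sufficient to compare with the initial datum (\<open>moment_le_initial\<close>).

The optimal constants are infima, and they satisfy their inequalities and are positive only because
some finite constant is admissible. Both inequalities are derived from translations: expanding
\<open>\<integral>(f (x + z) - f x)^2\<close> gives \<open>\<integral>f^2\<close> as half of this quantity, which is controlled by the gradient,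
plus a correlation \<open>\<integral>f x * f (x + z)\<close>. The correlation is zero for a long shift, which is the
Poincare inequality, and small on average over a large ball of shifts, which is the Faber--Krahn
inequality. The latter, applied to truncations at dyadic heights, gives the Sobolev inequality
(\<open>sobolev_C1c\<close>).
\<close>

section \<open>Translations of compactly supported functions\<close>

text \<open>The partial derivatives are carried along as a family indexed by the basis vectors. All
arguments below are made along one coordinate direction at a time, so a total derivative is never
formed.\<close>

definition C1c :: "('a::euclidean_space \<Rightarrow> real) \<Rightarrow> ('a \<Rightarrow> 'a \<Rightarrow> real) \<Rightarrow> bool" where
  "C1c f D \<longleftrightarrow> continuous_on UNIV f \<and> (\<exists>r. \<forall>x. r < norm x \<longrightarrow> f x = 0) \<and>
     (\<forall>b\<in>Basis. continuous_on UNIV (D b) \<and>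
        (\<forall>x. ((\<lambda>h. f (x + h *\<^sub>R b)) has_real_derivative D b x) (at 0)))"

lemma integrable_bounded_support:
  fixes f :: "'a::euclidean_space \<Rightarrow> real"
  assumes "continuous_on UNIV f" and "\<And>x. r < norm x \<Longrightarrow> f x = 0"
  shows "integrable lborel f"
proof -
  have "integrable lborel (\<lambda>x. indicator (cball 0 r) x *\<^sub>R f x)"
    by (rule borel_integrable_compact) (auto intro: continuous_on_subset[OF assms(1)])
  also have "(\<lambda>x. indicator (cball 0 r) x *\<^sub>R f x) = f"
    using assms(2) by (force simp: fun_eq_iff indicator_def)
  finally show ?thesis .
qed

lemma integral_lborel_translate:
  fixes f :: "'a::euclidean_space \<Rightarrow> real"
  assumes "f \<in> borel_measurable borel"
  shows "(LBINT x. f (x + z)) = (LBINT x. f x)"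
proof -
  have "(LBINT x. f x) = (\<integral>x. f x \<partial>distr lborel borel ((+) z))"
    by (simp add: lborel_distr_plus)
  also have "\<dots> = (LBINT x. f (z + x))"
    using assms by (subst integral_distr) auto
  finally show ?thesis by (simp add: add.commute)
qed

lemma eventually_line_in_open:
  fixes x b :: "'a::real_normed_vector"
  assumes "open U" and "x \<in> U"
  shows "\<forall>\<^sub>F h in nhds 0. x + h *\<^sub>R b \<in> U"
proof (rule topological_tendstoD)
  show "((\<lambda>h. x + h *\<^sub>R b) \<longlongrightarrow> x + 0 *\<^sub>R b) (nhds 0)"
    by (intro tendsto_intros) (simp add: filterlim_ident)
qed (use assms in auto)

lemma integrable_indicator_ball: "integrable lborel (\<lambda>x. indicator (ball c r) x :: real)"
  using emeasure_lborel_ball_finite[of c r] by (intro integrable_real_indicator) auto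

lemma integrable_indicator_cball: "integrable lborel (\<lambda>x. indicator (cball c r) x :: real)"
  using emeasure_lborel_cball_finite[of c r] by (intro integrable_real_indicator) auto

lemma DERIV_line:
  fixes f :: "'a::euclidean_space \<Rightarrow> real"
  assumes "((\<lambda>h. f (x + t *\<^sub>R b + h *\<^sub>R b)) has_real_derivative D) (at 0)"
  shows "((\<lambda>h. f (x + h *\<^sub>R b)) has_real_derivative D) (at t)"
proof -
  have "((\<lambda>h. f (x + (h + t) *\<^sub>R b)) has_real_derivative D) (at 0)"
    using assms by (simp add: algebra_simps)
  then show ?thesis
    using DERIV_shift[of "\<lambda>h. f (x + h *\<^sub>R b)" D 0 t] by simp
qed

lemma lipschitz_along:
  fixes f :: "'a::euclidean_space \<Rightarrow> real"
  assumes "\<And>x. ((\<lambda>h. f (x + h *\<^sub>R b)) has_real_derivative D x) (at 0)"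
    and "\<And>x. \<bar>D x\<bar> \<le> L"
  shows "\<bar>f (x + h *\<^sub>R b) - f x\<bar> \<le> L * \<bar>h\<bar>"
proof -
  have "norm (f (x + h *\<^sub>R b) - f (x + 0 *\<^sub>R b)) \<le> L * norm (h - 0)"
  proof (rule field_differentiable_bound[where S = UNIV and f' = "\<lambda>t. D (x + t *\<^sub>R b)"])
    fix t :: real
    show "((\<lambda>h. f (x + h *\<^sub>R b)) has_field_derivative D (x + t *\<^sub>R b)) (at t within UNIV)"
      using DERIV_line[OF assms(1)] by simp
  qed (use assms(2) in auto)
  then show ?thesis by simp
qed

lemma bounded_of_bounded_support:
  fixes f :: "'a::euclidean_space \<Rightarrow> real"
  assumes "continuous_on UNIV f" and "\<And>x. r < norm x \<Longrightarrow> f x = 0"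
  obtains L where "L > 0" and "\<And>x. \<bar>f x\<bar> \<le> L"
proof -
  have "compact (f ` cball 0 r)"
    by (intro compact_continuous_image continuous_on_subset[OF assms(1)]) auto
  then have "bounded (f ` cball 0 r)" by (rule compact_imp_bounded)
  then obtain L where L: "L > 0" "\<And>x. x \<in> cball 0 r \<Longrightarrow> \<bar>f x\<bar> \<le> L"
    unfolding bounded_pos by auto
  have "\<bar>f x\<bar> \<le> L" for x
  proof (cases "norm x \<le> r")
    case False
    then show ?thesis using assms(2)[of x] L(1) by simp
  qed (use L(2) in auto)
  with L(1) show ?thesis using that by blast
qed

lemma partial_bounded_support:
  fixes f :: "'a::euclidean_space \<Rightarrow> real"
  assumes "\<And>x. ((\<lambda>h. f (x + h *\<^sub>R b)) has_real_derivative D x) (at 0)"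
    and "\<And>x. r < norm x \<Longrightarrow> f x = 0" and "r < norm x"
  shows "D x = 0"
proof -
  have "\<forall>\<^sub>F h in at 0. r < norm (x + h *\<^sub>R b)"
  proof (rule order_tendstoD)
    show "((\<lambda>h. norm (x + h *\<^sub>R b)) \<longlongrightarrow> norm (x + 0 *\<^sub>R b)) (at 0)"
      by (intro tendsto_intros)
  qed (use assms(3) in auto)
  then have "\<forall>\<^sub>F h in at 0. f (x + h *\<^sub>R b) = 0"
    by eventually_elim (use assms(2) in auto)
  moreover have "f (x + 0 *\<^sub>R b) = 0" using assms(2,3) by simp
  ultimately have "((\<lambda>h. f (x + h *\<^sub>R b)) has_real_derivative 0) (at 0)"
    by (subst DERIV_cong_ev[OF refl _ refl, where g = "\<lambda>_. 0"])
      (auto simp: eventually_at_filter elim: eventually_mono)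
  with assms(1)[of x] show ?thesis by (rule DERIV_unique)
qed

text \<open>The case \<open>\<psi> = id\<close> serves to integrate a derivative, the case of the square to estimate a
shift by the energy of the derivative.\<close>

lemma difference_quotient_limit:
  fixes f :: "'a::euclidean_space \<Rightarrow> real" and h :: real and b :: 'a and \<psi> :: "real \<Rightarrow> real"
  defines "q \<equiv> \<lambda>N x. (f (x + (h / real (Suc N)) *\<^sub>R b) - f x) / (h / real (Suc N))"
  assumes f: "continuous_on UNIV f" and sf: "\<And>x. r < norm x \<Longrightarrow> f x = 0"
    and D: "continuous_on UNIV D"
    and df: "\<And>x. ((\<lambda>h. f (x + h *\<^sub>R b)) has_real_derivative D x) (at 0)"
    and h: "h \<noteq> 0" and \<psi>: "continuous_on UNIV \<psi>" "\<psi> 0 = 0"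
  shows "(\<lambda>N. LBINT x. \<psi> (q N x)) \<longlonglongrightarrow> (LBINT x. \<psi> (D x))"
proof -
  have sD: "D x = 0" if "r < norm x" for x
    using partial_bounded_support[OF df sf that] by blast
  obtain L where L: "L > 0" "\<And>x. \<bar>D x\<bar> \<le> L"
    using bounded_of_bounded_support[OF D sD] by blast
  have "compact (\<psi> ` {-L..L})"
    by (intro compact_continuous_image continuous_on_subset[OF \<psi>(1)]) auto
  then have "bounded (\<psi> ` {-L..L})" by (rule compact_imp_bounded)
  then obtain M where M: "M > 0" "\<And>t. t \<in> {-L..L} \<Longrightarrow> \<bar>\<psi> t\<bar> \<le> M"
    unfolding bounded_pos by auto
  define r' where "r' = r + \<bar>h\<bar> * norm b"
  have qL: "\<bar>q N x\<bar> \<le> L" for N x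
  proof -
    have "\<bar>f (x + (h / real (Suc N)) *\<^sub>R b) - f x\<bar> \<le> L * \<bar>h / real (Suc N)\<bar>"
      by (rule lipschitz_along[OF df L(2)])
    then show ?thesis using h by (simp add: q_def abs_divide abs_mult divide_simps del: of_nat_Suc)
  qed
  have qs: "q N x = 0" if "r' < norm x" for N x
  proof -
    have "\<bar>h / real (Suc N)\<bar> \<le> \<bar>h\<bar>"
      by (simp add: abs_divide divide_simps mult_le_cancel_left1)
    then have "norm ((h / real (Suc N)) *\<^sub>R b) \<le> \<bar>h\<bar> * norm b"
      unfolding norm_scaleR by (intro mult_right_mono) auto
    then have "r < norm (x + (h / real (Suc N)) *\<^sub>R b)"
      using that norm_triangle_ineq2[of x "- ((h / real (Suc N)) *\<^sub>R b)"] unfolding r'_def by simp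
    moreover have "r < norm x"
      using that unfolding r'_def by (smt (verit) mult_nonneg_nonneg norm_ge_zero)
    ultimately show ?thesis unfolding q_def by (simp only: sf) simp
  qed
  have fm[measurable]: "f \<in> borel_measurable borel"
    using f by (rule borel_measurable_continuous_onI)
  have \<psi>m[measurable]: "\<psi> \<in> borel_measurable borel"
    using \<psi>(1) by (rule borel_measurable_continuous_onI)
  have Dm[measurable]: "D \<in> borel_measurable borel"
    using D by (rule borel_measurable_continuous_onI)
  show ?thesis
  proof (rule integral_dominated_convergence[where w = "\<lambda>x. M * indicator (cball 0 r') x"])
    show "(\<lambda>x. \<psi> (D x)) \<in> borel_measurable lborel" by measurable
    show "(\<lambda>x. \<psi> (q N x)) \<in> borel_measurable lborel" for N unfolding q_def by measurable
    show "integrable lborel (\<lambda>x. M * indicator (cball (0::'a) r') x)"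
      by (intro integrable_mult_right integrable_indicator_cball)
    show "AE x in lborel. (\<lambda>N. \<psi> (q N x)) \<longlonglongrightarrow> \<psi> (D x)"
    proof (rule AE_I2)
      fix x
      have "((\<lambda>t. (f (x + t *\<^sub>R b) - f x) / t) \<longlongrightarrow> D x) (at 0)"
        using df[of x] by (simp add: DERIV_def)
      moreover have "filterlim (\<lambda>N. h / real (Suc N)) (at 0) sequentially"
        unfolding filterlim_at
        using h LIMSEQ_Suc[OF lim_const_over_n[of h]] by (auto intro!: always_eventually)
      ultimately have "(\<lambda>N. q N x) \<longlonglongrightarrow> D x"
        unfolding q_def by (rule filterlim_compose)
      moreover have "isCont \<psi> (D x)"
        using \<psi>(1) by (simp add: continuous_on_eq_continuous_at)
      ultimately show "(\<lambda>N. \<psi> (q N x)) \<longlonglongrightarrow> \<psi> (D x)"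
        by (rule isCont_tendsto_compose[rotated])
    qed
    show "AE x in lborel. norm (\<psi> (q N x)) \<le> M * indicator (cball 0 r') x" for N
    proof (rule AE_I2)
      fix x
      show "norm (\<psi> (q N x)) \<le> M * indicator (cball 0 r') x"
      proof (cases "norm x \<le> r'")
        case True
        then show ?thesis using M(2)[of "q N x"] qL[of N x] by (auto simp: abs_le_iff)
      qed (use qs[of x N] \<psi>(2) in auto)
    qed
  qed
qed

text \<open>Every difference quotient has integral zero, by translation invariance. This is the form in
which integration by parts is used.\<close>

lemma integral_partial_eq_0:
  fixes f :: "'a::euclidean_space \<Rightarrow> real"
  assumes f: "continuous_on UNIV f" and sf: "\<And>x. r < norm x \<Longrightarrow> f x = 0"
    and D: "continuous_on UNIV D"
    and df: "\<And>x. ((\<lambda>h. f (x + h *\<^sub>R b)) has_real_derivative D x) (at 0)"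
  shows "(LBINT x. D x) = 0"
proof -
  have fm[measurable]: "f \<in> borel_measurable borel"
    using f by (rule borel_measurable_continuous_onI)
  have fi: "integrable lborel f" using f sf by (rule integrable_bounded_support)
  have ti: "integrable lborel (\<lambda>x. f (x + z))" for z
  proof (rule integrable_bounded_support)
    show "continuous_on UNIV (\<lambda>x. f (x + z))"
      by (rule continuous_on_compose2[OF f]) (auto intro: continuous_intros)
    show "f (x + z) = 0" if "r + norm z < norm x" for x
      using that norm_triangle_ineq2[of x "- z"] by (intro sf) simp
  qed
  have "(LBINT x. (f (x + (1 / real (Suc N)) *\<^sub>R b) - f x) / (1 / real (Suc N))) = 0" for N
    using ti fi integral_lborel_translate[OF fm] by simp
  moreover have "(\<lambda>N. LBINT x. id ((f (x + (1 / real (Suc N)) *\<^sub>R b) - f x) / (1 / real (Suc N))))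
      \<longlonglongrightarrow> (LBINT x. id (D x))"
    by (rule difference_quotient_limit[OF f sf D df]) (auto simp: continuous_on_id)
  ultimately show ?thesis
    by (simp add: LIMSEQ_const_iff)
qed

definition shift_energy :: "('a::euclidean_space \<Rightarrow> real) \<Rightarrow> 'a \<Rightarrow> real" where
  "shift_energy f z = (LBINT x. (f (x + z) - f x)\<^sup>2)"

lemma integrable_shift_energy:
  fixes f :: "'a::euclidean_space \<Rightarrow> real"
  assumes f: "continuous_on UNIV f" and sf: "\<And>x. r < norm x \<Longrightarrow> f x = 0"
  shows "integrable lborel (\<lambda>x. (f (x + y) - f (x + z))\<^sup>2)"
proof (rule integrable_bounded_support)
  show "continuous_on UNIV (\<lambda>x. (f (x + y) - f (x + z))\<^sup>2)"
    by (intro continuous_intros continuous_on_compose2[OF f]) auto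
  show "(f (x + y) - f (x + z))\<^sup>2 = 0" if "r + norm y + norm z < norm x" for x
  proof -
    have "r < norm (x + y)" "r < norm (x + z)"
      using that norm_diff_ineq[of x z] norm_diff_ineq[of x y] norm_ge_zero[of y] norm_ge_zero[of z]
      by linarith+
    then show ?thesis by (simp add: sf)
  qed
qed

text \<open>The factor \<open>n\<close> comes from the Cauchy--Schwarz inequality for the telescoping sum of the
increments; each increment starts at another point, but translation invariance moves it to the
origin.\<close>

lemma shift_energy_sum:
  fixes f :: "'a::euclidean_space \<Rightarrow> real" and z :: "nat \<Rightarrow> 'a"
  assumes f: "continuous_on UNIV f" and sf: "\<And>x. r < norm x \<Longrightarrow> f x = 0"
  shows "shift_energy f (\<Sum>i<n. z i) \<le> real n * (\<Sum>i<n. shift_energy f (z i))"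
proof -
  define w where "w k = (\<Sum>i<k. z i)" for k
  have w: "w (Suc k) = w k + z k" for k by (simp add: w_def)
  have fm[measurable]: "f \<in> borel_measurable borel"
    using f by (rule borel_measurable_continuous_onI)
  have pt: "(f (x + w n) - f x)\<^sup>2 \<le> real n * (\<Sum>i<n. (f (x + w (Suc i)) - f (x + w i))\<^sup>2)" for x
  proof -
    have "f (x + w n) - f x = (\<Sum>i<n. f (x + w (Suc i)) - f (x + w i))"
      using sum_lessThan_telescope[of "\<lambda>i. f (x + w i)" n] by (simp add: w_def)
    then have "(f (x + w n) - f x)\<^sup>2 = (\<Sum>i<n. 1 * (f (x + w (Suc i)) - f (x + w i)))\<^sup>2" by simp
    also have "\<dots> \<le> (\<Sum>i<n. 1\<^sup>2) * (\<Sum>i<n. (f (x + w (Suc i)) - f (x + w i))\<^sup>2)"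
      by (rule Cauchy_Schwarz_ineq_sum)
    finally show ?thesis by simp
  qed
  have step: "(LBINT x. (f (x + w (Suc i)) - f (x + w i))\<^sup>2) = shift_energy f (z i)" for i
    using integral_lborel_translate[of "\<lambda>x. (f (x + z i) - f x)\<^sup>2" "w i"]
    unfolding shift_energy_def w by (simp add: add.assoc add.commute[of "w i"])
  have "shift_energy f (w n) \<le>
      (LBINT x. real n * (\<Sum>i<n. (f (x + w (Suc i)) - f (x + w i))\<^sup>2))"
    unfolding shift_energy_def
    using integrable_shift_energy[OF f sf, where y = "w n" and z = 0]
    by (intro integral_mono pt integrable_mult_right Bochner_Integration.integrable_sum
        integrable_shift_energy[OF f sf]) simp
  also have "\<dots> = real n * (\<Sum>i<n. LBINT x. (f (x + w (Suc i)) - f (x + w i))\<^sup>2)"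
    using integrable_shift_energy[OF f sf] by (simp add: Bochner_Integration.integral_sum)
  finally show ?thesis unfolding step by (simp add: w_def)
qed

text \<open>Dividing the shift into \<open>N + 1\<close> equal ones loses nothing here: the factor \<open>(N + 1)^2\<close> of
\<open>shift_energy_sum\<close> turns the increments into difference quotients, whose energy converges to that of
the derivative.\<close>

lemma shift_energy_along:
  fixes f :: "'a::euclidean_space \<Rightarrow> real"
  assumes f: "continuous_on UNIV f" and sf: "\<And>x. r < norm x \<Longrightarrow> f x = 0"
    and D: "continuous_on UNIV D"
    and df: "\<And>x. ((\<lambda>h. f (x + h *\<^sub>R b)) has_real_derivative D x) (at 0)"
  shows "shift_energy f (h *\<^sub>R b) \<le> h\<^sup>2 * (LBINT x. (D x)\<^sup>2)"
proof (cases "h = 0")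
  case True
  then show ?thesis by (simp add: shift_energy_def)
next
  case h: False
  define q where "q N x = (f (x + (h / real (Suc N)) *\<^sub>R b) - f x) / (h / real (Suc N))" for N x
  have "shift_energy f (h *\<^sub>R b) \<le> h\<^sup>2 * (LBINT x. (q N x)\<^sup>2)" for N
  proof -
    define k where "k = h / real (Suc N)"
    have "k \<noteq> 0" using h by (simp add: k_def)
    have "shift_energy f (h *\<^sub>R b) = shift_energy f (\<Sum>i<Suc N. k *\<^sub>R b)"
      by (simp add: k_def scaleR_sum_left[symmetric] sum_constant del: of_nat_Suc sum.lessThan_Suc)
    also have "\<dots> \<le> real (Suc N) * (\<Sum>i<Suc N. shift_energy f (k *\<^sub>R b))"
      by (rule shift_energy_sum[OF f sf])
    also have "\<dots> = (real (Suc N))\<^sup>2 * shift_energy f (k *\<^sub>R b)"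
      by (simp add: power2_eq_square del: of_nat_Suc sum.lessThan_Suc)
    also have "shift_energy f (k *\<^sub>R b) = k\<^sup>2 * (LBINT x. (q N x)\<^sup>2)"
      using \<open>k \<noteq> 0\<close> unfolding q_def k_def[symmetric] by (simp add: shift_energy_def power_divide)
    finally show ?thesis
      by (simp add: k_def power_divide del: of_nat_Suc)
  qed
  moreover have "(\<lambda>N. LBINT x. (q N x)\<^sup>2) \<longlonglongrightarrow> (LBINT x. (D x)\<^sup>2)"
    unfolding q_def
    by (rule difference_quotient_limit[OF f sf D df h]) (auto intro: continuous_intros)
  then have "(\<lambda>N. h\<^sup>2 * (LBINT x. (q N x)\<^sup>2)) \<longlonglongrightarrow> h\<^sup>2 * (LBINT x. (D x)\<^sup>2)"
    by (intro tendsto_intros)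
  ultimately show ?thesis
    by (intro tendsto_lowerbound[of _ _ sequentially]) auto
qed

section \<open>Poincare and Faber--Krahn inequalities\<close>

definition dirichlet_energy :: "('a::euclidean_space \<Rightarrow> 'a \<Rightarrow> real) \<Rightarrow> real" where
  "dirichlet_energy D = (\<Sum>b\<in>Basis. LBINT x. (D b x)\<^sup>2)"

lemma C1cE:
  assumes "C1c f D"
  obtains r where "r > 0" and "continuous_on UNIV f" and "\<And>x. r < norm x \<Longrightarrow> f x = 0"
    and "\<And>b. b \<in> Basis \<Longrightarrow> continuous_on UNIV (D b)"
    and "\<And>b x. b \<in> Basis \<Longrightarrow> ((\<lambda>h. f (x + h *\<^sub>R b)) has_real_derivative D b x) (at 0)"
    and "\<And>b x. b \<in> Basis \<Longrightarrow> r < norm x \<Longrightarrow> D b x = 0"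
proof -
  from assms obtain r where r: "\<And>x. r < norm x \<Longrightarrow> f x = 0" and c: "continuous_on UNIV f"
    and D: "\<And>b. b \<in> Basis \<Longrightarrow> continuous_on UNIV (D b)"
    and d: "\<And>b x. b \<in> Basis \<Longrightarrow> ((\<lambda>h. f (x + h *\<^sub>R b)) has_real_derivative D b x) (at 0)"
    unfolding C1c_def by blast
  have 0: "f x = 0" if "max r 1 < norm x" for x using r that by simp
  have "D b x = 0" if "b \<in> Basis" "max r 1 < norm x" for b x
    using partial_bounded_support[OF d[OF that(1)] 0 that(2)] by blast
  with 0 c D d show ?thesis using that[of "max r 1"] by simp
qed

lemma integrable_square_bounded_support:
  fixes f :: "'a::euclidean_space \<Rightarrow> real"
  assumes "continuous_on UNIV f" and "\<And>x. r < norm x \<Longrightarrow> f x = 0"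
  shows "integrable lborel (\<lambda>x. (f x)\<^sup>2)"
  by (rule integrable_bounded_support[where r = r])
    (use assms in \<open>auto intro!: continuous_intros continuous_on_subset[OF assms(1)]\<close>)

lemma dirichlet_energy_nonneg: "0 \<le> dirichlet_energy D"
  unfolding dirichlet_energy_def by (intro sum_nonneg integral_nonneg_AE) auto

lemma shift_energy_le:
  fixes f :: "'a::euclidean_space \<Rightarrow> real"
  assumes "C1c f D"
  shows "shift_energy f z \<le> real DIM('a) * (norm z)\<^sup>2 * dirichlet_energy D"
proof -
  obtain r where r: "r > 0" "continuous_on UNIV f" "\<And>x. r < norm x \<Longrightarrow> f x = 0"
    "\<And>b. b \<in> Basis \<Longrightarrow> continuous_on UNIV (D b)"
    "\<And>b x. b \<in> Basis \<Longrightarrow> ((\<lambda>h. f (x + h *\<^sub>R b)) has_real_derivative D b x) (at 0)"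
    using C1cE[OF assms] by metis
  obtain e where e: "bij_betw e {0..<DIM('a)} (Basis :: 'a set)"
    using ex_bij_betw_nat_finite[OF finite_Basis] by blast
  then have e': "bij_betw e {..<DIM('a)} (Basis :: 'a set)" by (simp add: atLeast0LessThan)
  have eB: "e i \<in> Basis" if "i < DIM('a)" for i
    using bij_betw_apply[OF e'] that by simp
  have "z = (\<Sum>i<DIM('a). (z \<bullet> e i) *\<^sub>R e i)"
    using euclidean_representation[of z] sum.reindex_bij_betw[OF e', of "\<lambda>b. (z \<bullet> b) *\<^sub>R b"] by simp
  then have "shift_energy f z \<le> real DIM('a) * (\<Sum>i<DIM('a). shift_energy f ((z \<bullet> e i) *\<^sub>R e i))"
    using shift_energy_sum[OF r(2,3), where z = "\<lambda>i. (z \<bullet> e i) *\<^sub>R e i" and n = "DIM('a)"] by simp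
  also have "\<dots> \<le> real DIM('a) * (\<Sum>i<DIM('a). (norm z)\<^sup>2 * (LBINT x. (D (e i) x)\<^sup>2))"
  proof (intro mult_left_mono sum_mono)
    fix i assume "i \<in> {..<DIM('a)}"
    then have b: "e i \<in> Basis" by (simp add: eB)
    have "shift_energy f ((z \<bullet> e i) *\<^sub>R e i) \<le> (z \<bullet> e i)\<^sup>2 * (LBINT x. (D (e i) x)\<^sup>2)"
      by (rule shift_energy_along[OF r(2,3) r(4)[OF b] r(5)[OF b]])
    also have "\<dots> \<le> (norm z)\<^sup>2 * (LBINT x. (D (e i) x)\<^sup>2)"
    proof (rule mult_right_mono)
      show "(z \<bullet> e i)\<^sup>2 \<le> (norm z)\<^sup>2"
        using Basis_le_norm[OF b, of z] by (metis abs_le_square_iff abs_norm_cancel)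
    qed (auto intro: integral_nonneg_AE)
    finally show "shift_energy f ((z \<bullet> e i) *\<^sub>R e i) \<le> (norm z)\<^sup>2 * (LBINT x. (D (e i) x)\<^sup>2)" .
  qed auto
  also have "\<dots> = real DIM('a) * (norm z)\<^sup>2 * dirichlet_energy D"
    unfolding dirichlet_energy_def
    using sum.reindex_bij_betw[OF e', of "\<lambda>b. (LBINT x. (D b x)\<^sup>2)"]
    by (simp add: sum_distrib_left[symmetric])
  finally show ?thesis .
qed

lemma integrable_shift_product:
  fixes f :: "'a::euclidean_space \<Rightarrow> real"
  assumes f: "continuous_on UNIV f" and sf: "\<And>x. r < norm x \<Longrightarrow> f x = 0"
  shows "integrable lborel (\<lambda>x. f x * f (x + z))"
  by (rule integrable_bounded_support[where r = r])
    (use sf in \<open>auto intro!: continuous_intros continuous_on_compose2[OF f]\<close>)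

text \<open>The source of both the Poincare and the Faber--Krahn inequality: it remains to choose shifts
\<open>z\<close> for which the correlation on the right is small compared with \<open>\<integral>f^2\<close>.\<close>

lemma integral_square_eq_shift:
  fixes f :: "'a::euclidean_space \<Rightarrow> real"
  assumes f: "continuous_on UNIV f" and sf: "\<And>x. r < norm x \<Longrightarrow> f x = 0"
  shows "(LBINT x. (f x)\<^sup>2) = shift_energy f z / 2 + (LBINT x. f x * f (x + z))"
proof -
  have [measurable]: "f \<in> borel_measurable borel"
    using f by (rule borel_measurable_continuous_onI)
  have i1: "integrable lborel (\<lambda>x. (f x)\<^sup>2)"
    using f sf by (rule integrable_square_bounded_support)
  have i3: "integrable lborel (\<lambda>x. f x * f (x + z))"
    using f sf by (rule integrable_shift_product)
  have i2: "integrable lborel (\<lambda>x. (f (x + z))\<^sup>2)"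
  proof (rule integrable_bounded_support[where r = "r + norm z"])
    show "continuous_on UNIV (\<lambda>x. (f (x + z))\<^sup>2)"
      by (intro continuous_intros continuous_on_compose2[OF f]) auto
    show "(f (x + z))\<^sup>2 = 0" if "r + norm z < norm x" for x
      using that norm_diff_ineq[of x z] by (simp add: sf)
  qed
  have "shift_energy f z = (LBINT x. (f (x + z))\<^sup>2 + (f x)\<^sup>2 - 2 * (f x * f (x + z)))"
    unfolding shift_energy_def
    by (intro arg_cong[where f = "integral\<^sup>L lborel"]) (auto simp: power2_eq_square algebra_simps)
  also have "\<dots> = (LBINT x. (f (x + z))\<^sup>2) + (LBINT x. (f x)\<^sup>2)
      - 2 * (LBINT x. f x * f (x + z))"
    using i1 i2 i3 by simp
  also have "(LBINT x. (f (x + z))\<^sup>2) = (LBINT x. (f x)\<^sup>2)"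
    by (rule integral_lborel_translate) measurable
  finally show ?thesis by argo
qed

text \<open>A shift of length \<open>2\<close> moves the unit ball off itself, so that the correlation vanishes.\<close>

lemma poincare_C1c:
  fixes f :: "'a::euclidean_space \<Rightarrow> real"
  assumes "C1c f D" and sup: "\<And>x. f x \<noteq> 0 \<Longrightarrow> norm x < 1"
  shows "(LBINT x. (f x)\<^sup>2) \<le> 2 * dirichlet_energy D"
proof -
  obtain r where r: "r > 0" "continuous_on UNIV f" "\<And>x. r < norm x \<Longrightarrow> f x = 0"
    "\<And>b. b \<in> Basis \<Longrightarrow> continuous_on UNIV (D b)"
    "\<And>b x. b \<in> Basis \<Longrightarrow> ((\<lambda>h. f (x + h *\<^sub>R b)) has_real_derivative D b x) (at 0)"
    using C1cE[OF assms(1)] by metis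
  obtain b :: 'a where b: "b \<in> Basis" using nonempty_Basis by blast
  have disj: "f x * f (x + 2 *\<^sub>R b) = 0" for x
  proof (rule ccontr)
    assume "f x * f (x + 2 *\<^sub>R b) \<noteq> 0"
    then have "norm x < 1" "norm (x + 2 *\<^sub>R b) < 1" using sup by auto
    moreover have "norm (2 *\<^sub>R b) \<le> norm (x + 2 *\<^sub>R b) + norm x"
      using norm_triangle_ineq4[of "x + 2 *\<^sub>R b" x] by simp
    ultimately show False using b by simp
  qed
  have "(LBINT x. (f x)\<^sup>2) = shift_energy f (2 *\<^sub>R b) / 2"
    using integral_square_eq_shift[where r = r, OF r(2,3), where z = "2 *\<^sub>R b"]
    unfolding disj by simp
  also have "\<dots> \<le> 2 * (LBINT x. (D b x)\<^sup>2)"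
    using shift_energy_along[OF r(2,3) r(4)[OF b] r(5)[OF b], where h = 2] by simp
  also have "(LBINT x. (D b x)\<^sup>2) \<le> dirichlet_energy D"
    unfolding dirichlet_energy_def by (rule member_le_sum) (auto simp: b intro: integral_nonneg_AE)
  finally show ?thesis by simp
qed

lemma integral_abs_square_le:
  fixes f :: "'a::euclidean_space \<Rightarrow> real"
  assumes f: "continuous_on UNIV f" and sf: "\<And>x. r < norm x \<Longrightarrow> f x = 0"
    and \<mu>: "measure lborel {x. f x \<noteq> 0} \<le> \<mu>" "\<mu> > 0"
  shows "(LBINT x. \<bar>f x\<bar>)\<^sup>2 \<le> \<mu> * (LBINT x. (f x)\<^sup>2)"
proof -
  have [measurable]: "f \<in> borel_measurable borel"
    using f by (rule borel_measurable_continuous_onI)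
  define A where "A = {x. f x \<noteq> 0}"
  have Am[measurable]: "A \<in> sets borel" unfolding A_def by measurable
  have "bounded A"
    unfolding bounded_iff A_def using sf by (metis linorder_not_le mem_Collect_eq)
  then have fin: "emeasure lborel A < \<infinity>" by (rule emeasure_bounded_finite)
  have iA: "integrable lborel (indicator A :: 'a \<Rightarrow> real)"
    using fin by (intro integrable_real_indicator) auto
  have i1: "integrable lborel (\<lambda>x. \<bar>f x\<bar>)"
    by (rule integrable_bounded_support[where r = r]) (use sf f in \<open>auto intro!: continuous_intros\<close>)
  have i2: "integrable lborel (\<lambda>x. (f x)\<^sup>2)"
    using f sf by (rule integrable_square_bounded_support)
  define I where "I = (LBINT x. \<bar>f x\<bar>)"
  define t where "t = I / \<mu>"
  have "0 \<le> (LBINT x. (\<bar>f x\<bar> - t * indicator A x)\<^sup>2)"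
    by (rule integral_nonneg_AE) auto
  also have "\<dots> = (LBINT x. (f x)\<^sup>2 - 2 * t * \<bar>f x\<bar> + t\<^sup>2 * indicator A x)"
    by (intro arg_cong[where f = "integral\<^sup>L lborel"])
      (auto simp: fun_eq_iff A_def indicator_def power2_eq_square algebra_simps)
  also have "\<dots> = (LBINT x. (f x)\<^sup>2) - 2 * t * I + t\<^sup>2 * measure lborel A"
    using i1 i2 iA fin by (simp add: I_def)
  also have "\<dots> \<le> (LBINT x. (f x)\<^sup>2) - 2 * t * I + t\<^sup>2 * \<mu>"
    using \<mu>(1) by (intro add_left_mono mult_left_mono) (auto simp: A_def)
  also have "\<dots> = (LBINT x. (f x)\<^sup>2) - I\<^sup>2 / \<mu>"
    using \<mu>(2) by (simp add: t_def power2_eq_square field_simps)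
  finally show ?thesis using \<mu>(2) by (simp add: I_def field_simps)
qed

text \<open>The integral of the correlation over all shifts is at most \<open>(\<integral>|f|)^2 \<le> \<mu> * \<integral>f^2\<close>. Its average over
the shifts in a ball of volume \<open>2 * \<mu>\<close> is therefore at most half of \<open>\<integral>f^2\<close> and can be absorbed. What
remains is the energy times the square of the radius of this ball.\<close>

lemma faber_krahn:
  fixes f :: "'a::euclidean_space \<Rightarrow> real"
  assumes "C1c f D" and \<mu>: "measure lborel {x. f x \<noteq> 0} \<le> \<mu>" "\<mu> > 0"
  shows "(LBINT x. (f x)\<^sup>2) \<le> real DIM('a) *
    (2 * \<mu> / unit_ball_vol (real DIM('a))) powr (2 / real DIM('a)) * dirichlet_energy D"
proof -
  obtain r where r: "r > 0" "continuous_on UNIV f" "\<And>x. r < norm x \<Longrightarrow> f x = 0"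
    using C1cE[OF assms(1)] by metis
  define \<omega> where "\<omega> = unit_ball_vol (real DIM('a))"
  \<comment> \<open>the radius of a ball of volume \<open>2 * \<mu>\<close>\<close>
  define h where "h = (2 * \<mu> / \<omega>) powr (1 / real DIM('a))"
  define B where "B = ball (0::'a) h"
  define F where "F = (LBINT x. (f x)\<^sup>2)"
  define J where "J z = (LBINT x. \<bar>f x\<bar> * \<bar>f (x + z)\<bar>)" for z
  define I where "I = (LBINT x. \<bar>f x\<bar>)"
  define E where "E = real DIM('a) * h\<^sup>2 * dirichlet_energy D"
  have \<omega>: "\<omega> > 0" by (simp add: \<omega>_def)
  have h: "h > 0" using \<mu>(2) \<omega> by (simp add: h_def)
  have "h ^ DIM('a) = h powr real DIM('a)" using h by (simp add: powr_realpow)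
  also have "\<dots> = 2 * \<mu> / \<omega>" using \<mu>(2) \<omega> by (simp add: h_def powr_powr)
  finally have hd: "h ^ DIM('a) = 2 * \<mu> / \<omega>" .
  have mB: "measure lborel B = 2 * \<mu>"
    using content_ball[of h "0::'a"] h \<omega> by (simp add: B_def hd \<omega>_def[symmetric])
  have [measurable]: "B \<in> sets borel" by (simp add: B_def)
  have h2: "h\<^sup>2 = (2 * \<mu> / \<omega>) powr (2 / real DIM('a))"
    using h \<mu>(2) \<omega> by (simp add: h_def powr_powr powr_realpow[symmetric] flip: powr_numeral)
  have fabs: "continuous_on UNIV (\<lambda>x. \<bar>f x\<bar>)" by (intro continuous_intros r)
  have FJ: "F \<le> E / 2 + J z" if "z \<in> B" for z
  proof -
    have "shift_energy f z \<le> real DIM('a) * (norm z)\<^sup>2 * dirichlet_energy D"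
      by (rule shift_energy_le[OF assms(1)])
    also have "\<dots> \<le> E"
      unfolding E_def using that h
      by (intro mult_right_mono mult_left_mono power_mono dirichlet_energy_nonneg) (auto simp: B_def)
    finally have "shift_energy f z \<le> E" .
    moreover have "(LBINT x. f x * f (x + z)) \<le> J z"
      unfolding J_def
    proof (rule integral_mono)
      show "integrable lborel (\<lambda>x. f x * f (x + z))"
        using r(2,3) by (rule integrable_shift_product)
      show "integrable lborel (\<lambda>x. \<bar>f x\<bar> * \<bar>f (x + z)\<bar>)"
        using integrable_shift_product[OF fabs, where r = r and z = z] r(3) by simp
      show "f x * f (x + z) \<le> \<bar>f x\<bar> * \<bar>f (x + z)\<bar>" for x
        by (simp add: abs_mult[symmetric])
    qed
    ultimately show ?thesis
      using integral_square_eq_shift[where r = r, OF r(2,3), where z = z] unfolding F_def by simp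
  qed
  have prod_int: "integrable (lborel \<Otimes>\<^sub>M lborel) (\<lambda>(x, z). \<bar>f x\<bar> * \<bar>f (x + z)\<bar>)"
    unfolding lborel_prod
  proof (rule integrable_bounded_support[where r = "3 * r"])
    show "continuous_on UNIV (\<lambda>(x, z). \<bar>f x\<bar> * \<bar>f (x + z)\<bar>)"
      unfolding split_beta by (intro continuous_intros continuous_on_compose2[OF r(2)]) auto
    fix p :: "'a \<times> 'a" assume p: "3 * r < norm p"
    obtain x z where xz: "p = (x, z)" by (cases p)
    have "f x = 0 \<or> f (x + z) = 0"
    proof (rule ccontr)
      assume "\<not> (f x = 0 \<or> f (x + z) = 0)"
      then have "norm x \<le> r" "norm (x + z) \<le> r" using r(3) by (meson not_le)+
      moreover have "norm z \<le> norm (x + z) + norm x"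
        using norm_triangle_ineq4[of "x + z" x] by simp
      ultimately have "norm x + norm z \<le> 3 * r" by simp
      with p show False using norm_Pair_le[of x z] by (simp add: xz)
    qed
    then show "(case p of (x, z) \<Rightarrow> \<bar>f x\<bar> * \<bar>f (x + z)\<bar>) = 0" by (auto simp: xz)
  qed
  have inner: "(LBINT z. \<bar>f x\<bar> * \<bar>f (x + z)\<bar>) = \<bar>f x\<bar> * I" for x
    using integral_lborel_translate[of "\<lambda>x. \<bar>f x\<bar>" x] borel_measurable_continuous_onI[OF fabs]
    by (simp add: I_def add.commute)
  have "(LBINT z. J z) = (LBINT x. (LBINT z. \<bar>f x\<bar> * \<bar>f (x + z)\<bar>))"
    unfolding J_def by (rule lborel_pair.Fubini_integral[OF prod_int])
  also have "\<dots> = I * I" unfolding inner by (simp add: I_def)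
  finally have J_int: "(LBINT z. J z) = I\<^sup>2" by (simp add: power2_eq_square)
  have Ji: "integrable lborel J"
    using lborel_pair.integrable_snd[OF prod_int] unfolding J_def by simp
  have J0: "0 \<le> J z" for z unfolding J_def by (rule integral_nonneg_AE) auto
  have iB: "integrable lborel (indicator B :: 'a \<Rightarrow> real)"
    unfolding B_def by (rule integrable_indicator_ball)
  have "2 * \<mu> * F = (LBINT z. F * indicator B z)" by (simp add: mB mult.commute)
  also have "\<dots> \<le> (LBINT z. E / 2 * indicator B z + J z)"
  proof (rule integral_mono)
    show "integrable lborel (\<lambda>z. F * indicator B z)"
      and "integrable lborel (\<lambda>z. E / 2 * indicator B z + J z)"
      by (intro Bochner_Integration.integrable_add integrable_mult_right Ji iB)+
    show "F * indicator B z \<le> E / 2 * indicator B z + J z" for z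
      using FJ[of z] J0[of z] by (cases "z \<in> B") auto
  qed
  also have "\<dots> = E * \<mu> + I\<^sup>2" using Ji iB by (simp add: mB J_int)
  also have "I\<^sup>2 \<le> \<mu> * F"
    unfolding I_def F_def by (rule integral_abs_square_le[OF r(2,3) \<mu>])
  finally have "\<mu> * F \<le> \<mu> * E" by (simp add: algebra_simps)
  then have "F \<le> E" using \<mu>(2) by simp
  then show ?thesis by (simp add: F_def E_def h2 \<omega>_def)
qed

section \<open>The Sobolev inequality by dyadic truncation\<close>

lemma DERIV_max0_square:
  "((\<lambda>x. (max 0 x)\<^sup>2) has_real_derivative 2 * max 0 x) (at (x::real))"
proof -
  consider "x > 0" | "x < 0" | "x = 0" by linarith
  then show ?thesis
  proof cases
    case 1
    have "((\<lambda>x. x\<^sup>2) has_real_derivative 2 * max 0 x) (at x)"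
      using 1 by (auto intro!: derivative_eq_intros)
    moreover have "\<forall>\<^sub>F y in nhds x. (max 0 y)\<^sup>2 = y\<^sup>2"
      using eventually_nhds_in_open[of "{0<..}" x] 1 by (auto elim!: eventually_mono)
    ultimately show ?thesis by (subst DERIV_cong_ev[OF refl _ refl])
  next
    case 2
    have "((\<lambda>x. 0) has_real_derivative 2 * max 0 x) (at x)"
      using 2 by (auto intro!: derivative_eq_intros)
    moreover have "\<forall>\<^sub>F y in nhds x. (max 0 y)\<^sup>2 = (0::real)"
      using eventually_nhds_in_open[of "{..<0}" x] 2 by (auto elim!: eventually_mono)
    ultimately show ?thesis by (subst DERIV_cong_ev[OF refl _ refl])
  next
    case 3
    have "((\<lambda>h::real. max 0 h) \<longlongrightarrow> max 0 0) (at 0)" by (intro tendsto_intros)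
    moreover have "((max 0 h)\<^sup>2 - (max 0 0)\<^sup>2) / h = max 0 h" for h :: real
      by (auto simp: max_def power2_eq_square)
    ultimately show ?thesis using 3 by (simp add: DERIV_def)
  qed
qed

text \<open>A \<open>C\<^sup>1\<close> step in \<open>\<bar>r\<bar>\<close> from \<open>0\<close> to \<open>2\<close>. As a function of \<open>r\<^sup>2\<close>, its derivative is a hat function
supported in the interval from \<open>1\<close> to \<open>3\<close>.\<close>

definition cutoff :: "real \<Rightarrow> real" where
  "cutoff r = (max 0 (r\<^sup>2 - 1))\<^sup>2 - 2 * (max 0 (r\<^sup>2 - 2))\<^sup>2 + (max 0 (r\<^sup>2 - 3))\<^sup>2"

definition cutoff' :: "real \<Rightarrow> real" where
  "cutoff' r = 4 * r * (max 0 (r\<^sup>2 - 1) - 2 * max 0 (r\<^sup>2 - 2) + max 0 (r\<^sup>2 - 3))"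

lemma DERIV_cutoff: "(cutoff has_real_derivative cutoff' r) (at r)"
proof -
  have "((\<lambda>r. (max 0 (r\<^sup>2 - a))\<^sup>2) has_real_derivative 2 * max 0 (r\<^sup>2 - a) * (2 * r)) (at r)" for a
    by (rule DERIV_chain2[OF DERIV_max0_square]) (auto intro!: derivative_eq_intros)
  note d = this[of 1] this[of 2] this[of 3]
  show ?thesis
    unfolding cutoff_def[abs_def]
    by (rule DERIV_cong[OF DERIV_add[OF DERIV_diff[OF d(1) DERIV_cmult[OF d(2)]] d(3)]])
      (simp add: cutoff'_def algebra_simps)
qed

lemma continuous_cutoff': "continuous_on UNIV cutoff'"
  unfolding cutoff'_def[abs_def] by (intro continuous_intros)

lemma cutoff_eq_0: "\<bar>r\<bar> \<le> 1 \<Longrightarrow> cutoff r = 0" and cutoff'_eq_0: "\<bar>r\<bar> \<le> 1 \<Longrightarrow> cutoff' r = 0"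
  using abs_square_le_1[of r] by (auto simp: cutoff_def cutoff'_def max_def)

lemma cutoff_large: "\<bar>r\<bar> \<ge> 2 \<Longrightarrow> cutoff r = 2" and cutoff'_large: "\<bar>r\<bar> \<ge> 2 \<Longrightarrow> cutoff' r = 0"
proof -
  assume "\<bar>r\<bar> \<ge> 2"
  then have "2\<^sup>2 \<le> \<bar>r\<bar>\<^sup>2" by (intro power_mono) auto
  then have "r\<^sup>2 \<ge> 4" by simp
  then show "cutoff r = 2" "cutoff' r = 0"
    by (auto simp: cutoff_def cutoff'_def max_def) (simp_all add: power2_eq_square algebra_simps)
qed

lemma abs_cutoff'_le: "\<bar>cutoff' r\<bar> \<le> 8"
proof (cases "\<bar>r\<bar> \<ge> 2")
  case False
  have "\<bar>max 0 (r\<^sup>2 - 1) - 2 * max 0 (r\<^sup>2 - 2) + max 0 (r\<^sup>2 - 3)\<bar> \<le> 1"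
    by (auto simp: max_def)
  then have "4 * \<bar>r\<bar> * \<bar>max 0 (r\<^sup>2 - 1) - 2 * max 0 (r\<^sup>2 - 2) + max 0 (r\<^sup>2 - 3)\<bar> \<le> 4 * 2 * 1"
    using False by (intro mult_mono) auto
  then show ?thesis by (simp add: cutoff'_def abs_mult)
qed (simp add: cutoff'_large)

lemma C1c_compose:
  assumes "C1c f D" and "\<And>r. (\<phi> has_real_derivative \<phi>' r) (at r)" and "continuous_on UNIV \<phi>'"
    and "\<phi> 0 = 0"
  shows "C1c (\<lambda>x. \<phi> (f x)) (\<lambda>b x. \<phi>' (f x) * D b x)"
  unfolding C1c_def
proof (intro conjI ballI allI)
  obtain r where r: "r > 0" "continuous_on UNIV f" "\<And>x. r < norm x \<Longrightarrow> f x = 0"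
    "\<And>b. b \<in> Basis \<Longrightarrow> continuous_on UNIV (D b)"
    "\<And>b x. b \<in> Basis \<Longrightarrow> ((\<lambda>h. f (x + h *\<^sub>R b)) has_real_derivative D b x) (at 0)"
    using C1cE[OF assms(1)] by metis
  have c: "continuous_on UNIV \<phi>"
    using assms(2) by (intro continuous_at_imp_continuous_on ballI DERIV_isCont)
  show "continuous_on UNIV (\<lambda>x. \<phi> (f x))"
    by (rule continuous_on_compose2[OF c r(2)]) auto
  show "\<exists>r. \<forall>x. r < norm x \<longrightarrow> \<phi> (f x) = 0"
    using r(3) assms(4) by (intro exI[of _ r]) simp
  fix b :: 'a assume b: "b \<in> Basis"
  show "continuous_on UNIV (\<lambda>x. \<phi>' (f x) * D b x)"
    by (intro continuous_intros r(4)[OF b] continuous_on_compose2[OF assms(3) r(2)]) auto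
  show "((\<lambda>h. \<phi> (f (x + h *\<^sub>R b))) has_real_derivative \<phi>' (f x) * D b x) (at 0)" for x
    using DERIV_chain2[OF assms(2) r(5)[OF b, of x]] by simp
qed

text \<open>The Faber--Krahn inequality for \<open>cutoff (f x / l)\<close>. This function lives on \<open>\<bar>f\<bar> > l\<close>, equals \<open>2\<close>
on \<open>\<bar>f\<bar> \<ge> 2 * l\<close>, and its gradient lives in between, so that the gradients at different dyadic heights
do not overlap.\<close>

lemma level_set_decay:
  fixes f :: "'a::euclidean_space \<Rightarrow> real"
  assumes f: "C1c f D" and l: "l > 0"
  defines "\<mu> \<equiv> \<lambda>l. measure lborel {x. l < \<bar>f x\<bar>}"
  shows "\<mu> (2 * l) \<le> 16 * real DIM('a) * (2 / unit_ball_vol (real DIM('a))) powr (2 / real DIM('a))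
    * \<mu> l powr (2 / real DIM('a)) / l\<^sup>2
    * (\<Sum>b\<in>Basis. LBINT x. (D b x)\<^sup>2 * indicator {x. l < \<bar>f x\<bar> \<and> \<bar>f x\<bar> < 2 * l} x)"
    (is "_ \<le> ?K * ?S")
proof -
  obtain r where r: "r > 0" "continuous_on UNIV f" "\<And>x. r < norm x \<Longrightarrow> f x = 0"
    "\<And>b. b \<in> Basis \<Longrightarrow> continuous_on UNIV (D b)"
    "\<And>b x. b \<in> Basis \<Longrightarrow> r < norm x \<Longrightarrow> D b x = 0"
    using C1cE[OF f] by metis
  have [measurable]: "f \<in> borel_measurable borel"
    using r(2) by (rule borel_measurable_continuous_onI)
  have fin: "emeasure lborel {x. s < \<bar>f x\<bar>} < \<infinity>" if "s > 0" for s
  proof (rule emeasure_bounded_finite)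
    show "bounded {x. s < \<bar>f x\<bar>}"
      unfolding bounded_iff using r(3) that
      by (metis abs_zero linorder_not_le mem_Collect_eq order_less_asym')
  qed
  have mono: "\<mu> (2 * l) \<le> \<mu> l"
    unfolding \<mu>_def using l fin[OF l] by (intro measure_mono_fmeasurable) (auto simp: fmeasurable_def)
  show ?thesis
  proof (cases "\<mu> l = 0")
    case True
    then have "\<mu> (2 * l) = 0" using mono by (simp add: \<mu>_def antisym)
    then show ?thesis by (simp add: True)
  next
    case False
    then have pos: "\<mu> l > 0" by (simp add: \<mu>_def zero_less_measure_iff)
    define g where "g x = cutoff (f x / l)" for x
    define Dg where "Dg b x = cutoff' (f x / l) / l * D b x" for b x
    have g: "C1c g Dg"
      unfolding g_def[abs_def] Dg_def[abs_def]
    proof (rule C1c_compose[OF f])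
      show "((\<lambda>r. cutoff (r / l)) has_real_derivative cutoff' (t / l) / l) (at t)" for t
        by (rule DERIV_cong[OF DERIV_chain2[OF DERIV_cutoff, where g = "\<lambda>r. r / l" and x = t]])
          (use l in \<open>auto intro!: derivative_eq_intros\<close>)
      show "continuous_on UNIV (\<lambda>r. cutoff' (r / l) / l)"
        using l by (intro continuous_intros continuous_on_compose2[OF continuous_cutoff']) auto
    qed (simp add: cutoff_eq_0)
    obtain s where s: "s > 0" "continuous_on UNIV g" "\<And>x. s < norm x \<Longrightarrow> g x = 0"
      using C1cE[OF g] by metis
    have g2: "integrable lborel (\<lambda>x. (g x)\<^sup>2)"
      using s(2,3) by (rule integrable_square_bounded_support)
    have sub: "{x. g x \<noteq> 0} \<subseteq> {x. l < \<bar>f x\<bar>}"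
    proof
      fix x assume "x \<in> {x. g x \<noteq> 0}"
      then have "\<not> \<bar>f x / l\<bar> \<le> 1" using cutoff_eq_0 by (auto simp: g_def)
      then show "x \<in> {x. l < \<bar>f x\<bar>}" using l by (simp add: abs_divide)
    qed
    have [measurable]: "g \<in> borel_measurable borel"
      using s(2) by (rule borel_measurable_continuous_onI)
    have "measure lborel {x. g x \<noteq> 0} \<le> \<mu> l"
      unfolding \<mu>_def using fin[OF l] sub by (intro measure_mono_fmeasurable) (auto simp: fmeasurable_def)
    note fk = faber_krahn[OF g this pos]
    have "4 * \<mu> (2 * l) = (LBINT x. 4 * indicator {x. 2 * l < \<bar>f x\<bar>} x)"
      by (simp add: \<mu>_def)
    also have "\<dots> \<le> (LBINT x. (g x)\<^sup>2)"
    proof (rule integral_mono[OF _ g2])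
      show "integrable lborel (\<lambda>x. 4 * indicator {x. 2 * l < \<bar>f x\<bar>} x :: real)"
        using fin[of "2 * l"] l by (intro integrable_mult_right integrable_real_indicator) auto
      fix x
      have "g x = 2" if "2 * l < \<bar>f x\<bar>"
        unfolding g_def using l that by (intro cutoff_large) (simp add: abs_divide field_simps)
      then show "4 * indicator {x. 2 * l < \<bar>f x\<bar>} x \<le> (g x)\<^sup>2"
        by (auto simp: indicator_def)
    qed
    also note fk
    also have "dirichlet_energy Dg \<le> 64 / l\<^sup>2 * ?S"
      unfolding dirichlet_energy_def sum_distrib_left
    proof (rule sum_mono)
      fix b :: 'a assume b: "b \<in> Basis"
      have [measurable]: "D b \<in> borel_measurable borel"
        using r(4)[OF b] by (rule borel_measurable_continuous_onI)
      have iD: "integrable lborel (\<lambda>x. (D b x)\<^sup>2)"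
        using r(4)[OF b] r(5)[OF b] by (rule integrable_square_bounded_support)
      have "(LBINT x. (Dg b x)\<^sup>2)
          \<le> (LBINT x. 64 / l\<^sup>2 * ((D b x)\<^sup>2 * indicator {x. l < \<bar>f x\<bar> \<and> \<bar>f x\<bar> < 2 * l} x))"
      proof (rule integral_mono)
        have "continuous_on UNIV (Dg b)" "\<And>x. r < norm x \<Longrightarrow> Dg b x = 0"
          using g b r(5)[OF b] by (auto simp: C1c_def Dg_def)
        then show "integrable lborel (\<lambda>x. (Dg b x)\<^sup>2)"
          by (rule integrable_square_bounded_support)
        show "integrable lborel
            (\<lambda>x. 64 / l\<^sup>2 * ((D b x)\<^sup>2 * indicator {x. l < \<bar>f x\<bar> \<and> \<bar>f x\<bar> < 2 * l} x))"
          by (intro integrable_mult_right integrable_real_mult_indicator iD) measurable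
        fix x
        show "(Dg b x)\<^sup>2 \<le> 64 / l\<^sup>2 * ((D b x)\<^sup>2 * indicator {x. l < \<bar>f x\<bar> \<and> \<bar>f x\<bar> < 2 * l} x)"
        proof (cases "l < \<bar>f x\<bar> \<and> \<bar>f x\<bar> < 2 * l")
          case True
          have "(cutoff' (f x / l))\<^sup>2 \<le> 8\<^sup>2"
            using abs_cutoff'_le[of "f x / l"] by (metis abs_le_square_iff abs_numeral)
          then have "(cutoff' (f x / l))\<^sup>2 * ((D b x)\<^sup>2 / l\<^sup>2) \<le> 64 * ((D b x)\<^sup>2 / l\<^sup>2)"
            by (intro mult_right_mono) auto
          then show ?thesis using True
            by (simp add: Dg_def power_mult_distrib power_divide)
        next
          case False
          then have "\<bar>f x / l\<bar> \<le> 1 \<or> \<bar>f x / l\<bar> \<ge> 2" using l by (auto simp: abs_divide field_simps)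
          then show ?thesis using cutoff'_eq_0 cutoff'_large by (auto simp: Dg_def)
        qed
      qed
      also have "\<dots> = 64 / l\<^sup>2 * (LBINT x. (D b x)\<^sup>2 * indicator {x. l < \<bar>f x\<bar> \<and> \<bar>f x\<bar> < 2 * l} x)"
        by (rule integral_mult_right_zero)
      finally show "(LBINT x. (Dg b x)\<^sup>2)
        \<le> 64 / l\<^sup>2 * (LBINT x. (D b x)\<^sup>2 * indicator {x. l < \<bar>f x\<bar> \<and> \<bar>f x\<bar> < 2 * l} x)" .
    qed
    finally have "4 * \<mu> (2 * l) \<le> real DIM('a) * (2 * \<mu> l / unit_ball_vol (real DIM('a))) powr (2 / real DIM('a))
        * (64 / l\<^sup>2 * ?S)"
      by (simp add: mult_left_mono)
    also have "(2 * \<mu> l / unit_ball_vol (real DIM('a))) powr (2 / real DIM('a))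
        = (2 / unit_ball_vol (real DIM('a))) powr (2 / real DIM('a)) * \<mu> l powr (2 / real DIM('a))"
      using pos by (subst powr_mult[symmetric]) (auto simp: less_imp_le)
    also have "real DIM('a) * ((2 / unit_ball_vol (real DIM('a))) powr (2 / real DIM('a))
        * \<mu> l powr (2 / real DIM('a))) * (64 / l\<^sup>2 * ?S) = 4 * (?K * ?S)"
      using l by (simp add: field_simps)
    finally show ?thesis by simp
  qed
qed

lemma sum_dyadic_indicators_le_1:
  assumes "l 0 > (0::real)" and "\<And>j. l j = 2 * l (Suc j)"
  shows "(\<Sum>j<N. indicator {x. l (Suc j) < \<bar>f x\<bar> \<and> \<bar>f x\<bar> < 2 * l (Suc j)} x)
    \<le> (indicator {x. l N < \<bar>f x\<bar>} x :: real)"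
proof (induction N)
  case (Suc N)
  have pos: "l j > 0" for j
  proof (induction j)
    case (Suc j)
    then show ?case using assms(2)[of j] by simp
  qed (rule assms(1))
  have "indicator {x. l N < \<bar>f x\<bar>} x + indicator {x. l (Suc N) < \<bar>f x\<bar> \<and> \<bar>f x\<bar> < 2 * l (Suc N)} x
      \<le> (indicator {x. l (Suc N) < \<bar>f x\<bar>} x :: real)"
    using pos[of "Suc N"] assms(2)[of N] by (auto simp: indicator_def)
  with Suc.IH show ?case unfolding sum.lessThan_Suc by linarith
qed simp

lemma powr_le_dyadic_sum:
  fixes l :: "nat \<Rightarrow> real"
  assumes l: "\<And>j. l j \<ge> 0" and q: "q > 0" and "\<bar>y\<bar> \<le> l 0"
  shows "\<bar>y\<bar> powr q \<le> (\<Sum>j<N. l j powr q * of_bool (l (Suc j) < \<bar>y\<bar>)) + l N powr q * of_bool (y \<noteq> 0)"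
proof (induction N)
  case 0
  show ?case using assms by (auto intro: powr_mono2)
next
  case (Suc N)
  show ?case
  proof (cases "l (Suc N) < \<bar>y\<bar>")
    case True
    then show ?thesis using Suc l[of "Suc N"] by (auto simp: add_nonneg_nonneg intro: order_trans)
  next
    case False
    have "0 \<le> (\<Sum>j<Suc N. l j powr q * of_bool (l (Suc j) < \<bar>y\<bar>))"
      by (intro sum_nonneg) auto
    moreover have "\<bar>y\<bar> powr q \<le> l (Suc N) powr q * of_bool (y \<noteq> 0)"
      using False q by (auto intro: powr_mono2)
    ultimately show ?thesis by linarith
  qed
qed

text \<open>Put \<open>a j = l j ^ q * measure {l j < \<bar>f\<bar>}\<close> for the heights \<open>l j = L / 2 ^ j\<close>. By the choice of
\<open>q\<close>, the previous lemma becomes \<open>a j \<le> K * a (j + 1) ^ (2 / d) * b j\<close>, where the energies \<open>b j\<close> of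
the dyadic layers add up to at most \<open>E = dirichlet_energy D\<close>. Bounding \<open>a (j + 1)\<close> by the sum \<open>A\<close> of all
\<open>a j\<close> and summing over \<open>j\<close> yields \<open>A \<le> K * E * A ^ (2 / d)\<close>. Since \<open>2 / d < 1\<close> and \<open>A\<close> is finite, this
bounds \<open>A\<close>, and \<open>A\<close> bounds the integral of \<open>\<bar>f\<bar> ^ q\<close>.\<close>

lemma sobolev_C1c:
  fixes f :: "'a::euclidean_space \<Rightarrow> real"
  assumes f: "C1c f D" and dim: "DIM('a) \<ge> 3"
  defines "d \<equiv> real DIM('a)"
  defines "q \<equiv> 2 * d / (d - 2)"
  defines "K \<equiv> 2 powr q * (16 * d * (2 / unit_ball_vol d) powr (2 / d))"
  shows "(LBINT x. \<bar>f x\<bar> powr q) \<le> 2 powr q * (K * dirichlet_energy D) powr (q / 2)"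
proof -
  have d: "d \<ge> 3" using dim by (simp add: d_def)
  then have q: "q > 2" by (simp add: q_def field_simps)
  \<comment> \<open>the identity that makes the powers of \<open>l\<close> in \<open>rec\<close> match\<close>
  have qd: "q - 2 = q * (2 / d)" using d by (simp add: q_def field_simps)
  have K: "K \<ge> 0" unfolding K_def using d by simp
  obtain r where r: "r > 0" "continuous_on UNIV f" "\<And>x. r < norm x \<Longrightarrow> f x = 0"
    "\<And>b. b \<in> Basis \<Longrightarrow> continuous_on UNIV (D b)"
    "\<And>b x. b \<in> Basis \<Longrightarrow> r < norm x \<Longrightarrow> D b x = 0"
    using C1cE[OF f] by metis
  have [measurable]: "f \<in> borel_measurable borel"
    using r(2) by (rule borel_measurable_continuous_onI)
  obtain L where L: "L > 0" "\<And>x. \<bar>f x\<bar> \<le> L"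
    using bounded_of_bounded_support[OF r(2,3)] by blast
  define l where "l j = L / 2 ^ j" for j :: nat
  define \<mu> where "\<mu> l = measure lborel {x. l < \<bar>f x\<bar>}" for l
  define b where "b j = (\<Sum>b\<in>Basis. LBINT x. (D b x)\<^sup>2 *
    indicator {x. l (Suc j) < \<bar>f x\<bar> \<and> \<bar>f x\<bar> < 2 * l (Suc j)} x)" for j
  define a where "a j = l j powr q * \<mu> (l j)" for j
  define M where "M = measure lborel (cball (0::'a) r)"
  have l: "l j > 0" "l j = 2 * l (Suc j)" for j
    using L(1) by (simp_all add: l_def)
  have ball_fin: "emeasure lborel (cball (0::'a) r) < \<infinity>"
    by (rule emeasure_lborel_cball_finite)
  have sub: "{x. s < \<bar>f x\<bar>} \<subseteq> cball 0 r" if "s > 0" for s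
    using r(3) that by (force simp: not_le[symmetric])
  have fin: "emeasure lborel {x. s < \<bar>f x\<bar>} < \<infinity>" if "s > 0" for s
    using emeasure_mono[OF sub[OF that], of lborel] ball_fin by (auto simp: le_less_trans)
  have \<mu>M: "\<mu> s \<le> M" if "s > 0" for s
    unfolding \<mu>_def M_def using ball_fin sub[OF that]
    by (intro measure_mono_fmeasurable) (auto simp: fmeasurable_def)
  have \<mu>0: "0 \<le> \<mu> s" for s by (simp add: \<mu>_def)
  have M0: "0 \<le> M" by (simp add: M_def)
  have a0: "0 \<le> a j" for j by (simp add: a_def \<mu>_def)
  have b0: "0 \<le> b j" for j unfolding b_def by (intro sum_nonneg integral_nonneg_AE) auto
  have rec: "a j \<le> K * a (Suc j) powr (2 / d) * b j" for j
  proof -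
    let ?l = "l (Suc j)"
    have l': "?l > 0" by (rule l)
    have "\<mu> (2 * ?l) \<le> 16 * d * (2 / unit_ball_vol d) powr (2 / d) * \<mu> ?l powr (2 / d) / ?l\<^sup>2 * b j"
      unfolding \<mu>_def b_def d_def by (rule level_set_decay[OF f l'])
    then have "a j \<le> (2 * ?l) powr q *
        (16 * d * (2 / unit_ball_vol d) powr (2 / d) * \<mu> ?l powr (2 / d) / ?l\<^sup>2 * b j)"
      unfolding a_def l(2)[of j] by (intro mult_left_mono) auto
    also have "\<dots> = K * (?l powr (q - 2) * \<mu> ?l powr (2 / d)) * b j"
      using l' by (simp add: K_def powr_mult powr_diff)
    also have "?l powr (q - 2) * \<mu> ?l powr (2 / d) = a (Suc j) powr (2 / d)"
      unfolding qd a_def using l' \<mu>0 by (simp add: powr_mult powr_powr)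
    finally show ?thesis .
  qed
  have sum_b: "(\<Sum>j<N. b j) \<le> dirichlet_energy D" for N
  proof -
    have "(\<Sum>j<N. b j) = (\<Sum>b\<in>Basis. \<Sum>j<N. LBINT x. (D b x)\<^sup>2 *
        indicator {x. l (Suc j) < \<bar>f x\<bar> \<and> \<bar>f x\<bar> < 2 * l (Suc j)} x)"
      unfolding b_def by (rule sum.swap)
    also have "\<dots> \<le> dirichlet_energy D"
      unfolding dirichlet_energy_def
    proof (rule sum_mono)
      fix b :: 'a assume b: "b \<in> Basis"
      let ?I = "\<lambda>j. indicator {x. l (Suc j) < \<bar>f x\<bar> \<and> \<bar>f x\<bar> < 2 * l (Suc j)} :: 'a \<Rightarrow> real"
      have iD: "integrable lborel (\<lambda>x. (D b x)\<^sup>2)"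
        using r(4)[OF b] r(5)[OF b] by (rule integrable_square_bounded_support)
      have iI: "integrable lborel (\<lambda>x. (D b x)\<^sup>2 * ?I j x)" for j
        by (intro integrable_real_mult_indicator iD) measurable
      have "(\<Sum>j<N. LBINT x. (D b x)\<^sup>2 * ?I j x) = (LBINT x. (D b x)\<^sup>2 * (\<Sum>j<N. ?I j x))"
        unfolding sum_distrib_left by (rule Bochner_Integration.integral_sum[symmetric, OF iI])
      also have "\<dots> \<le> (LBINT x. (D b x)\<^sup>2)"
      proof (rule integral_mono[OF _ iD])
        show "integrable lborel (\<lambda>x. (D b x)\<^sup>2 * (\<Sum>j<N. ?I j x))"
          unfolding sum_distrib_left by (intro Bochner_Integration.integrable_sum iI)
        fix x
        have "(\<Sum>j<N. ?I j x) \<le> indicator {x. l N < \<bar>f x\<bar>} x"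
          by (rule sum_dyadic_indicators_le_1) (rule l)+
        also have "\<dots> \<le> 1" by (simp add: indicator_def)
        finally show "(D b x)\<^sup>2 * (\<Sum>j<N. ?I j x) \<le> (D b x)\<^sup>2"
          by (simp add: mult_left_le)
      qed
      finally show "(\<Sum>j<N. LBINT x. (D b x)\<^sup>2 * ?I j x) \<le> (LBINT x. (D b x)\<^sup>2)" .
    qed
    finally show ?thesis .
  qed
  have l_lim: "(\<lambda>N. l N powr q * M) \<longlonglongrightarrow> 0"
  proof -
    have "l \<longlonglongrightarrow> 0"
      unfolding l_def[abs_def] using LIMSEQ_divide_realpow_zero[of 2 L] by simp
    then have "(\<lambda>N. l N powr q) \<longlonglongrightarrow> 0"
      using q l(1) by (intro tendsto_zero_powrI[where b = q]) (auto simp: less_imp_le)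
    then show ?thesis by (rule tendsto_mult_left_zero)
  qed
  have "summable a"
  proof (rule summable_comparison_test')
    show "summable (\<lambda>j. L powr q * M * (1 / 2) ^ j)"
      by (intro summable_mult summable_geometric) simp
    fix j :: nat assume "0 \<le> j"
    have "l j powr q = L powr q * ((1 / 2) ^ j) powr q"
      using L(1) by (simp add: l_def powr_mult powr_divide power_one_over divide_simps)
    also have "((1 / 2) ^ j) powr q \<le> ((1 / 2) ^ j) powr 1"
      using q by (intro powr_mono') (auto simp: power_le_one)
    also have "\<dots> = ((1 / 2 :: real) ^ j)" by simp
    finally have "l j powr q \<le> L powr q * (1 / 2) ^ j" by (simp add: mult_left_mono)
    then have "a j \<le> L powr q * (1 / 2) ^ j * M"
      unfolding a_def using \<mu>M[OF l(1)] \<mu>0 L(1) by (intro mult_mono) auto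
    then show "norm (a j) \<le> L powr q * M * (1 / 2) ^ j"
      using a0 by (simp add: mult_ac)
  qed
  define A where "A = (\<Sum>j. a j)"
  have aA: "a j \<le> A" for j
    unfolding A_def using sum_le_suminf[OF \<open>summable a\<close>, of "{j}"] a0 by simp
  have A0: "A \<ge> 0" using aA[of 0] a0[of 0] by simp
  have E0: "dirichlet_energy D \<ge> 0" by (rule dirichlet_energy_nonneg)
  have "A \<le> K * dirichlet_energy D * A powr (2 / d)"
    unfolding A_def
  proof (rule suminf_le_const[OF \<open>summable a\<close>])
    fix N
    have "(\<Sum>j<N. a j) \<le> (\<Sum>j<N. K * A powr (2 / d) * b j)"
    proof (rule sum_mono)
      fix j
      have "K * a (Suc j) powr (2 / d) * b j \<le> K * A powr (2 / d) * b j"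
        using aA a0 b0 K d by (intro mult_right_mono mult_left_mono powr_mono2) auto
      with rec[of j] show "a j \<le> K * A powr (2 / d) * b j" by linarith
    qed
    also have "\<dots> = K * A powr (2 / d) * (\<Sum>j<N. b j)" by (simp add: sum_distrib_left)
    also have "\<dots> \<le> K * A powr (2 / d) * dirichlet_energy D"
      using sum_b K by (intro mult_left_mono) auto
    finally show "(\<Sum>j<N. a j) \<le> K * dirichlet_energy D * suminf a powr (2 / d)"
      by (simp add: A_def mult_ac)
  qed
  then have A_le: "A \<le> (K * dirichlet_energy D) powr (q / 2)"
  proof (cases "A = 0")
    case False
    with A0 have A: "A > 0" by simp
    assume *: "A \<le> K * dirichlet_energy D * A powr (2 / d)"
    have "A powr (1 - 2 / d) = A / A powr (2 / d)" using A by (simp add: powr_diff)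
    also have "\<dots> \<le> K * dirichlet_energy D" using * A by (simp add: field_simps)
    finally have "(A powr (1 - 2 / d)) powr (q / 2) \<le> (K * dirichlet_energy D) powr (q / 2)"
      using q by (intro powr_mono2) auto
    moreover have "(1 - 2 / d) * (q / 2) = 1" using d by (simp add: q_def field_simps)
    ultimately show ?thesis using A by (simp add: powr_powr)
  qed simp
  define S where "S = (LBINT x. \<bar>f x\<bar> powr q)"
  have iq: "integrable lborel (\<lambda>x. \<bar>f x\<bar> powr q)"
    using q r(3)
    by (intro integrable_bounded_support[where r = r] continuous_on_powr' continuous_intros r(2)) auto
  have bound: "S \<le> 2 powr q * A + l N powr q * M" for N
  proof -
    have il: "integrable lborel (\<lambda>x. l j powr q * indicator {x. l (Suc j) < \<bar>f x\<bar>} x)" for j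
      using fin[OF l(1), of "Suc j"] by (intro integrable_mult_right integrable_real_indicator) auto
    have ib: "integrable lborel (\<lambda>x. l N powr q * indicator (cball (0::'a) r) x)"
      using ball_fin by (intro integrable_mult_right integrable_real_indicator) auto
    have "S \<le> (LBINT x. (\<Sum>j<N. l j powr q * indicator {x. l (Suc j) < \<bar>f x\<bar>} x)
        + l N powr q * indicator (cball 0 r) x)"
      unfolding S_def
    proof (rule integral_mono[OF iq])
      show "integrable lborel (\<lambda>x. (\<Sum>j<N. l j powr q * indicator {x. l (Suc j) < \<bar>f x\<bar>} x)
          + l N powr q * indicator (cball 0 r) x)"
        by (intro Bochner_Integration.integrable_add Bochner_Integration.integrable_sum il ib)
      fix x
      have "\<bar>f x\<bar> powr q \<le> (\<Sum>j<N. l j powr q * of_bool (l (Suc j) < \<bar>f x\<bar>)) + l N powr q * of_bool (f x \<noteq> 0)"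
        using L(2)[of x] q l(1) by (intro powr_le_dyadic_sum) (auto simp: less_imp_le l_def)
      also have "\<dots> \<le> (\<Sum>j<N. l j powr q * indicator {x. l (Suc j) < \<bar>f x\<bar>} x)
          + l N powr q * indicator (cball 0 r) x"
        using r(3)[of x] by (intro add_mono sum_mono mult_left_mono) (auto simp: indicator_def intro: leI)
      finally show "\<bar>f x\<bar> powr q \<le> (\<Sum>j<N. l j powr q * indicator {x. l (Suc j) < \<bar>f x\<bar>} x)
          + l N powr q * indicator (cball 0 r) x" .
    qed
    also have "\<dots> = (\<Sum>j<N. l j powr q * \<mu> (l (Suc j))) + l N powr q * M"
      unfolding Bochner_Integration.integral_add[OF Bochner_Integration.integrable_sum[OF il] ib]
        Bochner_Integration.integral_sum[OF il] integral_mult_right_zero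
      by (simp add: M_def \<mu>_def)
    also have "(\<Sum>j<N. l j powr q * \<mu> (l (Suc j))) = 2 powr q * (\<Sum>j<N. a (Suc j))"
      unfolding sum_distrib_left a_def
    proof (rule sum.cong[OF refl])
      fix j
      have "l j powr q = 2 powr q * l (Suc j) powr q"
        unfolding l(2)[of j] using l(1)[of "Suc j"] by (simp add: powr_mult)
      then show "l j powr q * \<mu> (l (Suc j)) = 2 powr q * (l (Suc j) powr q * \<mu> (l (Suc j)))" by simp
    qed
    also have "(\<Sum>j<N. a (Suc j)) \<le> A"
    proof -
      have "(\<Sum>j<N. a (Suc j)) \<le> (\<Sum>j<Suc N. a j)"
        unfolding sum.lessThan_Suc_shift using a0[of 0] by simp
      also have "\<dots> \<le> A" unfolding A_def using a0 \<open>summable a\<close> by (intro sum_le_suminf) auto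
      finally show ?thesis .
    qed
    finally show ?thesis by (simp add: mult_left_mono)
  qed
  have "S \<le> 2 powr q * A + 0"
  proof (rule tendsto_lowerbound)
    show "(\<lambda>N. 2 powr q * A + l N powr q * M) \<longlonglongrightarrow> 2 powr q * A + 0"
      by (intro tendsto_add tendsto_const l_lim)
  qed (use bound in auto)
  also have "\<dots> \<le> 2 powr q * (K * dirichlet_energy D) powr (q / 2)"
    using A_le by simp
  finally show ?thesis by (simp add: S_def)
qed

section \<open>The optimal constants\<close>

lemma integral_pos_continuous:
  fixes h :: "'a::euclidean_space \<Rightarrow> real"
  assumes "integrable lborel h" and "\<And>x. 0 \<le> h x" and "open U" and "continuous_on U h"
    and "x0 \<in> U" and "h x0 \<noteq> 0"
  shows "0 < (LBINT x. h x)"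
proof (rule ccontr)
  assume "\<not> 0 < (LBINT x. h x)"
  moreover have "0 \<le> (LBINT x. h x)" by (rule integral_nonneg_AE) (use assms(2) in auto)
  ultimately have "(LBINT x. h x) = 0" by simp
  then have "AE x in lborel. h x = 0"
    using assms(1,2) by (subst (asm) integral_nonneg_eq_0_iff_AE) auto
  then have "AE x in lebesgue. h x = 0" by (rule AE_completion)
  then have "negligible {x. h x \<noteq> 0}"
    unfolding negligible_iff_null_sets eventually_ae_filter
    by (auto intro: null_sets_completion_subset)
  moreover have "open (U \<inter> h -` (- {0}))"
    using assms(3,4) by (intro continuous_open_preimage) auto
  moreover have "U \<inter> h -` (- {0}) \<subseteq> {x. h x \<noteq> 0}" by auto
  ultimately have "U \<inter> h -` (- {0}) = {}"
    using negligible_subset open_not_negligible by metis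
  with assms(5,6) show False by auto
qed

lemma partial_eq_0_off_support:
  fixes f :: "'a::euclidean_space \<Rightarrow> real"
  assumes "((\<lambda>h. f (x + h *\<^sub>R b)) has_real_derivative D) (at 0)"
    and "x \<notin> closure {x. f x \<noteq> 0}"
  shows "D = 0"
proof -
  let ?U = "- closure {x. f x \<noteq> 0}"
  have 0: "f y = 0" if "y \<in> ?U" for y
    using that closure_subset[of "{x. f x \<noteq> 0}"] by auto
  have "\<forall>\<^sub>F h in nhds 0. x + h *\<^sub>R b \<in> ?U"
    by (rule eventually_line_in_open) (use assms(2) in auto)
  then have "\<forall>\<^sub>F h in nhds 0. f (x + h *\<^sub>R b) = 0"
    by eventually_elim (rule 0)
  then have "((\<lambda>h. f (x + h *\<^sub>R b)) has_real_derivative 0) (at 0)"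
    by (subst DERIV_cong_ev[OF refl _ refl]) auto
  with assms(1) show ?thesis by (rule DERIV_unique)
qed

lemma C1c_dir_deriv:
  assumes "C1c f D" and "b \<in> Basis"
  shows "dir_deriv b f = D b"
  using assms by (auto simp: fun_eq_iff C1c_def dir_deriv_def intro!: DERIV_imp_deriv)

lemma test_function_C1c:
  assumes "test_function S f"
  shows "C1c f (\<lambda>b. dir_deriv b f)"
proof -
  have f: "continuous_on UNIV f" and cp: "compact (closure {x. f x \<noteq> 0})"
    and P: "\<forall>b\<in>Basis. \<exists>g. (\<forall>x. ((\<lambda>h. f (x + h *\<^sub>R b)) has_real_derivative g x) (at 0)) \<and> continuous_on UNIV g"
    using assms by (auto simp: test_function_def)
  obtain r where r: "\<And>x. f x \<noteq> 0 \<Longrightarrow> norm x \<le> r"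
    using compact_imp_bounded[OF cp] closure_subset[of "{x. f x \<noteq> 0}"] unfolding bounded_iff by blast
  obtain D where D: "\<And>b. b \<in> Basis \<Longrightarrow> (\<forall>x. ((\<lambda>h. f (x + h *\<^sub>R b)) has_real_derivative D b x) (at 0))
      \<and> continuous_on UNIV (D b)"
    using bchoice[OF P] by blast
  have "C1c f D"
    unfolding C1c_def using f D r by (meson not_le)
  then show ?thesis
    using C1c_dir_deriv[of f D] by (simp add: C1c_def)
qed

lemma test_function_support: "test_function S f \<Longrightarrow> f x \<noteq> 0 \<Longrightarrow> x \<in> S"
  using closure_subset[of "{x. f x \<noteq> 0}"] by (auto simp: test_function_def)

lemma C1c_test_function:
  assumes "C1c f D" and "closure {x. f x \<noteq> 0} \<subseteq> S"
  shows "test_function S f"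
proof -
  obtain r where r: "continuous_on UNIV f" "\<And>x. r < norm x \<Longrightarrow> f x = 0"
    using C1cE[OF assms(1)] by metis
  have "bounded {x. f x \<noteq> 0}"
    unfolding bounded_iff using r(2) by (metis linorder_not_le mem_Collect_eq)
  then have "compact (closure {x. f x \<noteq> 0})" by (simp add: compact_closure)
  moreover have "Ck_on 1 UNIV f"
    using assms(1) by (auto simp: C1c_def)
  ultimately show ?thesis using assms(2) by (simp add: test_function_def)
qed

lemma grad_inner_Basis: "b \<in> Basis \<Longrightarrow> grad f x \<bullet> b = dir_deriv b f x"
  by (simp add: grad_def inner_sum_left_Basis)

lemma norm_grad_square: "(norm (grad f x))\<^sup>2 = (\<Sum>b\<in>Basis. (dir_deriv b f x)\<^sup>2)"
  by (subst norm_eq_sqrt_inner, subst euclidean_inner)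
    (simp add: grad_inner_Basis sum_nonneg power2_eq_square)

lemma continuous_grad:
  assumes "test_function S f"
  shows "continuous_on UNIV (grad f)"
  using test_function_C1c[OF assms] unfolding grad_def[abs_def] C1c_def
  by (auto intro!: continuous_intros)

lemma grad_support:
  assumes "test_function S f" and "grad f x \<noteq> 0"
  shows "x \<in> closure {x. f x \<noteq> 0}"
proof (rule ccontr)
  assume x: "x \<notin> closure {x. f x \<noteq> 0}"
  have "dir_deriv b f x = 0" if "b \<in> Basis" for b
    using test_function_C1c[OF assms(1)] that x
    by (intro partial_eq_0_off_support[where f = f and b = b and x = x]) (auto simp: C1c_def)
  with assms(2) show False by (simp add: grad_def)
qed

lemma set_integral_lebesgue_eq_lborel:
  fixes h :: "'a::euclidean_space \<Rightarrow> real"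
  assumes "h \<in> borel_measurable borel" and "\<And>x. x \<notin> S \<Longrightarrow> h x = 0"
  shows "set_lebesgue_integral lebesgue S h = (LBINT x. h x)"
proof -
  have "(\<lambda>x. indicator S x *\<^sub>R h x) = h"
    using assms(2) by (auto simp: fun_eq_iff indicator_def)
  then show ?thesis
    using assms(1) by (simp add: set_lebesgue_integral_def integral_completion)
qed

lemma Lp_norm_continuous:
  fixes g :: "'a::euclidean_space \<Rightarrow> 'b::euclidean_space"
  assumes "continuous_on UNIV g" and "\<And>x. g x \<noteq> 0 \<Longrightarrow> x \<in> S"
  shows "Lp_norm p S g = (LBINT x. norm (g x) powr p) powr (1 / p)"
proof -
  have [measurable]: "g \<in> borel_measurable borel"
    using assms(1) by (rule borel_measurable_continuous_onI)
  show ?thesis unfolding Lp_norm_def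
    by (subst set_integral_lebesgue_eq_lborel) (use assms(2) in auto)
qed

lemma Lp_norm_2: "Lp_norm 2 S g = sqrt (set_lebesgue_integral lebesgue S (\<lambda>x. (norm (g x))\<^sup>2))"
proof -
  have "0 \<le> set_lebesgue_integral lebesgue S (\<lambda>x. (norm (g x))\<^sup>2)"
    unfolding set_lebesgue_integral_def by (rule integral_nonneg_AE) auto
  then show ?thesis by (simp add: Lp_norm_def powr_half_sqrt)
qed

lemma Lp_norm_2_test_function:
  fixes f :: "'a::euclidean_space \<Rightarrow> real"
  assumes "test_function S f"
  shows "Lp_norm 2 S f = sqrt (LBINT x. (f x)\<^sup>2)"
    and "Lp_norm 2 S (grad f) = sqrt (dirichlet_energy (\<lambda>b. dir_deriv b f))"
proof -
  obtain r where r: "continuous_on UNIV f" "\<And>x. r < norm x \<Longrightarrow> f x = 0"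
    "\<And>b. b \<in> Basis \<Longrightarrow> continuous_on UNIV (dir_deriv b f)"
    "\<And>b x. b \<in> Basis \<Longrightarrow> r < norm x \<Longrightarrow> dir_deriv b f x = 0"
    using C1cE[OF test_function_C1c[OF assms]] by metis
  have [measurable]: "f \<in> borel_measurable borel" "grad f \<in> borel_measurable borel"
    using r(1) continuous_grad[OF assms] by (auto intro: borel_measurable_continuous_onI)
  show "Lp_norm 2 S f = sqrt (LBINT x. (f x)\<^sup>2)"
    unfolding Lp_norm_2
    by (subst set_integral_lebesgue_eq_lborel) (use test_function_support[OF assms] in auto)
  have "grad f x = 0" if "x \<notin> S" for x
    using grad_support[OF assms, of x] assms that by (auto simp: test_function_def)
  then have "Lp_norm 2 S (grad f) = sqrt (LBINT x. (norm (grad f x))\<^sup>2)"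
    unfolding Lp_norm_2 by (subst set_integral_lebesgue_eq_lborel) auto
  also have "(LBINT x. (norm (grad f x))\<^sup>2) = dirichlet_energy (\<lambda>b. dir_deriv b f)"
    unfolding norm_grad_square dirichlet_energy_def
    by (intro Bochner_Integration.integral_sum integrable_square_bounded_support[where r = r] r)
  finally show "Lp_norm 2 S (grad f) = sqrt (dirichlet_energy (\<lambda>b. dir_deriv b f))" .
qed

lemma Lp_space_2_continuous:
  fixes g :: "'a::euclidean_space \<Rightarrow> 'b::euclidean_space"
  assumes "continuous_on UNIV g" and "\<And>x. r < norm x \<Longrightarrow> g x = 0" and "S \<in> sets borel"
  shows "g \<in> Lp_space 2 S"
proof -
  have [measurable]: "g \<in> borel_measurable borel"
    using assms(1) by (rule borel_measurable_continuous_onI)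
  have gl: "g \<in> borel_measurable lebesgue" by (rule measurable_completion) simp
  have Sl: "S \<in> sets lebesgue" using assms(3) by (simp add: sets_completionI_sets)
  have "integrable lborel (\<lambda>x. (norm (g x))\<^sup>2)"
    by (rule integrable_square_bounded_support[where r = r]) (use assms in \<open>auto intro!: continuous_intros\<close>)
  then have "integrable lebesgue (\<lambda>x. (norm (g x))\<^sup>2)"
    by (subst integrable_completion) auto
  then have "set_integrable lebesgue S (\<lambda>x. (norm (g x))\<^sup>2)"
    unfolding set_integrable_def by (rule integrable_mult_indicator[OF Sl])
  moreover have "set_borel_measurable lebesgue S g"
    unfolding set_borel_measurable_def using gl Sl by (intro borel_measurable_scaleR) auto
  ultimately show ?thesis by (simp add: Lp_space_def)
qed

lemma Lp_norm_2_square_le: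
  fixes u v :: "'a::euclidean_space \<Rightarrow> 'b::euclidean_space"
  assumes "u \<in> Lp_space 2 S" and "v \<in> Lp_space 2 S"
  shows "(Lp_norm 2 S u)\<^sup>2 \<le> 2 * (Lp_norm 2 S v)\<^sup>2 + 2 * (Lp_norm 2 S (\<lambda>x. v x - u x))\<^sup>2"
proof -
  define U where "U x = indicator S x *\<^sub>R u x" for x
  define V where "V x = indicator S x *\<^sub>R v x" for x
  have sq: "(Lp_norm 2 S g)\<^sup>2 = (\<integral>x. (norm (indicator S x *\<^sub>R g x))\<^sup>2 \<partial>lebesgue)"
    for g :: "'a \<Rightarrow> 'b"
  proof -
    have "set_lebesgue_integral lebesgue S (\<lambda>x. (norm (g x))\<^sup>2)
        = (\<integral>x. (norm (indicator S x *\<^sub>R g x))\<^sup>2 \<partial>lebesgue)"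
      unfolding set_lebesgue_integral_def
      by (intro arg_cong[where f = "integral\<^sup>L lebesgue"]) (auto simp: indicator_def)
    then show ?thesis by (simp add: Lp_norm_2 integral_nonneg_AE)
  qed
  have eq: "(\<lambda>x. indicator S x *\<^sub>R (norm (g x) powr 2)) = (\<lambda>x. (norm (indicator S x *\<^sub>R g x))\<^sup>2)"
    for g :: "'a \<Rightarrow> 'b"
    by (auto simp: indicator_def)
  have [measurable]: "U \<in> borel_measurable lebesgue" "V \<in> borel_measurable lebesgue"
    using assms by (auto simp: U_def[abs_def] V_def[abs_def] Lp_space_def set_borel_measurable_def)
  have iU: "integrable lebesgue (\<lambda>x. (norm (U x))\<^sup>2)" and iV: "integrable lebesgue (\<lambda>x. (norm (V x))\<^sup>2)"
    using assms unfolding U_def V_def Lp_space_def set_integrable_def eq by auto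
  have 1: "(norm (a + b))\<^sup>2 \<le> 2 * (norm a)\<^sup>2 + 2 * (norm b)\<^sup>2" for a b :: 'b
  proof -
    have "(norm (a + b))\<^sup>2 \<le> (norm a + norm b)\<^sup>2"
      by (intro power_mono norm_triangle_ineq) auto
    also have "\<dots> \<le> 2 * (norm a)\<^sup>2 + 2 * (norm b)\<^sup>2"
      using zero_le_power2[of "norm a - norm b"] by (simp add: power2_eq_square algebra_simps)
    finally show ?thesis .
  qed
  have iD: "integrable lebesgue (\<lambda>x. (norm (V x - U x))\<^sup>2)"
  proof (rule Bochner_Integration.integrable_bound)
    show "integrable lebesgue (\<lambda>x. 2 * (norm (V x))\<^sup>2 + 2 * (norm (U x))\<^sup>2)"
      using iU iV by simp
    show "AE x in lebesgue. norm ((norm (V x - U x))\<^sup>2) \<le> norm (2 * (norm (V x))\<^sup>2 + 2 * (norm (U x))\<^sup>2)"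
      using 1[of "V x" "- U x" for x] by (intro AE_I2) simp
  qed measurable
  have "(\<integral>x. (norm (U x))\<^sup>2 \<partial>lebesgue) \<le> (\<integral>x. 2 * (norm (V x))\<^sup>2 + 2 * (norm (V x - U x))\<^sup>2 \<partial>lebesgue)"
    using iU iV iD 1[of "V x" "U x - V x" for x]
    by (intro integral_mono) (auto simp: norm_minus_commute)
  also have "\<dots> = 2 * (\<integral>x. (norm (V x))\<^sup>2 \<partial>lebesgue) + 2 * (\<integral>x. (norm (V x - U x))\<^sup>2 \<partial>lebesgue)"
    using iV iD by simp
  also have "(\<lambda>x. V x - U x) = (\<lambda>x. indicator S x *\<^sub>R (v x - u x))"
    by (simp add: V_def U_def scaleR_diff_right)
  finally show ?thesis unfolding sq U_def V_def by (simp add: scaleR_diff_right)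
qed

text \<open>An inequality that is closed in its constant passes to the infimum of the admissible
constants.\<close>

lemma Inf_admissible_constant:
  fixes N M :: "'i \<Rightarrow> real" and P :: "'i \<Rightarrow> bool"
  defines "A \<equiv> {C. 0 \<le> C \<and> (\<forall>i. P i \<longrightarrow> N i \<le> C * M i)}"
  assumes "A \<noteq> {}" and "\<And>i. P i \<Longrightarrow> 0 \<le> M i"
  shows "\<And>i. P i \<Longrightarrow> N i \<le> Inf A * M i" and "\<And>i. P i \<Longrightarrow> 0 < N i \<Longrightarrow> 0 < Inf A"
proof -
  show *: "N i \<le> Inf A * M i" if "P i" for i
  proof (cases "M i = 0")
    case True
    obtain C where "C \<in> A" using assms(2) by auto
    then have "N i \<le> C * M i" using that by (auto simp: A_def)
    then show ?thesis using True by simp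
  next
    case False
    then have M: "M i > 0" using assms(3)[OF that] by simp
    have "N i / M i \<le> Inf A"
      using assms(2) M that by (intro cInf_greatest) (auto simp: A_def field_simps)
    then show ?thesis using M by (simp add: field_simps)
  qed
  show "0 < Inf A" if "P i" "0 < N i" for i
  proof -
    have "0 < Inf A * M i" using *[OF that(1)] that(2) by simp
    then show ?thesis using assms(3)[OF that(1)] by (auto simp: zero_less_mult_iff)
  qed
qed

lemma Lp_space_2_test_function:
  assumes "test_function S f" and "S \<in> sets borel"
  shows "f \<in> Lp_space 2 S" and "grad f \<in> Lp_space 2 S"
proof -
  obtain r where r: "continuous_on UNIV f" "\<And>x. r < norm x \<Longrightarrow> f x = 0"
    "\<And>b x. b \<in> Basis \<Longrightarrow> r < norm x \<Longrightarrow> dir_deriv b f x = 0"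
    using C1cE[OF test_function_C1c[OF assms(1)]] by metis
  show "f \<in> Lp_space 2 S"
    using r(1,2) assms(2) by (rule Lp_space_2_continuous)
  have "grad f x = 0" if "r < norm x" for x
    using r(3) that by (simp add: grad_def)
  with continuous_grad[OF assms(1)] show "grad f \<in> Lp_space 2 S"
    using assms(2) by (rule Lp_space_2_continuous)
qed

lemma W12_0_test_function:
  assumes "test_function S f" and "S \<in> sets borel"
  shows "W12_0 S f (grad f)"
  unfolding W12_0_def
  using assms Lp_space_2_test_function[OF assms]
  by (auto intro!: exI[of _ "\<lambda>_. f"] simp: Lp_norm_2)

text \<open>Any constant would do: the lemma shows that the infimum defining \<open>poincare_const\<close> is taken over
a nonempty set.\<close>

lemma poincare_W12_0_unit_ball:
  fixes f :: "'a::euclidean_space \<Rightarrow> real"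
  assumes "W12_0 (ball 0 1) f g"
  shows "Lp_norm 2 (ball 0 1) f \<le> sqrt 8 * Lp_norm 2 (ball 0 1) g"
proof -
  let ?N = "\<lambda>h :: 'a \<Rightarrow> real. Lp_norm 2 (ball 0 1) h" and ?N' = "\<lambda>h :: 'a \<Rightarrow> 'a. Lp_norm 2 (ball 0 1) h"
  obtain \<phi> where fg: "f \<in> Lp_space 2 (ball 0 1)" "g \<in> Lp_space 2 (ball 0 1)"
    and \<phi>: "\<And>n. test_function (ball 0 1) (\<phi> n)"
    and lim: "(\<lambda>n. ?N (\<lambda>x. \<phi> n x - f x)) \<longlonglongrightarrow> 0" "(\<lambda>n. ?N' (\<lambda>x. grad (\<phi> n) x - g x)) \<longlonglongrightarrow> 0"
    using assms unfolding W12_0_def by blast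
  have B: "ball (0::'a) 1 \<in> sets borel" by simp
  have est: "(?N f)\<^sup>2 \<le> 8 * (?N' g)\<^sup>2
      + (8 * (?N' (\<lambda>x. grad (\<phi> n) x - g x))\<^sup>2 + 2 * (?N (\<lambda>x. \<phi> n x - f x))\<^sup>2)" for n
  proof -
    note sp = Lp_space_2_test_function[OF \<phi> B, of n]
    have "(?N f)\<^sup>2 \<le> 2 * (?N (\<phi> n))\<^sup>2 + 2 * (?N (\<lambda>x. \<phi> n x - f x))\<^sup>2"
      by (rule Lp_norm_2_square_le[OF fg(1) sp(1)])
    moreover have "(?N (\<phi> n))\<^sup>2 \<le> 2 * (?N' (grad (\<phi> n)))\<^sup>2"
      using poincare_C1c[OF test_function_C1c[OF \<phi>], of n] test_function_support[OF \<phi>, of n]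
      by (simp add: Lp_norm_2_test_function[OF \<phi>] dirichlet_energy_nonneg integral_nonneg_AE)
    moreover have "(?N' (grad (\<phi> n)))\<^sup>2 \<le> 2 * (?N' g)\<^sup>2 + 2 * (?N' (\<lambda>x. g x - grad (\<phi> n) x))\<^sup>2"
      by (rule Lp_norm_2_square_le[OF sp(2) fg(2)])
    moreover have "?N' (\<lambda>x. g x - grad (\<phi> n) x) = ?N' (\<lambda>x. grad (\<phi> n) x - g x)"
      by (simp add: Lp_norm_def norm_minus_commute)
    ultimately show ?thesis by simp
  qed
  have "(?N f)\<^sup>2 \<le> 8 * (?N' g)\<^sup>2 + (8 * 0\<^sup>2 + 2 * 0\<^sup>2)"
  proof (rule tendsto_lowerbound)
    show "(\<lambda>n. 8 * (?N' g)\<^sup>2 + (8 * (?N' (\<lambda>x. grad (\<phi> n) x - g x))\<^sup>2 + 2 * (?N (\<lambda>x. \<phi> n x - f x))\<^sup>2))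
        \<longlonglongrightarrow> 8 * (?N' g)\<^sup>2 + (8 * 0\<^sup>2 + 2 * 0\<^sup>2)"
      by (intro tendsto_intros lim)
  qed (use est in auto)
  then have "(?N f)\<^sup>2 \<le> (sqrt 8 * ?N' g)\<^sup>2" by (simp add: power_mult_distrib)
  then show ?thesis
    by (rule power2_le_imp_le) (simp add: Lp_norm_def)
qed

lemma sobolev_test_function:
  fixes f :: "'a::euclidean_space \<Rightarrow> real"
  assumes dim: "DIM('a) \<ge> 3"
  defines "s \<equiv> 2 * real DIM('a) / (real DIM('a) - 2)"
  obtains C where "C \<ge> 0" and
    "\<And>f :: 'a \<Rightarrow> real. test_function UNIV f \<Longrightarrow> Lp_norm s UNIV f \<le> C * Lp_norm 2 UNIV (grad f)"
proof -
  define K where "K = 2 powr s * (16 * real DIM('a) * (2 / unit_ball_vol (real DIM('a))) powr (2 / real DIM('a)))"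
  have s: "s > 2" using dim by (simp add: s_def field_simps)
  have K: "K \<ge> 0" by (simp add: K_def)
  have "Lp_norm s UNIV f \<le> 2 * sqrt K * Lp_norm 2 UNIV (grad f)" if f: "test_function UNIV f" for f :: "'a \<Rightarrow> real"
  proof -
    let ?E = "dirichlet_energy (\<lambda>b. dir_deriv b f)"
    note E0 = dirichlet_energy_nonneg[of "\<lambda>b. dir_deriv b f"]
    have f': "C1c f (\<lambda>b. dir_deriv b f)" using f by (rule test_function_C1c)
    then have "continuous_on UNIV f" by (simp add: C1c_def)
    then have "Lp_norm s UNIV f = (LBINT x. \<bar>f x\<bar> powr s) powr (1 / s)"
      by (subst Lp_norm_continuous) auto
    also have "\<dots> \<le> (2 powr s * (K * ?E) powr (s / 2)) powr (1 / s)"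
      using sobolev_C1c[OF f' dim, folded s_def, folded K_def] s
      by (intro powr_mono2) (auto intro: integral_nonneg_AE)
    also have "\<dots> = 2 * sqrt (K * ?E)"
      using s K E0 by (simp add: powr_mult powr_powr powr_half_sqrt real_sqrt_mult)
    also have "\<dots> = 2 * sqrt K * Lp_norm 2 UNIV (grad f)"
      by (simp add: Lp_norm_2_test_function[OF f] real_sqrt_mult)
    finally show ?thesis .
  qed
  then show ?thesis using that[of "2 * sqrt K"] K by simp
qed

text \<open>A witness for the positivity of the two optimal constants.\<close>

lemma nonzero_test_function:
  obtains f :: "'a::euclidean_space \<Rightarrow> real" where "test_function (ball 0 1) f" and "f 0 \<noteq> 0"
proof
  let ?f = "\<lambda>x::'a. (max 0 (1 / 4 - x \<bullet> x))\<^sup>2"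
  have sup: "norm x \<le> 1 / 2" if "?f x \<noteq> 0" for x
  proof -
    have "(norm x)\<^sup>2 \<le> (1 / 2)\<^sup>2"
      using that by (auto simp: power2_norm_eq_inner power_divide max_def split: if_splits)
    then show ?thesis by (rule power2_le_imp_le) simp
  qed
  have "C1c ?f (\<lambda>b x. 2 * max 0 (1 / 4 - x \<bullet> x) * (- 2 * (x \<bullet> b)))"
    unfolding C1c_def
  proof (intro conjI ballI allI exI[of _ "1 / 2"] impI)
    show "?f x = 0" if "1 / 2 < norm x" for x
      using sup[of x] that by linarith
    fix b :: 'a assume b: "b \<in> Basis"
    have d: "((\<lambda>h. 1 / 4 - (x + h *\<^sub>R b) \<bullet> (x + h *\<^sub>R b)) has_real_derivative - 2 * (x \<bullet> b)) (at 0)" for x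
      unfolding inner_add_left inner_add_right inner_scaleR_left inner_scaleR_right
      by (auto intro!: derivative_eq_intros simp: inner_commute)
    show "((\<lambda>h. ?f (x + h *\<^sub>R b)) has_real_derivative
        2 * max 0 (1 / 4 - x \<bullet> x) * (- 2 * (x \<bullet> b))) (at 0)" for x
      using DERIV_chain2[OF DERIV_max0_square d[of x]] by simp
  qed (intro continuous_intros)+
  moreover have "closure {x. ?f x \<noteq> 0} \<subseteq> cball 0 (1 / 2)"
    by (rule closure_minimal) (use sup in auto)
  then have "closure {x. ?f x \<noteq> 0} \<subseteq> ball 0 1" by (force simp: subset_iff)
  ultimately show "test_function (ball 0 1) ?f" by (rule C1c_test_function)
qed simp

lemma Lp_norm_pos:
  fixes f :: "'a::euclidean_space \<Rightarrow> real"
  assumes "test_function S f" and "f x0 \<noteq> 0" and "p > 0"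
  shows "0 < (LBINT x. \<bar>f x\<bar> powr p)" and "0 < Lp_norm p S f"
proof -
  obtain r where r: "continuous_on UNIV f" "\<And>x. r < norm x \<Longrightarrow> f x = 0"
    using C1cE[OF test_function_C1c[OF assms(1)]] by metis
  have c: "continuous_on UNIV (\<lambda>x. \<bar>f x\<bar> powr p)"
    using assms(3) by (intro continuous_on_powr' continuous_intros r) auto
  show "0 < (LBINT x. \<bar>f x\<bar> powr p)"
    using c r(2) assms(2)
    by (intro integral_pos_continuous[of _ UNIV x0] integrable_bounded_support[where r = r]) auto
  then show "0 < Lp_norm p S f"
    using Lp_norm_continuous[OF r(1), of S p] test_function_support[OF assms(1)] by simp
qed

lemma poincare_const_pos: "0 < poincare_const (ball (0::'a::euclidean_space) 1)"
  and poincare_const_bound: "W12_0 (ball (0::'a::euclidean_space) 1) f g \<Longrightarrow>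
    Lp_norm 2 (ball 0 1) f \<le> poincare_const (ball (0::'a) 1) * Lp_norm 2 (ball 0 1) g"
proof -
  let ?B = "ball (0::'a) 1"
  let ?P = "\<lambda>(f, g). W12_0 ?B f g"
  let ?A = "{C. 0 \<le> C \<and> (\<forall>i. ?P i \<longrightarrow> Lp_norm 2 ?B (fst i) \<le> C * Lp_norm 2 ?B (snd i))}"
  have eq: "poincare_const ?B = Inf ?A"
    unfolding poincare_const_def by (intro arg_cong[where f = Inf]) auto
  have "sqrt 8 \<in> ?A" using poincare_W12_0_unit_ball by auto
  then have ne: "?A \<noteq> {}" by blast
  have nn: "0 \<le> Lp_norm 2 ?B (snd i)" for i :: "('a \<Rightarrow> real) \<times> ('a \<Rightarrow> 'a)" by (simp add: Lp_norm_def)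
  obtain f :: "'a \<Rightarrow> real" where f: "test_function ?B f" "f 0 \<noteq> 0" by (rule nonzero_test_function)
  then have "W12_0 ?B f (grad f)" "0 < Lp_norm 2 ?B f"
    by (auto intro: W12_0_test_function Lp_norm_pos)
  then show "0 < poincare_const ?B"
    unfolding eq using Inf_admissible_constant(2)[OF ne nn, of "(f, grad f)"] by simp
  show "Lp_norm 2 ?B f \<le> poincare_const ?B * Lp_norm 2 ?B g" if "W12_0 ?B f g" for f g
    unfolding eq using Inf_admissible_constant(1)[OF ne nn, of "(f, g)"] that by simp
qed

lemma sobolev_const_pos: "DIM('a) \<ge> 3 \<Longrightarrow> 0 < sobolev_const TYPE('a::euclidean_space)"
  and sobolev_const_bound: "DIM('a) \<ge> 3 \<Longrightarrow> test_function UNIV f \<Longrightarrow>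
    Lp_norm (2 * real DIM('a) / (real DIM('a) - 2)) UNIV f
      \<le> sobolev_const TYPE('a) * Lp_norm 2 UNIV (grad (f :: 'a \<Rightarrow> real))"
proof -
  assume dim: "DIM('a) \<ge> 3"
  let ?s = "2 * real DIM('a) / (real DIM('a) - 2)"
  let ?A = "{C. 0 \<le> C \<and> (\<forall>f :: 'a \<Rightarrow> real. test_function UNIV f \<longrightarrow>
      Lp_norm ?s UNIV f \<le> C * Lp_norm 2 UNIV (grad f))}"
  have eq: "sobolev_const TYPE('a) = Inf ?A" unfolding sobolev_const_def ..
  obtain C where "C \<in> ?A" using sobolev_test_function[OF dim] by blast
  then have ne: "?A \<noteq> {}" by blast
  have nn: "0 \<le> Lp_norm 2 UNIV (grad f)" for f :: "'a \<Rightarrow> real" by (simp add: Lp_norm_def)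
  obtain f :: "'a \<Rightarrow> real" where f: "test_function (ball 0 1) f" "f 0 \<noteq> 0" by (rule nonzero_test_function)
  then have f': "test_function UNIV f" by (simp add: test_function_def)
  moreover have "0 < Lp_norm ?s UNIV f"
    using dim by (intro Lp_norm_pos[OF f' f(2)]) auto
  ultimately show "0 < sobolev_const TYPE('a)"
    unfolding eq by (rule Inf_admissible_constant(2)[OF ne nn])
  show "Lp_norm ?s UNIV f \<le> sobolev_const TYPE('a) * Lp_norm 2 UNIV (grad f)"
    if "test_function UNIV f" for f :: "'a \<Rightarrow> real"
    unfolding eq using that by (rule Inf_admissible_constant(1)[OF ne nn])
qed

lemma integral_lborel_affine:
  fixes f :: "'a::euclidean_space \<Rightarrow> real"
  assumes [measurable]: "f \<in> borel_measurable borel" and "\<rho> > 0"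
  shows "(LBINT x. f x) = \<rho> ^ DIM('a) * (LBINT x. f (c + \<rho> *\<^sub>R x))"
proof -
  have "(LBINT x. f x) = (\<integral>x. f x \<partial>density (distr lborel borel (\<lambda>x. c + \<rho> *\<^sub>R x)) (\<lambda>_. \<bar>\<rho>\<bar> ^ DIM('a)))"
    using lborel_affine[of \<rho> c] assms(2) by simp
  also have "\<dots> = \<rho> ^ DIM('a) * (LBINT x. f (c + \<rho> *\<^sub>R x))"
    using assms(2) by (subst integral_density) (auto simp: integral_distr)
  finally show ?thesis .
qed

text \<open>Scaling to the unit ball. The factors \<open>\<rho> ^ DIM('a)\<close> of both integrals cancel, and the gradient
contributes one factor \<open>\<rho>\<close>.\<close>

lemma poincare_test_function:
  fixes f :: "'a::euclidean_space \<Rightarrow> real"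
  assumes f: "test_function (ball c \<rho>) f" and \<rho>: "\<rho> > 0"
  shows "(LBINT x. (f x)\<^sup>2)
    \<le> (poincare_const (ball (0::'a) 1) * \<rho>)\<^sup>2 * dirichlet_energy (\<lambda>b. dir_deriv b f)"
proof -
  let ?P = "poincare_const (ball (0::'a) 1)"
  define g where "g x = f (c + \<rho> *\<^sub>R x)" for x
  obtain r where r: "r > 0" "continuous_on UNIV f" "\<And>x. r < norm x \<Longrightarrow> f x = 0"
    "\<And>b. b \<in> Basis \<Longrightarrow> continuous_on UNIV (dir_deriv b f)"
    "\<And>b x. b \<in> Basis \<Longrightarrow> ((\<lambda>h. f (x + h *\<^sub>R b)) has_real_derivative dir_deriv b f x) (at 0)"
    using C1cE[OF test_function_C1c[OF f]] by metis
  have Dg: "C1c g (\<lambda>b x. \<rho> * dir_deriv b f (c + \<rho> *\<^sub>R x))"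
    unfolding C1c_def
  proof (intro conjI ballI allI exI impI)
    show "continuous_on UNIV g"
      unfolding g_def by (intro continuous_on_compose2[OF r(2)] continuous_intros) auto
    show "g x = 0" if "(r + norm c) / \<rho> < norm x" for x
    proof -
      have "r + norm c < norm (\<rho> *\<^sub>R x)" using that \<rho> by (simp add: field_simps)
      also have "\<dots> \<le> norm (c + \<rho> *\<^sub>R x) + norm c"
        using norm_triangle_ineq4[of "c + \<rho> *\<^sub>R x" c] by simp
      finally show ?thesis unfolding g_def by (intro r(3)) simp
    qed
    fix b :: 'a assume b: "b \<in> Basis"
    show "continuous_on UNIV (\<lambda>x. \<rho> * dir_deriv b f (c + \<rho> *\<^sub>R x))"
      by (intro continuous_intros continuous_on_compose2[OF r(4)[OF b]]) auto
    show "((\<lambda>h. g (x + h *\<^sub>R b)) has_real_derivative \<rho> * dir_deriv b f (c + \<rho> *\<^sub>R x)) (at 0)" for x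
    proof -
      have "((\<lambda>h. f (c + \<rho> *\<^sub>R x + h *\<^sub>R b)) has_real_derivative dir_deriv b f (c + \<rho> *\<^sub>R x)) (at (\<rho> * 0))"
        using r(5)[OF b] by simp
      moreover have "((\<lambda>h. \<rho> * h) has_real_derivative \<rho>) (at 0)"
        by (auto intro!: derivative_eq_intros)
      ultimately have "((\<lambda>h. f (c + \<rho> *\<^sub>R x + (\<rho> * h) *\<^sub>R b)) has_real_derivative
          dir_deriv b f (c + \<rho> *\<^sub>R x) * \<rho>) (at 0)"
        by (rule DERIV_chain2)
      then show ?thesis by (simp add: g_def scaleR_add_right add.assoc mult.commute)
    qed
  qed
  have "closure {x. g x \<noteq> 0} \<subseteq> {x. c + \<rho> *\<^sub>R x \<in> closure {x. f x \<noteq> 0}}"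
  proof (rule closure_minimal)
    show "closed {x. c + \<rho> *\<^sub>R x \<in> closure {x. f x \<noteq> 0}}"
      using continuous_closed_vimage[of "closure {x. f x \<noteq> 0}" "\<lambda>x. c + \<rho> *\<^sub>R x"]
      by (simp add: vimage_def continuous_intros)
  qed (use closure_subset[of "{x. f x \<noteq> 0}"] in \<open>auto simp: g_def\<close>)
  also have "\<dots> \<subseteq> {x. c + \<rho> *\<^sub>R x \<in> ball c \<rho>}"
    using f by (auto simp: test_function_def)
  also have "\<dots> \<subseteq> ball 0 1"
    using \<rho> by (auto simp: dist_norm)
  finally have g: "test_function (ball 0 1) g" using Dg by (intro C1c_test_function)
  have "sqrt (LBINT x. (g x)\<^sup>2) \<le> ?P * sqrt (dirichlet_energy (\<lambda>b. dir_deriv b g))"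
    using poincare_const_bound[OF W12_0_test_function[OF g]]
    by (simp add: Lp_norm_2_test_function[OF g])
  then have "(sqrt (LBINT x. (g x)\<^sup>2))\<^sup>2 \<le> (?P * sqrt (dirichlet_energy (\<lambda>b. dir_deriv b g)))\<^sup>2"
    by (intro power_mono) (auto intro: integral_nonneg_AE)
  then have "(LBINT x. (g x)\<^sup>2) \<le> ?P\<^sup>2 * dirichlet_energy (\<lambda>b. dir_deriv b g)"
    by (simp add: power_mult_distrib integral_nonneg_AE dirichlet_energy_nonneg)
  then have "\<rho> ^ DIM('a) * (LBINT x. (g x)\<^sup>2) \<le> \<rho> ^ DIM('a) * (?P\<^sup>2 * dirichlet_energy (\<lambda>b. dir_deriv b g))"
    using \<rho> by (intro mult_left_mono) auto
  also have "\<rho> ^ DIM('a) * (LBINT x. (g x)\<^sup>2) = (LBINT x. (f x)\<^sup>2)"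
    unfolding g_def using \<rho> borel_measurable_continuous_onI[OF r(2)]
    by (subst integral_lborel_affine[where \<rho> = \<rho> and c = c]) auto
  also have "\<rho> ^ DIM('a) * (?P\<^sup>2 * dirichlet_energy (\<lambda>b. dir_deriv b g)) = (?P * \<rho>)\<^sup>2 * dirichlet_energy (\<lambda>b. dir_deriv b f)"
  proof -
    have "dirichlet_energy (\<lambda>b. dir_deriv b g) = \<rho>\<^sup>2 * (\<Sum>b\<in>Basis. LBINT x. (dir_deriv b f (c + \<rho> *\<^sub>R x))\<^sup>2)"
      unfolding dirichlet_energy_def sum_distrib_left
      by (intro sum.cong refl) (simp add: C1c_dir_deriv[OF Dg] power_mult_distrib)
    moreover have "\<rho> ^ DIM('a) * (\<Sum>b\<in>Basis. LBINT x. (dir_deriv b f (c + \<rho> *\<^sub>R x))\<^sup>2)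
        = dirichlet_energy (\<lambda>b. dir_deriv b f)"
      unfolding dirichlet_energy_def sum_distrib_left
    proof (intro sum.cong refl)
      fix b :: 'a assume "b \<in> Basis"
      then have "dir_deriv b f \<in> borel_measurable borel" by (intro borel_measurable_continuous_onI r)
      then show "\<rho> ^ DIM('a) * (LBINT x. (dir_deriv b f (c + \<rho> *\<^sub>R x))\<^sup>2) = (LBINT x. (dir_deriv b f x)\<^sup>2)"
        using \<rho> by (subst integral_lborel_affine[where \<rho> = \<rho> and c = c]) auto
    qed
    ultimately show ?thesis by (simp add: power_mult_distrib mult_ac)
  qed
  finally show ?thesis .
qed

section \<open>Interpolation between the two inequalities\<close>

text \<open>Hoelder's inequality, obtained from Young's inequality at each point after both integrals on the
right have been normalised to one.\<close>

lemma integral_powr_interpolation: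
  fixes f :: "'a \<Rightarrow> real"
  assumes [measurable]: "f \<in> borel_measurable M"
    and ia: "integrable M (\<lambda>x. \<bar>f x\<bar> powr a)" and ib: "integrable M (\<lambda>x. \<bar>f x\<bar> powr b)"
    and A: "0 < (\<integral>x. \<bar>f x\<bar> powr a \<partial>M)" and B: "0 < (\<integral>x. \<bar>f x\<bar> powr b \<partial>M)"
    and l: "0 \<le> l" "l \<le> 1" and ab: "a > 0" "b > 0"
  shows "(\<integral>x. \<bar>f x\<bar> powr ((1 - l) * a + l * b) \<partial>M)
    \<le> (\<integral>x. \<bar>f x\<bar> powr a \<partial>M) powr (1 - l) * (\<integral>x. \<bar>f x\<bar> powr b \<partial>M) powr l"
proof -
  define I where "I = (\<integral>x. \<bar>f x\<bar> powr a \<partial>M)"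
  define J where "J = (\<integral>x. \<bar>f x\<bar> powr b \<partial>M)"
  define C where "C = I powr (1 - l) * J powr l"
  have pos: "I > 0" "J > 0" "C > 0" using A B by (simp_all add: I_def J_def C_def)
  have pt: "\<bar>f x\<bar> powr ((1 - l) * a + l * b)
      \<le> C * ((1 - l) / I * \<bar>f x\<bar> powr a + l / J * \<bar>f x\<bar> powr b)" for x
  proof (cases "f x = 0")
    case False
    then have p: "\<bar>f x\<bar> powr a / I > 0" "\<bar>f x\<bar> powr b / J > 0" using pos by auto
    have "\<bar>f x\<bar> powr ((1 - l) * a + l * b) = C * ((\<bar>f x\<bar> powr a / I) powr (1 - l) * (\<bar>f x\<bar> powr b / J) powr l)"
      using pos False by (simp add: C_def powr_divide powr_powr powr_add mult_ac)
    also have "\<dots> \<le> C * ((1 - l) * (\<bar>f x\<bar> powr a / I) + l * (\<bar>f x\<bar> powr b / J))"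
      using pos l p by (intro mult_left_mono Youngs_inequality_0) auto
    finally show ?thesis by simp
  qed (use pos l in simp)
  have ir: "integrable M (\<lambda>x. C * ((1 - l) / I * \<bar>f x\<bar> powr a + l / J * \<bar>f x\<bar> powr b))"
    by (intro integrable_mult_right Bochner_Integration.integrable_add ia ib)
  have il: "integrable M (\<lambda>x. \<bar>f x\<bar> powr ((1 - l) * a + l * b))"
  proof (rule Bochner_Integration.integrable_bound[OF ir])
    show "AE x in M. norm (\<bar>f x\<bar> powr ((1 - l) * a + l * b))
        \<le> norm (C * ((1 - l) / I * \<bar>f x\<bar> powr a + l / J * \<bar>f x\<bar> powr b))"
      using pt by (intro AE_I2) (smt (verit, best) powr_ge_zero real_norm_def)
  qed measurable
  have "(\<integral>x. \<bar>f x\<bar> powr ((1 - l) * a + l * b) \<partial>M)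
      \<le> (\<integral>x. C * ((1 - l) / I * \<bar>f x\<bar> powr a + l / J * \<bar>f x\<bar> powr b) \<partial>M)"
    using il ir pt by (rule integral_mono)
  also have "\<dots> = C * ((1 - l) / I * I + l / J * J)"
    using ia ib by (simp add: I_def J_def)
  also have "\<dots> = C" using pos by simp
  finally show ?thesis by (simp add: C_def I_def J_def)
qed

text \<open>The condition on \<open>q\<close> says that \<open>1 / q\<close> is the mean of \<open>1 / 2\<close> and \<open>1 / 2*\<close> with weights \<open>1 - \<theta>\<close> and
\<open>\<theta>\<close>. The two energies then occur with the exponents \<open>1 - \<theta>\<close> and \<open>\<theta>\<close> and combine to one.\<close>

lemma gagliardo_nirenberg_ball:
  fixes f :: "'a::euclidean_space \<Rightarrow> real"
  assumes f: "test_function (ball c \<rho>) f" and \<rho>: "\<rho> > 0" and dim: "DIM('a) \<ge> 3"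
    and \<theta>: "0 \<le> \<theta>" "\<theta> \<le> 1" and q: "1 / q = 1 / 2 - \<theta> / real DIM('a)"
  shows "(LBINT x. \<bar>f x\<bar> powr q) powr (2 / q)
    \<le> (poincare_const (ball (0::'a) 1) * \<rho>) powr (2 * (1 - \<theta>)) * sobolev_const TYPE('a) powr (2 * \<theta>)
      * dirichlet_energy (\<lambda>b. dir_deriv b f)"
proof (cases "\<exists>x. f x \<noteq> 0")
  case False
  then have "(\<lambda>x. \<bar>f x\<bar> powr q) = (\<lambda>x. 0)" by auto
  then show ?thesis by (simp add: dirichlet_energy_nonneg)
next
  case True
  then obtain x0 where x0: "f x0 \<noteq> 0" by blast
  let ?P = "poincare_const (ball (0::'a) 1) * \<rho>" and ?S = "sobolev_const TYPE('a)"
  let ?E = "dirichlet_energy (\<lambda>b. dir_deriv b f)"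
  define d where "d = real DIM('a)"
  define s where "s = 2 * d / (d - 2)"
  have d: "d \<ge> 3" using dim by (simp add: d_def)
  have s: "s > 2" "1 / s = 1 / 2 - 1 / d" using d by (simp_all add: s_def field_simps)
  have P: "?P > 0" by (rule mult_pos_pos[OF poincare_const_pos \<rho>])
  have S: "?S > 0" by (rule sobolev_const_pos[OF dim])
  have E: "?E \<ge> 0" by (rule dirichlet_energy_nonneg)
  have "1 / q > 0"
  proof -
    have "\<theta> / d \<le> 1 / 3" using \<theta> d by (simp add: field_simps)
    then show ?thesis using q unfolding d_def by linarith
  qed
  then have qpos: "q > 0" by simp
  define I where "I = (LBINT x. \<bar>f x\<bar> powr 2)"
  define J where "J = (LBINT x. \<bar>f x\<bar> powr s)"
  obtain r where r: "continuous_on UNIV f" "\<And>x. r < norm x \<Longrightarrow> f x = 0"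
    using C1cE[OF test_function_C1c[OF f]] by metis
  have [measurable]: "f \<in> borel_measurable borel"
    using r(1) by (rule borel_measurable_continuous_onI)
  have int: "integrable lborel (\<lambda>x. \<bar>f x\<bar> powr a)" if "a > 0" for a
    using that r
    by (intro integrable_bounded_support[where r = r] continuous_on_powr' continuous_intros) auto
  have fU: "test_function UNIV f" using f by (simp add: test_function_def)
  define l where "l = q * \<theta> / s"
  have lq: "1 - l = q * (1 - \<theta>) / 2"
  proof -
    have "\<theta> / s = \<theta> * (1 / s)" by simp
    also have "\<dots> = \<theta> / 2 - \<theta> / d" unfolding s(2) by (simp add: algebra_simps)
    finally have "1 / q = (1 - \<theta>) / 2 + \<theta> / s"
      using q unfolding d_def[symmetric] by argo
    then have "q * (1 / q) = q * ((1 - \<theta>) / 2 + \<theta> / s)" by simp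
    then have "1 = q * (1 - \<theta>) / 2 + q * \<theta> / s" using qpos by (simp add: distrib_left)
    then show ?thesis unfolding l_def by linarith
  qed
  have l0: "0 \<le> l" using \<theta> qpos s by (simp add: l_def)
  have l1: "l \<le> 1" using lq \<theta> qpos by (smt (verit) divide_nonneg_nonneg mult_nonneg_nonneg)
  have eq: "(1 - l) * 2 + l * s = q"
    using lq s by (simp add: l_def algebra_simps)
  have I0: "I > 0" and J0: "J > 0"
    unfolding I_def J_def using s by (intro Lp_norm_pos(1)[OF f x0]; simp)+
  have IP: "I \<le> ?P\<^sup>2 * ?E"
    using poincare_test_function[OF f \<rho>] by (simp add: I_def)
  have JS: "J powr (2 / s) \<le> ?S\<^sup>2 * ?E"
  proof -
    have "J powr (1 / s) \<le> ?S * sqrt ?E"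
      using sobolev_const_bound[OF dim fU] Lp_norm_2_test_function(2)[OF fU]
        Lp_norm_continuous[OF r(1), of UNIV s]
      by (simp add: J_def s_def d_def)
    then have "(J powr (1 / s))\<^sup>2 \<le> (?S * sqrt ?E)\<^sup>2" by (intro power_mono) auto
    moreover have "(J powr (1 / s))\<^sup>2 = J powr (2 / s)" using J0 by (simp add: powr_power)
    ultimately show ?thesis using E by (simp add: power_mult_distrib)
  qed
  have "(LBINT x. \<bar>f x\<bar> powr q) \<le> I powr (1 - l) * J powr l"
    unfolding I_def J_def
    by (rule integral_powr_interpolation[OF _ int int I0[unfolded I_def] J0[unfolded J_def] l0 l1,
          unfolded eq])
      (use s in auto)
  then have "(LBINT x. \<bar>f x\<bar> powr q) powr (2 / q) \<le> (I powr (1 - l) * J powr l) powr (2 / q)"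
    using qpos by (intro powr_mono2) (auto intro: integral_nonneg_AE)
  also have "\<dots> = I powr (1 - \<theta>) * (J powr (2 / s)) powr \<theta>"
  proof -
    have "(1 - l) * (2 / q) = 1 - \<theta>" using qpos unfolding lq by simp
    moreover have "l * (2 / q) = 2 / s * \<theta>" using qpos by (simp add: l_def)
    ultimately show ?thesis by (simp only: powr_mult powr_powr powr_ge_zero)
  qed
  also have "\<dots> \<le> (?P\<^sup>2 * ?E) powr (1 - \<theta>) * (?S\<^sup>2 * ?E) powr \<theta>"
    using IP JS \<theta> I0 by (intro mult_mono powr_mono2) auto
  also have "\<dots> = ?P powr (2 * (1 - \<theta>)) * ?S powr (2 * \<theta>) * (?E powr (1 - \<theta>) * ?E powr \<theta>)"
  proof -
    have "(x\<^sup>2) powr a = x powr (2 * a)" if "x > 0" for x a :: real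
      using that powr_powr[of x 2 a] by simp
    then show ?thesis using P S E by (simp only: powr_mult zero_le_power2) (simp add: mult_ac)
  qed
  also have "?E powr (1 - \<theta>) * ?E powr \<theta> = ?E"
    using E powr_add[of ?E "1 - \<theta>" \<theta>] by simp
  finally show ?thesis .
qed

section \<open>Truncated powers of one real variable\<close>

definition antideriv :: "(real \<Rightarrow> real) \<Rightarrow> real \<Rightarrow> real" where
  "antideriv k r = integral {0..r} k"

lemma antideriv_eq_0:
  assumes "\<And>r. r \<le> \<epsilon> \<Longrightarrow> k r = 0" and "r \<le> \<epsilon>"
  shows "antideriv k r = 0"
proof -
  have "integral {0..r} k = integral {0..r} (\<lambda>_. 0)"
    using assms by (intro integral_cong) auto
  then show ?thesis by (simp add: antideriv_def)
qed

lemma DERIV_antideriv: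
  assumes k: "continuous_on UNIV k" and "\<epsilon> > 0" and 0: "\<And>r. r \<le> \<epsilon> \<Longrightarrow> k r = 0"
  shows "(antideriv k has_real_derivative k r) (at r)"
proof (cases "r > 0")
  case True
  have "((\<lambda>x. integral {0..x} k) has_real_derivative k r) (at r within {0..r + 1})"
    using True by (intro integral_has_real_derivative continuous_on_subset[OF k]) auto
  then have "((\<lambda>x. integral {0..x} k) has_real_derivative k r) (at r within {0<..<r + 1})"
    by (rule DERIV_subset) auto
  then show ?thesis
    using True at_within_open[of r "{0<..<r + 1}"] by (simp add: antideriv_def[abs_def])
next
  case False
  have "\<forall>\<^sub>F x in nhds r. x \<in> {..<\<epsilon>}"
    using False \<open>\<epsilon> > 0\<close> by (intro eventually_nhds_in_open) auto
  then have "\<forall>\<^sub>F x in nhds r. antideriv k x = 0"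
    by eventually_elim (rule antideriv_eq_0[of \<epsilon>], use 0 in auto)
  then have "(antideriv k has_real_derivative 0) (at r)"
    by (subst DERIV_cong_ev[OF refl _ refl]) auto
  then show ?thesis using 0[of r] False \<open>\<epsilon> > 0\<close> by simp
qed

lemma continuous_antideriv:
  assumes "continuous_on UNIV k" and "\<epsilon> > 0" and "\<And>r. r \<le> \<epsilon> \<Longrightarrow> k r = 0"
  shows "continuous_on UNIV (antideriv k)"
  using DERIV_antideriv[OF assms] by (intro continuous_at_imp_continuous_on ballI DERIV_isCont)

lemma antideriv_nonneg:
  assumes "continuous_on UNIV k" and "\<And>r. 0 \<le> k r"
  shows "0 \<le> antideriv k r"
  unfolding antideriv_def using assms
  by (intro integral_nonneg integrable_continuous_real continuous_on_subset[OF assms(1)]) auto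

lemma continuous_powr_Icc: "(a::real) > 0 \<Longrightarrow> 0 \<le> s \<Longrightarrow> continuous_on {s..r} (\<lambda>x. x powr a)"
  by (intro continuous_on_powr' continuous_intros) auto

lemma antideriv_upper:
  assumes k: "continuous_on UNIV k" "\<epsilon> > 0" "\<And>r. r \<le> \<epsilon> \<Longrightarrow> k r = 0"
    and "a > 0" and le: "\<And>r. r > 0 \<Longrightarrow> k r \<le> C * (a * r powr (a - 1))" and "r \<ge> 0"
  shows "antideriv k r \<le> C * r powr a"
proof -
  have "C * 0 powr a - antideriv k 0 \<le> C * r powr a - antideriv k r"
  proof (rule DERIV_nonneg_imp_increasing_open[where f = "\<lambda>r. C * r powr a - antideriv k r"])
    show "\<exists>y. ((\<lambda>r. C * r powr a - antideriv k r) has_real_derivative y) (at x) \<and> 0 \<le> y"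
      if "0 < x" for x
      using that le[of x]
      by (intro exI[of _ "C * (a * x powr (a - 1)) - k x"] conjI DERIV_diff DERIV_cmult
          has_real_derivative_powr DERIV_antideriv[OF k]) auto
    show "continuous_on {0..r} (\<lambda>r. C * r powr a - antideriv k r)"
      using \<open>a > 0\<close>
      by (intro continuous_intros continuous_powr_Icc continuous_on_subset[OF continuous_antideriv[OF k]]) auto
  qed (use \<open>r \<ge> 0\<close> in auto)
  then show ?thesis using antideriv_eq_0[of \<epsilon> k 0] k by simp
qed

lemma antideriv_lower:
  assumes k: "continuous_on UNIV k" "\<epsilon> > 0" "\<And>r. r \<le> \<epsilon> \<Longrightarrow> k r = 0" and k0: "\<And>r. 0 \<le> k r"
    and "a > 0" "C \<ge> 0" "\<delta> \<ge> 0" and le: "\<And>r. \<delta> < r \<Longrightarrow> r < N \<Longrightarrow> C * (a * r powr (a - 1)) \<le> k r"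
    and "0 \<le> r" "r \<le> N"
  shows "C * (r powr a - \<delta> powr a) \<le> antideriv k r"
proof (cases "r \<le> \<delta>")
  case True
  then have "r powr a \<le> \<delta> powr a" using assms by (intro powr_mono2) auto
  then have "C * (r powr a - \<delta> powr a) \<le> 0" using \<open>C \<ge> 0\<close> by (intro mult_nonneg_nonpos) auto
  also have "0 \<le> antideriv k r" by (rule antideriv_nonneg[OF k(1) k0])
  finally show ?thesis .
next
  case False
  have "antideriv k \<delta> - C * \<delta> powr a \<le> antideriv k r - C * r powr a"
  proof (rule DERIV_nonneg_imp_increasing_open[where f = "\<lambda>r. antideriv k r - C * r powr a"])
    show "\<exists>y. ((\<lambda>r. antideriv k r - C * r powr a) has_real_derivative y) (at x) \<and> 0 \<le> y"
      if "\<delta> < x" "x < r" for x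
      using that le[of x] \<open>\<delta> \<ge> 0\<close> \<open>r \<le> N\<close>
      by (intro exI[of _ "k x - C * (a * x powr (a - 1))"] conjI DERIV_diff DERIV_cmult
          has_real_derivative_powr DERIV_antideriv[OF k]) auto
    show "continuous_on {\<delta>..r} (\<lambda>r. antideriv k r - C * r powr a)"
      using \<open>a > 0\<close> \<open>\<delta> \<ge> 0\<close>
      by (intro continuous_intros continuous_powr_Icc continuous_on_subset[OF continuous_antideriv[OF k]]) auto
  qed (use False in auto)
  moreover have "0 \<le> antideriv k \<delta>" by (rule antideriv_nonneg[OF k(1) k0])
  ultimately show ?thesis by (simp add: algebra_simps)
qed

definition plateau :: "real \<Rightarrow> real \<Rightarrow> real" where
  "plateau N r = max 0 (min 1 (min (N * r - 1) (N + 1 - r)))"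

lemma plateau_bounds: "0 \<le> plateau N r" "plateau N r \<le> 1"
  by (auto simp: plateau_def)

lemma plateau_eq_0: "N > 0 \<Longrightarrow> r \<le> 1 / N \<Longrightarrow> plateau N r = 0" "N + 1 \<le> r \<Longrightarrow> plateau N r = 0"
  by (auto simp: plateau_def field_simps)

lemma plateau_eq_1: "N > 0 \<Longrightarrow> 2 / N \<le> r \<Longrightarrow> r \<le> N \<Longrightarrow> plateau N r = 1"
  by (auto simp: plateau_def field_simps)

lemma continuous_plateau: "continuous_on UNIV (plateau N)"
  unfolding plateau_def[abs_def] by (intro continuous_intros)

text \<open>\<open>entropy0 p N\<close> is a convex substitute of class \<open>C\<^sup>2\<close> for \<open>r powr p\<close>, and \<open>entropy1 p N\<close> and
\<open>entropy2 p N\<close> are its derivatives. The second derivative is that of \<open>r powr p\<close> times the square of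
the plateau. The cut at \<open>1 / N\<close> gives \<open>entropy0 p N (u t x)\<close> compact support in the ball, the cut at
\<open>N + 1\<close> makes \<open>entropy0 p N\<close> Lipschitz. The maximum with \<open>1 / N\<close> changes the power only where the
plateau vanishes and keeps it continuous there. In the same way, \<open>cutpow b N\<close> is a substitute for
\<open>r powr b\<close>.\<close>

definition entropy2 :: "real \<Rightarrow> real \<Rightarrow> real \<Rightarrow> real" where
  "entropy2 p N r = p * ((p - 1) * max (1 / N) r powr (p - 1 - 1)) * (plateau N r)\<^sup>2"

definition entropy1 :: "real \<Rightarrow> real \<Rightarrow> real \<Rightarrow> real" where
  "entropy1 p N = antideriv (entropy2 p N)"

definition entropy0 :: "real \<Rightarrow> real \<Rightarrow> real \<Rightarrow> real" where
  "entropy0 p N = antideriv (entropy1 p N)"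

definition cutpow1 :: "real \<Rightarrow> real \<Rightarrow> real \<Rightarrow> real" where
  "cutpow1 b N r = b * max (1 / N) r powr (b - 1) * plateau N r"

definition cutpow :: "real \<Rightarrow> real \<Rightarrow> real \<Rightarrow> real" where
  "cutpow b N = antideriv (cutpow1 b N)"

context
  fixes p N :: real
  assumes N: "N > 0"
begin

lemma continuous_max_powr: "continuous_on UNIV (\<lambda>r. max (1 / N) r powr a)"
  using N by (intro continuous_on_powr continuous_intros) (auto simp: max_def not_le intro: order_less_imp_not_eq2)

lemma entropy2_eq_0: "r \<le> 1 / N \<Longrightarrow> entropy2 p N r = 0"
  using N by (simp add: entropy2_def plateau_eq_0)

lemma entropy1_eq_0: "r \<le> 1 / N \<Longrightarrow> entropy1 p N r = 0"
  unfolding entropy1_def using entropy2_eq_0 by (rule antideriv_eq_0)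

lemma entropy0_eq_0: "r \<le> 1 / N \<Longrightarrow> entropy0 p N r = 0"
  unfolding entropy0_def using entropy1_eq_0 by (rule antideriv_eq_0)

lemma continuous_entropy2: "continuous_on UNIV (entropy2 p N)"
  unfolding entropy2_def[abs_def]
  by (intro continuous_intros continuous_max_powr continuous_plateau)

lemma DERIV_entropy1: "(entropy1 p N has_real_derivative entropy2 p N r) (at r)"
  unfolding entropy1_def
  by (rule DERIV_antideriv[OF continuous_entropy2 _ entropy2_eq_0]) (use N in auto)

lemma continuous_entropy1: "continuous_on UNIV (entropy1 p N)"
  using DERIV_entropy1 by (intro continuous_at_imp_continuous_on ballI DERIV_isCont)

lemma DERIV_entropy0: "(entropy0 p N has_real_derivative entropy1 p N r) (at r)"
  unfolding entropy0_def
  by (rule DERIV_antideriv[OF continuous_entropy1 _ entropy1_eq_0]) (use N in auto)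

lemma continuous_entropy0: "continuous_on UNIV (entropy0 p N)"
  using DERIV_entropy0 by (intro continuous_at_imp_continuous_on ballI DERIV_isCont)

lemma continuous_cutpow1: "continuous_on UNIV (cutpow1 b N)"
  unfolding cutpow1_def[abs_def]
  by (intro continuous_intros continuous_max_powr continuous_plateau)

lemma cutpow1_eq_0: "r \<le> 1 / N \<Longrightarrow> cutpow1 b N r = 0"
  using N by (simp add: cutpow1_def plateau_eq_0)

lemma cutpow_eq_0: "r \<le> 1 / N \<Longrightarrow> cutpow b N r = 0"
  unfolding cutpow_def using cutpow1_eq_0 by (rule antideriv_eq_0)

lemma DERIV_cutpow: "(cutpow b N has_real_derivative cutpow1 b N r) (at r)"
  unfolding cutpow_def
  by (rule DERIV_antideriv[OF continuous_cutpow1 _ cutpow1_eq_0]) (use N in auto)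

lemma continuous_cutpow: "continuous_on UNIV (cutpow b N)"
  using DERIV_cutpow by (intro continuous_at_imp_continuous_on ballI DERIV_isCont)

lemma cutpow_nonneg: "b > 0 \<Longrightarrow> 0 \<le> cutpow b N r"
  unfolding cutpow_def
  by (rule antideriv_nonneg[OF continuous_cutpow1]) (simp add: cutpow1_def plateau_bounds)

lemma cutpow_lower:
  assumes "b > 0" "0 \<le> r" "r \<le> N"
  shows "r powr b - (2 / N) powr b \<le> cutpow b N r"
proof -
  have "1 * (r powr b - (2 / N) powr b) \<le> antideriv (cutpow1 b N) r"
  proof (rule antideriv_lower[OF continuous_cutpow1 _ cutpow1_eq_0, where N = N])
    show "1 * (b * s powr (b - 1)) \<le> cutpow1 b N s" if "2 / N < s" "s < N" for s
    proof -
      have "1 / N \<le> s" using that N by (simp add: field_simps)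
      then show ?thesis using that N by (simp add: cutpow1_def plateau_eq_1 max_def)
    qed
    show "0 \<le> cutpow1 b N s" for s using assms by (simp add: cutpow1_def plateau_bounds)
  qed (use assms N in auto)
  then show ?thesis by (simp add: cutpow_def)
qed

text \<open>The reason for squaring the plateau in \<open>entropy2\<close> but not in \<open>cutpow1\<close>: the dissipation density
of the entropy is a constant multiple of the squared gradient of \<open>cutpow b N\<close> applied to the solution.\<close>

lemma entropy2_eq_cutpow1_square:
  assumes "r > 0" and b: "2 * b = p + m - 1" "b > 0"
  shows "entropy2 p N r * r powr (m - 1) = p * (p - 1) / b\<^sup>2 * (cutpow1 b N r)\<^sup>2"
proof (cases "r \<le> 1 / N")
  case True
  then show ?thesis by (simp add: entropy2_eq_0 cutpow1_eq_0)
next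
  case False
  have "r powr (p - 1 - 1) * r powr (m - 1) = (r powr (b - 1))\<^sup>2"
  proof -
    have "p - 1 - 1 + (m - 1) = (b - 1) + (b - 1)" using b by simp
    then show ?thesis by (simp only: power2_eq_square powr_add[symmetric])
  qed
  then have "p * ((p - 1) * r powr (p - 1 - 1)) * (plateau N r)\<^sup>2 * r powr (m - 1)
      = p * (p - 1) * (plateau N r)\<^sup>2 * (r powr (b - 1))\<^sup>2"
    by (simp add: mult_ac)
  then show ?thesis
    using False b(2) by (simp add: entropy2_def cutpow1_def max_def power_mult_distrib)
qed

context
  assumes p: "p > 1"
begin

lemma entropy2_nonneg: "0 \<le> entropy2 p N r"
  using p by (simp add: entropy2_def)

lemma entropy1_nonneg: "0 \<le> entropy1 p N r"
  unfolding entropy1_def by (rule antideriv_nonneg[OF continuous_entropy2 entropy2_nonneg])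

lemma entropy0_nonneg: "0 \<le> entropy0 p N r"
  unfolding entropy0_def by (rule antideriv_nonneg[OF continuous_entropy1 entropy1_nonneg])

lemma entropy1_le: "r \<ge> 0 \<Longrightarrow> entropy1 p N r \<le> p * r powr (p - 1)"
  unfolding entropy1_def
proof (rule antideriv_upper[OF continuous_entropy2 _ entropy2_eq_0])
  show "entropy2 p N r \<le> p * ((p - 1) * r powr (p - 1 - 1))" if "r > 0" for r
  proof (cases "r \<le> 1 / N")
    case False
    have "(plateau N r)\<^sup>2 \<le> 1" using plateau_bounds[of N r] by (simp add: power_le_one)
    then have "p * ((p - 1) * r powr (p - 1 - 1)) * (plateau N r)\<^sup>2 \<le> p * ((p - 1) * r powr (p - 1 - 1)) * 1"
      using p by (intro mult_left_mono) auto
    then show ?thesis using False by (simp add: entropy2_def max_def)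
  qed (use p in \<open>simp add: entropy2_eq_0\<close>)
qed (use p N in auto)

lemma entropy0_le: "r \<ge> 0 \<Longrightarrow> entropy0 p N r \<le> r powr p"
  unfolding entropy0_def
  using antideriv_upper[where k = "entropy1 p N" and \<epsilon> = "1 / N" and a = p and C = 1 and r = r,
      OF continuous_entropy1 _ entropy1_eq_0] entropy1_le p N by simp

lemma entropy1_bounded: "\<bar>entropy1 p N r\<bar> \<le> p * (N + 1) powr (p - 1)"
proof -
  have "entropy1 p N r \<le> p * (N + 1) powr (p - 1)"
  proof (cases "r \<le> 0")
    case True
    then have "entropy1 p N r = 0" using N by (intro entropy1_eq_0) (simp add: order_trans[of _ 0])
    then show ?thesis using p by simp
  next
    case False
    have "entropy1 p N r \<le> entropy1 p N (min r (N + 1))"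
    proof (cases "r \<le> N + 1")
      case False
      have "entropy1 p N r \<le> entropy1 p N (N + 1)"
      proof (rule DERIV_nonpos_imp_nonincreasing[where f = "entropy1 p N"])
        show "\<exists>y. (entropy1 p N has_real_derivative y) (at x) \<and> y \<le> 0" if "N + 1 \<le> x" for x
          using that DERIV_entropy1[of x] by (intro exI[of _ "entropy2 p N x"]) (simp add: entropy2_def plateau_eq_0)
      qed (use False in auto)
      then show ?thesis using False by simp
    qed simp
    also have "\<dots> \<le> p * (min r (N + 1)) powr (p - 1)"
      using False N by (intro entropy1_le) auto
    also have "\<dots> \<le> p * (N + 1) powr (p - 1)"
      using False N p by (intro mult_left_mono powr_mono2) auto
    finally show ?thesis .
  qed
  then show ?thesis using entropy1_nonneg[of r] by simp
qed

lemma entropy0_lipschitz: "\<bar>entropy0 p N x - entropy0 p N y\<bar> \<le> p * (N + 1) powr (p - 1) * \<bar>x - y\<bar>"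
  using field_differentiable_bound[of UNIV "entropy0 p N" "entropy1 p N" "p * (N + 1) powr (p - 1)" x y]
    DERIV_entropy0 entropy1_bounded by simp

lemma entropy0_lower:
  assumes "0 \<le> r" "r \<le> N"
  shows "r powr p - p * (2 / N) powr (p - 1) * r \<le> entropy0 p N r"
proof -
  let ?d = "p * (2 / N) powr (p - 1)"
  have lower1: "p * (x powr (p - 1) - (2 / N) powr (p - 1)) \<le> entropy1 p N x" if "0 \<le> x" "x \<le> N" for x
    unfolding entropy1_def
  proof (rule antideriv_lower[OF continuous_entropy2 _ entropy2_eq_0 entropy2_nonneg, where N = N])
    show "p * ((p - 1) * s powr (p - 1 - 1)) \<le> entropy2 p N s" if "2 / N < s" "s < N" for s
    proof -
      have "1 / N \<le> s" using that N by (simp add: field_simps)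
      then show ?thesis using that N by (simp add: entropy2_def plateau_eq_1 max_def)
    qed
  qed (use p N that in auto)
  have "entropy0 p N 0 - 0 powr p + ?d * 0 \<le> entropy0 p N r - r powr p + ?d * r"
  proof (rule DERIV_nonneg_imp_increasing_open[where f = "\<lambda>r. entropy0 p N r - r powr p + ?d * r"])
    show "\<exists>y. ((\<lambda>r. entropy0 p N r - r powr p + ?d * r) has_real_derivative y) (at x) \<and> 0 \<le> y"
      if "0 < x" "x < r" for x
      using that lower1[of x] assms
      by (intro exI[of _ "entropy1 p N x - p * x powr (p - 1) + ?d * 1"] conjI DERIV_add DERIV_diff
          DERIV_cmult DERIV_ident has_real_derivative_powr DERIV_entropy0) (auto simp: algebra_simps)
    show "continuous_on {0..r} (\<lambda>r. entropy0 p N r - r powr p + ?d * r)"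
      using p by (intro continuous_intros continuous_powr_Icc continuous_on_subset[OF continuous_entropy0]) auto
  qed (use assms in auto)
  then show ?thesis using entropy0_eq_0[of 0] N by simp
qed

end

end

text \<open>Transfers the uniform lower bound for \<open>cutpow\<close> to its \<open>q\<close>-th power.\<close>

lemma powr_lower_of_shift:
  fixes v x \<eta> q :: real
  assumes "q \<ge> 1" "0 \<le> v" "0 \<le> x" "x \<le> M" "x - \<eta> \<le> v" "0 \<le> \<eta>"
  shows "x powr q - q * \<eta> * M powr (q - 1) \<le> v powr q"
proof (cases "v < x")
  case True
  have "continuous_on {v..x} (\<lambda>x. x powr q)" using assms by (intro continuous_powr_Icc) auto
  moreover have "(\<lambda>x. x powr q) differentiable (at y)" if "v < y" "y < x" for y
    using has_real_derivative_powr[of y q] that assms(2) real_differentiable_def by fastforce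
  ultimately obtain l z where z: "v < z" "z < x" "((\<lambda>x. x powr q) has_real_derivative l) (at z)"
    "x powr q - v powr q = (x - v) * l"
    using MVT[OF True] by blast
  have "((\<lambda>x. x powr q) has_real_derivative q * z powr (q - 1)) (at z)"
    using z assms(2) by (intro has_real_derivative_powr) auto
  with z(3) have "l = q * z powr (q - 1)" by (rule DERIV_unique)
  then have "x powr q - v powr q = (x - v) * (q * z powr (q - 1))" using z(4) by simp
  also have "\<dots> \<le> \<eta> * (q * M powr (q - 1))"
    using z assms by (intro mult_mono powr_mono2) auto
  finally show ?thesis by (simp add: mult_ac)
next
  case False
  then have "x powr q \<le> v powr q" using assms by (intro powr_mono2) auto
  moreover have "0 \<le> q * \<eta> * M powr (q - 1)" using assms by simp
  ultimately show ?thesis by linarith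
qed

section \<open>Entropy dissipation\<close>

definition zero_ext :: "'a set \<Rightarrow> ('a \<Rightarrow> real) \<Rightarrow> 'a \<Rightarrow> real" where
  "zero_ext S f x = (if x \<in> S then f x else 0)"

lemma zero_ext_ball_eq_0:
  assumes "norm c + \<rho> < norm (x :: 'a::real_normed_vector)"
  shows "zero_ext (ball c \<rho>) f x = 0"
proof -
  have "norm x \<le> norm c + dist c x"
    using norm_triangle_sub[of x c] by (simp add: dist_norm norm_minus_commute)
  then show ?thesis using assms by (auto simp: zero_ext_def)
qed

lemma continuous_zero_ext_time:
  fixes f :: "'t::topological_space \<Rightarrow> 'a::topological_space \<Rightarrow> real"
  assumes f: "continuous_on (A \<times> S) (\<lambda>(t, x). f t x)" and "open S" "closed K" "K \<subseteq> S"
    and 0: "\<And>t x. t \<in> A \<Longrightarrow> x \<in> S - K \<Longrightarrow> f t x = 0"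
  shows "continuous_on (A \<times> UNIV) (\<lambda>(t, x). zero_ext S (f t) x)"
proof -
  have eq: "A \<times> UNIV = A \<times> S \<union> A \<times> (- K)" using \<open>K \<subseteq> S\<close> by auto
  have op: "openin (top_of_set (A \<times> UNIV)) (A \<times> U)" if "open U" for U :: "'a set"
    using openin_open_Int[of "UNIV \<times> U" "A \<times> UNIV"] that by (simp add: open_Times Times_Int_Times)
  show ?thesis
    unfolding eq
  proof (rule continuous_on_Un_local_open)
    show "openin (top_of_set (A \<times> S \<union> A \<times> - K)) (A \<times> S)"
      "openin (top_of_set (A \<times> S \<union> A \<times> - K)) (A \<times> - K)"
      unfolding eq[symmetric] using assms by (auto intro: op)
    show "continuous_on (A \<times> S) (\<lambda>(t, x). zero_ext S (f t) x)"
      by (rule continuous_on_eq[OF f]) (auto simp: zero_ext_def)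
    show "continuous_on (A \<times> - K) (\<lambda>(t, x). zero_ext S (f t) x)"
      by (rule continuous_on_eq[OF continuous_on_const[of _ 0]]) (use 0 in \<open>auto simp: zero_ext_def\<close>)
  qed
qed

lemma continuous_zero_ext:
  fixes f :: "'a::topological_space \<Rightarrow> real"
  assumes "continuous_on S f" and "open S" "closed K" "K \<subseteq> S" and "\<And>x. x \<in> S - K \<Longrightarrow> f x = 0"
  shows "continuous_on UNIV (zero_ext S f)"
proof -
  have "continuous_on (UNIV \<times> S) (\<lambda>(t::real, x). f x)"
    unfolding split_beta by (intro continuous_on_compose2[OF assms(1)] continuous_intros) auto
  then have "continuous_on (UNIV \<times> UNIV) (\<lambda>(t::real, x). zero_ext S f x)"
    using assms by (intro continuous_zero_ext_time[where K = K]) auto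
  from continuous_on_compose2[OF this, of UNIV "\<lambda>x. (0, x)"] show ?thesis
    by (simp add: continuous_intros)
qed

lemma DERIV_zero_ext:
  fixes f :: "'a::real_normed_vector \<Rightarrow> real"
  assumes "open S" "closed K" "K \<subseteq> S" and 0: "\<And>x. x \<in> S - K \<Longrightarrow> f x = 0"
    and f: "\<And>x. x \<in> S \<Longrightarrow> ((\<lambda>h. f (x + h *\<^sub>R b)) has_real_derivative f' x) (at 0)"
  shows "((\<lambda>h. zero_ext S f (x + h *\<^sub>R b)) has_real_derivative zero_ext S f' x) (at 0)"
proof -
  note ev = eventually_line_in_open[of _ x b]
  show ?thesis
  proof (cases "x \<in> S")
    case True
    have "\<forall>\<^sub>F h in nhds 0. zero_ext S f (x + h *\<^sub>R b) = f (x + h *\<^sub>R b)"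
      using ev[OF \<open>open S\<close> True] by eventually_elim (simp add: zero_ext_def)
    then show ?thesis
      using f[OF True] True by (subst DERIV_cong_ev[OF refl _ refl]) (auto simp: zero_ext_def)
  next
    case False
    then have "x \<in> - K" using \<open>K \<subseteq> S\<close> by auto
    with \<open>closed K\<close> have "\<forall>\<^sub>F h in nhds 0. x + h *\<^sub>R b \<in> - K" by (intro ev) auto
    then have "\<forall>\<^sub>F h in nhds 0. zero_ext S f (x + h *\<^sub>R b) = 0"
      by eventually_elim (simp add: zero_ext_def 0)
    then show ?thesis
      using False by (subst DERIV_cong_ev[OF refl _ refl, where g = "\<lambda>_. 0"]) (auto simp: zero_ext_def)
  qed
qed

lemma integral_cbox_eq_lborel:
  fixes F :: "'a::euclidean_space \<Rightarrow> real"
  assumes "continuous_on UNIV F" and "\<And>x. F x \<noteq> 0 \<Longrightarrow> x \<in> cbox a b"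
  shows "integral (cbox a b) F = (LBINT x. F x)"
proof -
  obtain r where r: "\<And>x. x \<in> cbox a b \<Longrightarrow> norm x \<le> r"
    using bounded_cbox[of a b] unfolding bounded_iff by blast
  then have "F x = 0" if "r < norm x" for x
    using assms(2)[of x] r[of x] that by linarith
  then have "integrable lborel F"
    by (intro integrable_bounded_support[OF assms(1)])
  moreover have "F = (\<lambda>x. if x \<in> cbox a b then F x else 0)"
    using assms(2) by (force simp: fun_eq_iff)
  then have "integral UNIV F = integral (cbox a b) F" by (metis integral_restrict_UNIV)
  ultimately show ?thesis by (simp add: integral_lborel)
qed

text \<open>What is used of a solution. \<open>D1 b\<close> and \<open>D2 b\<close> are the first and the second derivative in the
direction \<open>b\<close>, and the Laplacian of \<open>u^m / m\<close> has been expanded by the chain rule. In this form the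
logarithmic case \<open>m = 0\<close> is no exception.\<close>

locale positive_fde =
  fixes m \<rho> :: real and c :: "'a::euclidean_space" and I :: "real set" and u :: "real \<Rightarrow> 'a \<Rightarrow> real"
    and D1 D2 :: "'a \<Rightarrow> real \<times> 'a \<Rightarrow> real"
  assumes cont_u: "continuous_on (I \<times> cball c \<rho>) (\<lambda>(t, x). u t x)"
    and pos_u: "\<And>t x. t \<in> I \<Longrightarrow> x \<in> ball c \<rho> \<Longrightarrow> 0 < u t x"
    and bdry_u: "\<And>t x. t \<in> I \<Longrightarrow> x \<in> sphere c \<rho> \<Longrightarrow> u t x = 0"
    and cont_D1: "\<And>b. b \<in> Basis \<Longrightarrow> continuous_on (I \<times> ball c \<rho>) (D1 b)"
    and cont_D2: "\<And>b. b \<in> Basis \<Longrightarrow> continuous_on (I \<times> ball c \<rho>) (D2 b)"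
    and DERIV_u: "\<And>b t x. b \<in> Basis \<Longrightarrow> t \<in> I \<Longrightarrow> x \<in> ball c \<rho> \<Longrightarrow>
      ((\<lambda>h. u t (x + h *\<^sub>R b)) has_real_derivative D1 b (t, x)) (at 0)"
    and DERIV_D1: "\<And>b t x. b \<in> Basis \<Longrightarrow> t \<in> I \<Longrightarrow> x \<in> ball c \<rho> \<Longrightarrow>
      ((\<lambda>h. D1 b (t, x + h *\<^sub>R b)) has_real_derivative D2 b (t, x)) (at 0)"
    and pde: "\<And>t x. t \<in> I \<Longrightarrow> x \<in> ball c \<rho> \<Longrightarrow> ((\<lambda>\<tau>. u \<tau> x) has_real_derivative
      (\<Sum>b\<in>Basis. (m - 1) * u t x powr (m - 2) * (D1 b (t, x))\<^sup>2 + u t x powr (m - 1) * D2 b (t, x))) (at t)"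
begin

abbreviation "B \<equiv> ball c \<rho>"

definition flux_div :: "real \<Rightarrow> 'a \<Rightarrow> real" where
  "flux_div t x = (\<Sum>b\<in>Basis. (m - 1) * u t x powr (m - 2) * (D1 b (t, x))\<^sup>2 + u t x powr (m - 1) * D2 b (t, x))"

lemma cont_u_ball: "continuous_on (I \<times> B) (\<lambda>(t, x). u t x)"
  by (rule continuous_on_subset[OF cont_u]) auto

lemma cont_powr_u: "continuous_on (I \<times> B) (\<lambda>(t, x). u t x powr a)"
  using pos_u cont_u_ball unfolding split_beta
  by (intro continuous_on_powr continuous_intros) (auto simp: order_less_imp_not_eq2 split_beta)

lemma cont_compose_u: "continuous_on UNIV g \<Longrightarrow> continuous_on (I \<times> B) (\<lambda>(t, x). g (u t x))"
  using continuous_on_compose2[OF _ cont_u_ball, of UNIV g] by (simp add: split_beta)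

lemma cont_flux_div: "continuous_on (I \<times> B) (\<lambda>(t, x). flux_div t x)"
  unfolding flux_div_def split_beta
  by (intro continuous_intros cont_powr_u[unfolded split_beta])
    (use cont_D1 cont_D2 in auto)

lemma slice: "t \<in> I \<Longrightarrow> continuous_on (I \<times> B) F \<Longrightarrow> continuous_on B (\<lambda>x. F (t, x))"
  by (rule continuous_on_compose2[of "I \<times> B" F]) (auto intro!: continuous_intros)

text \<open>The part of space-time where \<open>u \<ge> \<epsilon>\<close> is compact and keeps away from the lateral boundary, where
\<open>u = 0\<close>. Its projection to space is a common support, for all times in \<open>{s..t}\<close>, of everything that
vanishes for \<open>u \<le> \<epsilon>\<close>.\<close>

lemma compact_superlevel:
  assumes "{s..t} \<subseteq> I" and "\<epsilon> > 0"
  obtains K where "compact K" "K \<subseteq> B" "\<And>\<tau> x. \<tau> \<in> {s..t} \<Longrightarrow> x \<in> B - K \<Longrightarrow> u \<tau> x \<le> \<epsilon>"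
proof -
  let ?S = "{s..t} \<times> cball c \<rho>"
  let ?f = "\<lambda>(t, x). u t x"
  let ?A = "?S \<inter> ?f -` {\<epsilon>..}"
  have "continuous_on ?S ?f" using assms(1) by (intro continuous_on_subset[OF cont_u]) auto
  then have "closed ?A"
    by (intro continuous_closed_preimage closed_Times) auto
  moreover have "compact ?S" by (intro compact_Times) auto
  ultimately have "compact (?S \<inter> ?A)" by (rule compact_Int_closed[rotated])
  then have "compact (snd ` (?S \<inter> ?A))"
    by (intro compact_continuous_image continuous_intros)
  moreover have "snd ` (?S \<inter> ?A) \<subseteq> B"
  proof clarsimp
    fix \<tau> x assume a: "s \<le> \<tau>" "\<tau> \<le> t" "dist c x \<le> \<rho>" "\<epsilon> \<le> u \<tau> x"
    then have "dist c x \<noteq> \<rho>" using bdry_u[of \<tau> x] assms by auto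
    then show "dist c x < \<rho>" using a by simp
  qed
  moreover have "u \<tau> x \<le> \<epsilon>" if "\<tau> \<in> {s..t}" "x \<in> B - snd ` (?S \<inter> ?A)" for \<tau> x
    using that by (force simp: image_iff)
  ultimately show ?thesis using that by blast
qed

lemma compact_superlevel_slice:
  assumes "t \<in> I" and "\<epsilon> > 0"
  obtains K where "compact K" "K \<subseteq> B" "\<And>x. x \<in> B - K \<Longrightarrow> u t x \<le> \<epsilon>"
proof -
  have "{t..t} \<subseteq> I" using assms(1) by simp
  then obtain K where "compact K" "K \<subseteq> B" "\<And>\<tau> x. \<tau> \<in> {t..t} \<Longrightarrow> x \<in> B - K \<Longrightarrow> u \<tau> x \<le> \<epsilon>"
    using compact_superlevel[of t t, OF _ assms(2)] by metis
  then show ?thesis using that[of K] by simp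
qed

definition trunc :: "real \<Rightarrow> real \<Rightarrow> real \<Rightarrow> 'a \<Rightarrow> real" where
  "trunc N b t = zero_ext B (\<lambda>x. cutpow b N (u t x))"

definition trunc_grad :: "real \<Rightarrow> real \<Rightarrow> real \<Rightarrow> 'a \<Rightarrow> 'a \<Rightarrow> real" where
  "trunc_grad N b t e = zero_ext B (\<lambda>x. cutpow1 b N (u t x) * D1 e (t, x))"

definition entropy :: "real \<Rightarrow> real \<Rightarrow> real \<Rightarrow> real" where
  "entropy p N t = (LBINT x. zero_ext B (\<lambda>x. entropy0 p N (u t x)) x)"

lemma test_function_trunc:
  assumes N: "N > 0" and t: "t \<in> I"
  shows "test_function B (trunc N b t)" and "C1c (trunc N b t) (trunc_grad N b t)"
proof -
  have N': "1 / N > 0" using N by simp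
  obtain K where K: "compact K" "K \<subseteq> B" "\<And>x. x \<in> B - K \<Longrightarrow> u t x \<le> 1 / N"
    using compact_superlevel_slice[OF t N'] by metis
  note cK = compact_imp_closed[OF K(1)]
  have c1: "continuous_on UNIV (trunc N b t)"
    unfolding trunc_def
    using slice[OF t cont_compose_u[OF continuous_cutpow[OF N, of b]]] K(3) cutpow_eq_0[OF N]
    by (intro continuous_zero_ext[OF _ open_ball cK K(2)]) auto
  have c2: "continuous_on UNIV (trunc_grad N b t e)" if "e \<in> Basis" for e
    unfolding trunc_grad_def
    using slice[OF t cont_compose_u[OF continuous_cutpow1[OF N, of b]]] slice[OF t cont_D1[OF that]]
      K(3) cutpow1_eq_0[OF N]
    by (intro continuous_zero_ext[OF _ open_ball cK K(2)] continuous_on_mult) auto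
  have d: "((\<lambda>h. trunc N b t (x + h *\<^sub>R e)) has_real_derivative trunc_grad N b t e x) (at 0)"
    if "e \<in> Basis" for e x
    unfolding trunc_def trunc_grad_def
  proof (rule DERIV_zero_ext[OF open_ball cK K(2)])
    show "cutpow b N (u t x) = 0" if "x \<in> B - K" for x
      using K(3)[OF that] by (rule cutpow_eq_0[OF N])
    show "((\<lambda>h. cutpow b N (u t (x + h *\<^sub>R e))) has_real_derivative
        cutpow1 b N (u t x) * D1 e (t, x)) (at 0)" if "x \<in> B" for x
      using DERIV_chain2[OF DERIV_cutpow[OF N] DERIV_u[OF \<open>e \<in> Basis\<close> t that]] by simp
  qed
  have supp: "trunc N b t x = 0" if "norm c + \<rho> < norm x" for x
    unfolding trunc_def by (rule zero_ext_ball_eq_0[OF that])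
  show C: "C1c (trunc N b t) (trunc_grad N b t)"
    unfolding C1c_def using c1 c2 d supp by blast
  have "{x. trunc N b t x \<noteq> 0} \<subseteq> K"
    using K(3) cutpow_eq_0[OF N] by (auto simp: trunc_def zero_ext_def)
  then have "closure {x. trunc N b t x \<noteq> 0} \<subseteq> K" using cK by (rule closure_minimal)
  with K(2) show "test_function B (trunc N b t)"
    using C by (intro C1c_test_function) auto
qed

context
  fixes p N b :: real
  assumes N: "N > 0" and b: "b > 0" "2 * b = p + m - 1"
begin

text \<open>Integration by parts: for each basis vector \<open>e\<close>, the function \<open>entropy1 p N u * u^(m - 1) * D1 e\<close>
has compact support, so the integral of its derivative in direction \<open>e\<close> is zero. By the product rule
this derivative is the sum of a dissipation term \<open>P e\<close> and a part \<open>Q e\<close> of the left-hand side.\<close>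

lemma integral_entropy1_flux_div:
  assumes t: "t \<in> I"
  shows "(LBINT x. zero_ext B (\<lambda>x. entropy1 p N (u t x) * flux_div t x) x)
    = - (p * (p - 1) / b\<^sup>2) * dirichlet_energy (trunc_grad N b t)"
proof -
  have N': "1 / N > 0" using N by simp
  obtain K where K: "compact K" "K \<subseteq> B" "\<And>x. x \<in> B - K \<Longrightarrow> u t x \<le> 1 / N"
    using compact_superlevel_slice[OF t N'] by metis
  note cK = compact_imp_closed[OF K(1)]
  define k where "k x = entropy2 p N (u t x)" for x
  define g where "g x = entropy1 p N (u t x)" for x
  define w where "w a x = u t x powr a" for a x
  have k0: "k x = 0" and g0: "g x = 0" if "x \<in> B - K" for x
    using K(3)[OF that] by (simp_all add: k_def g_def entropy2_eq_0[OF N] entropy1_eq_0[OF N])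
  have ck: "continuous_on B k" and cg: "continuous_on B g" and cw: "continuous_on B (w a)" for a
    using slice[OF t cont_compose_u[OF continuous_entropy2[OF N]]]
      slice[OF t cont_compose_u[OF continuous_entropy1[OF N]]] slice[OF t cont_powr_u]
    by (simp_all add: k_def[abs_def] g_def[abs_def] w_def[abs_def])
  have cD1: "continuous_on B (\<lambda>x. D1 e (t, x))" and cD2: "continuous_on B (\<lambda>x. D2 e (t, x))"
    if "e \<in> Basis" for e
    using slice[OF t cont_D1[OF that]] slice[OF t cont_D2[OF that]] .
  define P where "P e x = k x * w (m - 1) x * (D1 e (t, x))\<^sup>2" for e x
  define Q where "Q e x = g x * ((m - 1) * w (m - 2) x * (D1 e (t, x))\<^sup>2 + w (m - 1) x * D2 e (t, x))" for e x
  have cP: "continuous_on UNIV (zero_ext B (P e))" and cQ: "continuous_on UNIV (zero_ext B (Q e))"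
    if "e \<in> Basis" for e
    unfolding P_def Q_def using k0 g0 that
    by (auto intro!: continuous_zero_ext[OF _ open_ball cK K(2)] continuous_intros ck cg cw cD1 cD2)
  have sup: "zero_ext B F x = 0" if "norm c + \<rho> < norm x" for F :: "'a \<Rightarrow> real" and x
    by (rule zero_ext_ball_eq_0[OF that])
  have iP: "integrable lborel (zero_ext B (P e))" and iQ: "integrable lborel (zero_ext B (Q e))"
    if "e \<in> Basis" for e
    using cP[OF that] cQ[OF that] sup by (auto intro: integrable_bounded_support)
  have PQ: "(LBINT x. zero_ext B (P e) x) + (LBINT x. zero_ext B (Q e) x) = 0" if e: "e \<in> Basis" for e
  proof -
    have "(LBINT x. zero_ext B (\<lambda>x. P e x + Q e x) x) = 0"
    proof (rule integral_partial_eq_0[where f = "zero_ext B (\<lambda>x. g x * w (m - 1) x * D1 e (t, x))" and b = e])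
      show "continuous_on UNIV (zero_ext B (\<lambda>x. g x * w (m - 1) x * D1 e (t, x)))"
        using g0 by (auto intro!: continuous_zero_ext[OF _ open_ball cK K(2)] continuous_intros cg cw cD1[OF e])
      have "zero_ext B (\<lambda>x. P e x + Q e x) = (\<lambda>x. zero_ext B (P e) x + zero_ext B (Q e) x)"
        by (auto simp: zero_ext_def)
      then show "continuous_on UNIV (zero_ext B (\<lambda>x. P e x + Q e x))"
        using cP[OF e] cQ[OF e] by (auto intro: continuous_intros)
      fix x
      show "((\<lambda>h. zero_ext B (\<lambda>x. g x * w (m - 1) x * D1 e (t, x)) (x + h *\<^sub>R e)) has_real_derivative
          zero_ext B (\<lambda>x. P e x + Q e x) x) (at 0)"
      proof (rule DERIV_zero_ext[OF open_ball cK K(2)])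
        show "g x * w (m - 1) x * D1 e (t, x) = 0" if "x \<in> B - K" for x
          using g0[OF that] by simp
        fix x assume x: "x \<in> B"
        note du = DERIV_u[OF e t x]
        have dg: "((\<lambda>h. g (x + h *\<^sub>R e)) has_real_derivative k x * D1 e (t, x)) (at 0)"
          unfolding g_def k_def using DERIV_chain2[OF DERIV_entropy1[OF N] du] by simp
        have ux: "u t x > 0" by (rule pos_u[OF t x])
        have dw: "((\<lambda>h. w (m - 1) (x + h *\<^sub>R e)) has_real_derivative (m - 1) * w (m - 2) x * D1 e (t, x)) (at 0)"
          unfolding w_def
          using DERIV_chain2[OF _ du, where f = "\<lambda>z. z powr (m - 1)" and Da = "(m - 1) * u t x powr (m - 2)"]
            has_real_derivative_powr[OF ux, of "m - 1"] by simp
        show "((\<lambda>h. g (x + h *\<^sub>R e) * w (m - 1) (x + h *\<^sub>R e) * D1 e (t, x + h *\<^sub>R e)) has_real_derivative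
            P e x + Q e x) (at 0)"
          by (rule DERIV_cong[OF DERIV_mult[OF DERIV_mult[OF dg dw] DERIV_D1[OF e t x]]])
            (simp add: P_def Q_def power2_eq_square algebra_simps)
      qed
    qed (rule sup)
    moreover have "(\<lambda>x. zero_ext B (\<lambda>x. P e x + Q e x) x) = (\<lambda>x. zero_ext B (P e) x + zero_ext B (Q e) x)"
      by (auto simp: zero_ext_def)
    ultimately show ?thesis using iP[OF e] iQ[OF e] by simp
  qed
  have "zero_ext B (\<lambda>x. entropy1 p N (u t x) * flux_div t x) = (\<lambda>x. \<Sum>e\<in>Basis. zero_ext B (Q e) x)"
    by (auto simp: zero_ext_def Q_def g_def w_def flux_div_def sum_distrib_left)
  then have "(LBINT x. zero_ext B (\<lambda>x. entropy1 p N (u t x) * flux_div t x) x)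
      = (\<Sum>e\<in>Basis. LBINT x. zero_ext B (Q e) x)"
    using iQ by (simp add: Bochner_Integration.integral_sum)
  also have "\<dots> = (\<Sum>e\<in>Basis. - (p * (p - 1) / b\<^sup>2) * (LBINT x. (trunc_grad N b t e x)\<^sup>2))"
  proof (rule sum.cong[OF refl])
    fix e :: 'a assume e: "e \<in> Basis"
    have "zero_ext B (P e) = (\<lambda>x. p * (p - 1) / b\<^sup>2 * (trunc_grad N b t e x)\<^sup>2)"
    proof
      fix x
      show "zero_ext B (P e) x = p * (p - 1) / b\<^sup>2 * (trunc_grad N b t e x)\<^sup>2"
      proof (cases "x \<in> B")
        case True
        have "P e x = p * (p - 1) / b\<^sup>2 * (cutpow1 b N (u t x))\<^sup>2 * (D1 e (t, x))\<^sup>2"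
          unfolding P_def k_def w_def
          using entropy2_eq_cutpow1_square[OF N pos_u[OF t True] b(2,1)] by simp
        with True show ?thesis by (simp add: zero_ext_def trunc_grad_def power_mult_distrib)
      qed (simp add: zero_ext_def trunc_grad_def)
    qed
    then show "(LBINT x. zero_ext B (Q e) x)
        = - (p * (p - 1) / b\<^sup>2) * (LBINT x. (trunc_grad N b t e x)\<^sup>2)"
      using PQ[OF e] by simp
  qed
  finally show ?thesis by (simp add: dirichlet_energy_def sum_distrib_left)
qed

text \<open>The common compact support keeps the integrand continuous on a whole box of the space variable,
which permits differentiation under the integral.\<close>

lemma DERIV_entropy:
  assumes st: "{s..t} \<subseteq> I" and \<tau>: "\<tau> \<in> {s..t}"
  shows "(entropy p N has_real_derivative - (p * (p - 1) / b\<^sup>2) * dirichlet_energy (trunc_grad N b \<tau>)) (at \<tau> within {s..t})"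
proof -
  have N': "1 / N > 0" using N by simp
  obtain K where K: "compact K" "K \<subseteq> B" "\<And>\<tau> x. \<tau> \<in> {s..t} \<Longrightarrow> x \<in> B - K \<Longrightarrow> u \<tau> x \<le> 1 / N"
    using compact_superlevel[OF st N'] by metis
  note cK = compact_imp_closed[OF K(1)]
  obtain a' b' where ab: "B \<subseteq> cbox a' b'"
    using bounded_subset_cbox_symmetric[OF bounded_ball] by metis
  define F where "F \<tau> = zero_ext B (\<lambda>x. entropy0 p N (u \<tau> x))" for \<tau>
  define F' where "F' \<tau> = zero_ext B (\<lambda>x. entropy1 p N (u \<tau> x) * flux_div \<tau> x)" for \<tau>
  have sub: "continuous_on ({s..t} \<times> B) G" if "continuous_on (I \<times> B) G" for G :: "real \<times> 'a \<Rightarrow> real"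
    using st by (intro continuous_on_subset[OF that]) auto
  have cF: "continuous_on ({s..t} \<times> UNIV) (\<lambda>(\<tau>, x). F \<tau> x)"
    unfolding F_def
    using K(3) entropy0_eq_0[OF N] sub[OF cont_compose_u[OF continuous_entropy0[OF N]]]
    by (intro continuous_zero_ext_time[OF _ open_ball cK K(2)]) auto
  have cF': "continuous_on ({s..t} \<times> UNIV) (\<lambda>(\<tau>, x). F' \<tau> x)"
    unfolding F'_def
    using K(3) entropy1_eq_0[OF N]
      continuous_on_mult[OF sub[OF cont_compose_u[OF continuous_entropy1[OF N]]] sub[OF cont_flux_div]]
    by (intro continuous_zero_ext_time[OF _ open_ball cK K(2)]) (auto simp: split_beta)
  have sl: "continuous_on UNIV (\<lambda>x. G \<tau> x)"
    if "continuous_on ({s..t} \<times> UNIV) (\<lambda>(\<tau>, x). G \<tau> x)" "\<tau> \<in> {s..t}" for G :: "real \<Rightarrow> 'a \<Rightarrow> real" and \<tau>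
  proof -
    have "continuous_on UNIV (\<lambda>x::'a. (\<tau>, x))" by (intro continuous_intros)
    then have "continuous_on UNIV (\<lambda>x. (\<lambda>(\<tau>, x). G \<tau> x) (\<tau>, x))"
      by (rule continuous_on_compose2[OF that(1)]) (use that(2) in auto)
    then show ?thesis by simp
  qed
  have int_F: "integral (cbox a' b') (F \<tau>) = entropy p N \<tau>" if "\<tau> \<in> {s..t}" for \<tau>
    unfolding entropy_def F_def[symmetric] using ab
    by (intro integral_cbox_eq_lborel sl[OF cF that]) (auto simp: F_def zero_ext_def split: if_splits)
  have int_F': "integral (cbox a' b') (F' \<tau>) = - (p * (p - 1) / b\<^sup>2) * dirichlet_energy (trunc_grad N b \<tau>)"
    if "\<tau> \<in> {s..t}" for \<tau>
  proof -
    have "\<tau> \<in> I" using st that by auto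
    have "integral (cbox a' b') (F' \<tau>) = (LBINT x. F' \<tau> x)"
      using ab by (intro integral_cbox_eq_lborel sl[OF cF' that]) (auto simp: F'_def zero_ext_def split: if_splits)
    then show ?thesis using integral_entropy1_flux_div[OF \<open>\<tau> \<in> I\<close>] by (simp add: F'_def)
  qed
  have "((\<lambda>\<tau>. integral (cbox a' b') (F \<tau>)) has_real_derivative integral (cbox a' b') (F' \<tau>)) (at \<tau> within {s..t})"
  proof (rule leibniz_rule_field_derivative)
    fix \<sigma> x assume \<sigma>: "\<sigma> \<in> {s..t}"
    show "((\<lambda>\<tau>. F \<tau> x) has_real_derivative F' \<sigma> x) (at \<sigma> within {s..t})"
    proof (cases "x \<in> B")
      case True
      have "\<sigma> \<in> I" using \<sigma> st by auto
      have "((\<lambda>\<tau>. u \<tau> x) has_real_derivative flux_div \<sigma> x) (at \<sigma>)"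
        unfolding flux_div_def by (rule pde[OF \<open>\<sigma> \<in> I\<close> True])
      from DERIV_chain2[OF DERIV_entropy0[OF N] this]
      show ?thesis using True
        by (auto simp: F_def F'_def zero_ext_def intro: DERIV_subset)
    qed (simp add: F_def F'_def zero_ext_def)
  next
    fix \<sigma> assume "\<sigma> \<in> {s..t}"
    then show "F \<sigma> integrable_on cbox a' b'"
      by (intro integrable_continuous continuous_on_subset[OF sl[OF cF]]) auto
  next
    show "continuous_on ({s..t} \<times> cbox a' b') (\<lambda>(\<tau>, x). F' \<tau> x)"
      by (rule continuous_on_subset[OF cF']) auto
  qed (use \<tau> in auto)
  then show ?thesis
    unfolding int_F'[OF \<tau>]
    by (rule has_field_derivative_transform_within[where d = 1]) (use \<tau> int_F in auto)
qed

lemma entropy_decrease: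
  assumes st: "{s..t} \<subseteq> I" and "s < t"
  obtains \<xi> where "s < \<xi>" "\<xi> < t"
    "entropy p N t - entropy p N s = - (t - s) * (p * (p - 1) / b\<^sup>2 * dirichlet_energy (trunc_grad N b \<xi>))"
proof -
  have d: "(entropy p N has_real_derivative - (p * (p - 1) / b\<^sup>2) * dirichlet_energy (trunc_grad N b \<tau>)) (at \<tau>)"
    if "s < \<tau>" "\<tau> < t" for \<tau>
  proof -
    have "(entropy p N has_real_derivative - (p * (p - 1) / b\<^sup>2) * dirichlet_energy (trunc_grad N b \<tau>)) (at \<tau> within {s<..<t})"
      by (rule DERIV_subset[OF DERIV_entropy[OF st]]) (use that in auto)
    then show ?thesis using at_within_open[of \<tau> "{s<..<t}"] that by simp
  qed
  have "continuous_on {s..t} (entropy p N)"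
    using DERIV_entropy[OF st] by (intro DERIV_continuous_on)
  then obtain l \<xi> where \<xi>: "s < \<xi>" "\<xi> < t" "(entropy p N has_real_derivative l) (at \<xi>)"
    "entropy p N t - entropy p N s = (t - s) * l"
    using MVT[OF \<open>s < t\<close>, of "entropy p N"] d real_differentiable_def by blast
  have "l = - (p * (p - 1) / b\<^sup>2) * dirichlet_energy (trunc_grad N b \<xi>)"
    using \<xi>(3) d[OF \<xi>(1,2)] by (rule DERIV_unique)
  then have "entropy p N t - entropy p N s = - (t - s) * (p * (p - 1) / b\<^sup>2 * dirichlet_energy (trunc_grad N b \<xi>))"
  proof -
    have "(t - s) * (- k * e) = - (t - s) * (k * e)" for k e :: real by (simp add: algebra_simps)
    with \<xi>(4) show ?thesis unfolding \<open>l = _\<close> by metis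
  qed
  with \<xi>(1,2) show ?thesis by (rule that)
qed

end

end

section \<open>Decay of the moments\<close>

text \<open>With \<open>z = k * y powr (- \<delta>)\<close> the hypothesis reads \<open>y * (1 + z) \<le> x\<close>, and
\<open>(1 + z) powr \<delta> \<ge> 1 + \<delta> * ln (1 + z) \<ge> 1 + \<delta> * (z - z\<^sup>2)\<close>.\<close>

lemma powr_step_lower:
  fixes x y :: real
  assumes "0 < \<delta>" "0 < y0" "y0 \<le> y" "0 \<le> k" and x: "y + k * y powr (1 - \<delta>) \<le> x"
  shows "\<delta> * k - \<delta> * k\<^sup>2 * y0 powr (- \<delta>) \<le> x powr \<delta> - y powr \<delta>"
proof -
  have y: "y > 0" using assms by simp
  define z where "z = k * y powr (- \<delta>)"
  have z: "z \<ge> 0" using assms by (simp add: z_def)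
  have "y * (1 + z) = y + k * (y powr 1 * y powr (- \<delta>))"
    using y by (simp add: z_def algebra_simps)
  also have "y powr 1 * y powr (- \<delta>) = y powr (1 - \<delta>)" by (simp only: powr_add[symmetric]) simp
  finally have xz: "y * (1 + z) \<le> x" using x by simp
  have "z - z\<^sup>2 \<le> z / (1 + z)"
    using z by (simp add: field_simps power2_eq_square)
  also have "\<dots> = 1 - 1 / (1 + z)" using z by (simp add: field_simps)
  also have "\<dots> \<le> ln (1 + z)"
    using ln_le_minus_one[of "1 / (1 + z)"] z by (simp add: ln_div)
  finally have "1 + \<delta> * (z - z\<^sup>2) \<le> 1 + \<delta> * ln (1 + z)" using assms by simp
  also have "\<dots> \<le> (1 + z) powr \<delta>"
    using z exp_ge_add_one_self[of "\<delta> * ln (1 + z)"] by (simp add: powr_def)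
  finally have "y powr \<delta> * (1 + \<delta> * (z - z\<^sup>2)) \<le> y powr \<delta> * (1 + z) powr \<delta>"
    by (intro mult_left_mono) auto
  also have "\<dots> = (y * (1 + z)) powr \<delta>" using y z by (simp add: powr_mult)
  also have "\<dots> \<le> x powr \<delta>" using xz y z assms(1) by (intro powr_mono2) auto
  finally have "\<delta> * (y powr \<delta> * z) - \<delta> * (y powr \<delta> * z\<^sup>2) \<le> x powr \<delta> - y powr \<delta>"
    by (simp add: algebra_simps)
  moreover have yz: "y powr \<delta> * z = k" using y by (simp add: z_def powr_minus)
  moreover have "y powr \<delta> * z\<^sup>2 = k\<^sup>2 * y powr (- \<delta>)"
  proof -
    have "y powr \<delta> * z\<^sup>2 = (y powr \<delta> * z) * z" by (simp add: power2_eq_square)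
    also have "\<dots> = k\<^sup>2 * y powr (- \<delta>)" unfolding yz by (simp add: z_def power2_eq_square)
    finally show ?thesis .
  qed
  moreover have "y powr (- \<delta>) \<le> y0 powr (- \<delta>)"
    using assms by (intro powr_mono2') auto
  then have "\<delta> * (k\<^sup>2 * y powr (- \<delta>)) \<le> \<delta> * (k\<^sup>2 * y0 powr (- \<delta>))"
    using assms by (intro mult_left_mono) auto
  ultimately show ?thesis by (simp add: mult.assoc)
qed

text \<open>The hypothesis is a step of the implicit Euler scheme for \<open>y' = - \<kappa> y^(1 - \<delta>)\<close>, whose solutions have
an affine power \<open>y^\<delta>\<close>. A step of length \<open>h\<close> falls short of the exact decay by \<open>O(h^2)\<close> only, so the
total error over equidistant steps tends to zero.\<close>

lemma powr_decay_of_step_inequality: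
  fixes Y :: "real \<Rightarrow> real"
  assumes pos: "\<And>t. a \<le> t \<Longrightarrow> t \<le> b \<Longrightarrow> 0 < Y t" and "0 < \<delta>" "0 \<le> \<kappa>" "a < b"
    and step: "\<And>s t. a \<le> s \<Longrightarrow> s < t \<Longrightarrow> t \<le> b \<Longrightarrow> Y t - Y s \<le> - (t - s) * \<kappa> * Y t powr (1 - \<delta>)"
  shows "Y b powr \<delta> - Y a powr \<delta> \<le> - \<kappa> * \<delta> * (b - a)"
proof -
  define C where "C = \<delta> * (\<kappa> * (b - a))\<^sup>2 * Y b powr (- \<delta>)"
  have mono: "Y b \<le> Y t" if "a \<le> t" "t \<le> b" for t
  proof (cases "t = b")
    case False
    then have "Y b - Y t \<le> - (b - t) * \<kappa> * Y b powr (1 - \<delta>)" using step[of t b] that by simp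
    also have "\<dots> \<le> 0" using that \<open>0 \<le> \<kappa>\<close> by (intro mult_nonpos_nonneg) auto
    finally show ?thesis by simp
  qed simp
  have est: "\<kappa> * \<delta> * (b - a) - C / real (Suc n) \<le> Y a powr \<delta> - Y b powr \<delta>" for n
  proof -
    define h where "h = (b - a) / real (Suc n)"
    define t where "t i = a + real i * h" for i
    have h: "h > 0" using \<open>a < b\<close> by (simp add: h_def)
    have nh: "real (Suc n) * h = b - a" by (simp add: h_def del: of_nat_Suc)
    have t0: "t 0 = a" and tn: "t (Suc n) = b" using nh by (simp_all add: t_def del: of_nat_Suc)
    have tS: "t (Suc i) = t i + h" for i by (simp add: t_def algebra_simps)
    have ta: "a \<le> t i" for i using h by (simp add: t_def)
    have tb: "t i \<le> b" if "i \<le> Suc n" for i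
    proof -
      have "real i * h \<le> real (Suc n) * h" using that h by (intro mult_right_mono) auto
      then show ?thesis using nh by (simp add: t_def)
    qed
    have "(\<Sum>i<Suc n. \<delta> * (\<kappa> * h) - \<delta> * (\<kappa> * h)\<^sup>2 * Y b powr (- \<delta>))
        \<le> (\<Sum>i<Suc n. Y (t i) powr \<delta> - Y (t (Suc i)) powr \<delta>)"
    proof (rule sum_mono)
      fix i assume i: "i \<in> {..<Suc n}"
      have "Y (t (Suc i)) - Y (t i) \<le> - h * \<kappa> * Y (t (Suc i)) powr (1 - \<delta>)"
        using step[of "t i" "t (Suc i)"] ta[of i] tb[of "Suc i"] i h unfolding tS by simp
      then show "\<delta> * (\<kappa> * h) - \<delta> * (\<kappa> * h)\<^sup>2 * Y b powr (- \<delta>) \<le> Y (t i) powr \<delta> - Y (t (Suc i)) powr \<delta>"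
        using pos[of b] \<open>a < b\<close> mono[OF ta tb, of "Suc i"] i h \<open>0 < \<delta>\<close> \<open>0 \<le> \<kappa>\<close>
        by (intro powr_step_lower) (auto simp: mult_ac)
    qed
    also have "\<dots> = Y a powr \<delta> - Y b powr \<delta>"
      unfolding sum_lessThan_telescope'[of "\<lambda>i. Y (t i) powr \<delta>"] t0 tn ..
    also have "(\<Sum>i<Suc n. \<delta> * (\<kappa> * h) - \<delta> * (\<kappa> * h)\<^sup>2 * Y b powr (- \<delta>))
        = \<kappa> * \<delta> * (real (Suc n) * h) - \<delta> * \<kappa>\<^sup>2 * (real (Suc n) * h) * h * Y b powr (- \<delta>)"
      by (simp add: power_mult_distrib power2_eq_square algebra_simps del: sum.lessThan_Suc)
    also have "\<dots> = \<kappa> * \<delta> * (b - a) - C / real (Suc n)"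
      unfolding nh by (simp add: C_def h_def power2_eq_square mult_ac del: of_nat_Suc)
    finally show ?thesis .
  qed
  have "\<kappa> * \<delta> * (b - a) - 0 \<le> Y a powr \<delta> - Y b powr \<delta>"
  proof (rule tendsto_upperbound)
    show "(\<lambda>n. \<kappa> * \<delta> * (b - a) - C / real (Suc n)) \<longlonglongrightarrow> \<kappa> * \<delta> * (b - a) - 0"
      by (intro tendsto_diff tendsto_const LIMSEQ_Suc[OF lim_const_over_n])
  qed (use est in auto)
  then show ?thesis by simp
qed

lemma powr_over_n_tendsto_0:
  assumes "a > 0"
  shows "(\<lambda>n. (2 / real n) powr a) \<longlonglongrightarrow> 0"
  using assms by (intro tendsto_zero_powrI[where b = a] lim_const_over_n) auto

context positive_fde
begin

definition moment :: "real \<Rightarrow> real \<Rightarrow> real" where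
  "moment p t = (LBINT x. zero_ext B (\<lambda>x. u t x powr p) x)"

lemma bounded_u:
  assumes "{s..t} \<subseteq> I"
  obtains M where "M > 0" and "\<And>\<tau> x. \<tau> \<in> {s..t} \<Longrightarrow> x \<in> B \<Longrightarrow> u \<tau> x \<le> M"
proof -
  have "compact ((\<lambda>(t, x). u t x) ` ({s..t} \<times> cball c \<rho>))"
    using assms by (intro compact_continuous_image continuous_on_subset[OF cont_u] compact_Times) auto
  then have "bounded ((\<lambda>(t, x). u t x) ` ({s..t} \<times> cball c \<rho>))" by (rule compact_imp_bounded)
  then obtain M where "M > 0" and M: "\<And>z. z \<in> (\<lambda>(t, x). u t x) ` ({s..t} \<times> cball c \<rho>) \<Longrightarrow> norm z \<le> M"
    unfolding bounded_pos by blast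
  have "u \<tau> x \<le> M" if "\<tau> \<in> {s..t}" "x \<in> B" for \<tau> x
  proof -
    have "u \<tau> x \<in> (\<lambda>(t, x). u t x) ` ({s..t} \<times> cball c \<rho>)" using that by force
    from M[OF this] show ?thesis by simp
  qed
  with \<open>M > 0\<close> show ?thesis using that by blast
qed

lemma bounded_u_slice:
  assumes "t \<in> I"
  obtains M where "\<And>x. x \<in> B \<Longrightarrow> u t x \<le> M"
proof -
  have "{t..t} \<subseteq> I" using assms by simp
  then obtain M where "\<And>\<tau> x. \<tau> \<in> {t..t} \<Longrightarrow> x \<in> B \<Longrightarrow> u \<tau> x \<le> M"
    using bounded_u by metis
  then show ?thesis using that[of M] by simp
qed

lemma integrable_zero_ext_ball:
  assumes f: "continuous_on B f" and bd: "\<And>x. x \<in> B \<Longrightarrow> \<bar>f x\<bar> \<le> C"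
  shows "integrable lborel (zero_ext B f)"
proof (rule Bochner_Integration.integrable_bound)
  show "integrable lborel (\<lambda>x. C * indicator B x)"
    by (intro integrable_mult_right integrable_indicator_ball)
  have "(\<lambda>x. indicator B x *\<^sub>R f x) \<in> borel_measurable borel"
    by (rule borel_measurable_continuous_on_indicator[OF _ f]) simp
  moreover have "(\<lambda>x. indicator B x *\<^sub>R f x) = zero_ext B f"
    by (auto simp: zero_ext_def indicator_def)
  ultimately show "zero_ext B f \<in> borel_measurable lborel" by simp
  show "AE x in lborel. norm (zero_ext B f x) \<le> norm (C * indicator B x)"
    using bd by (intro AE_I2) (auto simp: zero_ext_def indicator_def intro: order_trans[OF _ abs_ge_self])
qed

lemma slice_powr: "t \<in> I \<Longrightarrow> continuous_on B (\<lambda>x. u t x powr a)"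
  using slice[OF _ cont_powr_u] by simp

lemma integrable_moment:
  assumes "t \<in> I" and "p > 0"
  shows "integrable lborel (zero_ext B (\<lambda>x. u t x powr p))"
proof -
  obtain M where "\<And>x. x \<in> B \<Longrightarrow> u t x \<le> M"
    using bounded_u_slice[OF assms(1)] by metis
  then have "\<bar>u t x powr p\<bar> \<le> M powr p" if "x \<in> B" for x
    using pos_u[OF assms(1) that] that assms(2) by (auto intro: powr_mono2 less_imp_le)
  then show ?thesis by (intro integrable_zero_ext_ball slice_powr assms)
qed

lemma moment_pos:
  assumes "t \<in> I" and "p > 0" and "\<rho> > 0"
  shows "0 < moment p t"
  unfolding moment_def
proof (rule integral_pos_continuous[of _ B c])
  show "continuous_on B (zero_ext B (\<lambda>x. u t x powr p))"
    by (rule continuous_on_eq[OF slice_powr[OF assms(1), of p]]) (simp add: zero_ext_def)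
  show "zero_ext B (\<lambda>x. u t x powr p) c \<noteq> 0"
    using pos_u[OF assms(1), of c] assms(3) by (simp add: zero_ext_def)
  show "integrable lborel (zero_ext B (\<lambda>x. u t x powr p))"
    by (rule integrable_moment[OF assms(1,2)])
  show "0 \<le> zero_ext B (\<lambda>x. u t x powr p) x" for x by (simp add: zero_ext_def)
qed (use assms(3) in auto)

lemma integrable_entropy:
  assumes "t \<in> I" and p: "p > 1" and N: "N > 0"
  shows "integrable lborel (zero_ext B (\<lambda>x. entropy0 p N (u t x)))"
proof -
  have "continuous_on B (\<lambda>x. entropy0 p N (u t x))"
    using slice[OF assms(1) cont_compose_u[OF continuous_entropy0[OF N]]] by simp
  moreover obtain M where M: "\<And>x. x \<in> B \<Longrightarrow> u t x \<le> M"
    using bounded_u_slice[OF assms(1)] by metis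
  have "\<bar>entropy0 p N (u t x)\<bar> \<le> M powr p" if "x \<in> B" for x
  proof -
    have "0 < u t x" by (rule pos_u[OF assms(1) that])
    then have "entropy0 p N (u t x) \<le> u t x powr p" by (intro entropy0_le[OF N p]) simp
    also have "\<dots> \<le> M powr p" using \<open>0 < u t x\<close> M[OF that] p by (intro powr_mono2) auto
    finally show ?thesis using entropy0_nonneg[OF N p] by simp
  qed
  ultimately show ?thesis by (rule integrable_zero_ext_ball)
qed

lemma entropy_le_moment:
  assumes "t \<in> I" and p: "p > 1" and N: "N > 0"
  shows "entropy p N t \<le> moment p t"
  unfolding entropy_def moment_def
  using integrable_entropy[OF assms] integrable_moment[OF assms(1)] p
proof (intro integral_mono)
  show "zero_ext B (\<lambda>x. entropy0 p N (u t x)) x \<le> zero_ext B (\<lambda>x. u t x powr p) x" for x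
    using pos_u[OF assms(1), of x] entropy0_le[OF N p, of "u t x"] by (auto simp: zero_ext_def)
qed auto

lemma moment_le_entropy:
  assumes "t \<in> I" and p: "p > 1" and N: "N > 0" and M: "\<And>x. x \<in> B \<Longrightarrow> u t x \<le> M" "M \<le> N"
  shows "moment p t - p * (2 / N) powr (p - 1) * M * measure lborel B \<le> entropy p N t"
proof -
  let ?d = "p * (2 / N) powr (p - 1) * M"
  have iB: "integrable lborel (\<lambda>x. ?d * indicator B x)"
    by (intro integrable_mult_right integrable_indicator_ball)
  have "moment p t \<le> (LBINT x. zero_ext B (\<lambda>x. entropy0 p N (u t x)) x + ?d * indicator B x)"
    unfolding moment_def
  proof (rule integral_mono)
    show "integrable lborel (zero_ext B (\<lambda>x. u t x powr p))"
      using integrable_moment[OF assms(1)] p by simp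
    show "integrable lborel (\<lambda>x. zero_ext B (\<lambda>x. entropy0 p N (u t x)) x + ?d * indicator B x)"
      by (intro Bochner_Integration.integrable_add iB integrable_entropy[OF assms(1) p N])
    fix x
    show "zero_ext B (\<lambda>x. u t x powr p) x \<le> zero_ext B (\<lambda>x. entropy0 p N (u t x)) x + ?d * indicator B x"
    proof (cases "x \<in> B")
      case True
      have u: "0 < u t x" by (rule pos_u[OF assms(1) True])
      have "u t x powr p - p * (2 / N) powr (p - 1) * u t x \<le> entropy0 p N (u t x)"
        using u M(1)[OF True] M(2) by (intro entropy0_lower[OF N p]) auto
      moreover have "p * (2 / N) powr (p - 1) * u t x \<le> ?d"
        using M(1)[OF True] p by (intro mult_left_mono) auto
      ultimately show ?thesis using True by (simp add: zero_ext_def)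
    qed (simp add: zero_ext_def)
  qed
  also have "\<dots> = entropy p N t + ?d * measure lborel B"
    using iB integrable_entropy[OF assms(1) p N] by (simp add: entropy_def emeasure_lborel_ball_finite)
  finally show ?thesis by simp
qed

lemma entropy_tendsto_moment:
  assumes "t \<in> I" and p: "p > 1"
  shows "(\<lambda>n. entropy p (real n) t) \<longlonglongrightarrow> moment p t"
proof -
  obtain M where M: "\<And>x. x \<in> B \<Longrightarrow> u t x \<le> M"
    using bounded_u_slice[OF assms(1)] by metis
  have ev: "\<forall>\<^sub>F n in sequentially. 0 < real n \<and> M \<le> real n"
    using eventually_ge_at_top[of "nat \<lceil>M\<rceil>"] eventually_gt_at_top[of 0]
    by eventually_elim linarith
  have 1: "\<forall>\<^sub>F n in sequentially. moment p t - p * (2 / real n) powr (p - 1) * M * measure lborel B \<le> entropy p (real n) t"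
    using ev by eventually_elim (use moment_le_entropy[OF assms] M in auto)
  have 2: "\<forall>\<^sub>F n in sequentially. entropy p (real n) t \<le> moment p t"
    using ev by eventually_elim (use entropy_le_moment[OF assms] in auto)
  have "(\<lambda>n. moment p t - p * (2 / real n) powr (p - 1) * M * measure lborel B)
      \<longlonglongrightarrow> moment p t - p * 0 * M * measure lborel B"
    using p by (intro tendsto_intros powr_over_n_tendsto_0) auto
  then have 3: "(\<lambda>n. moment p t - p * (2 / real n) powr (p - 1) * M * measure lborel B) \<longlonglongrightarrow> moment p t"
    by simp
  show ?thesis by (rule tendsto_sandwich[OF 1 2 3 tendsto_const])
qed

lemma entropy_mono:
  assumes "{s..t} \<subseteq> I" "s \<le> t" and p: "p > 1" "p + m - 1 > 0" and N: "N > 0"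
  shows "entropy p N t \<le> entropy p N s"
proof (cases "s = t")
  case False
  define b where "b = (p + m - 1) / 2"
  have b: "b > 0" "2 * b = p + m - 1" using p by (simp_all add: b_def)
  have "s < t" using False assms(2) by simp
  obtain \<xi> where "entropy p N t - entropy p N s
      = - (t - s) * (p * (p - 1) / b\<^sup>2 * dirichlet_energy (trunc_grad N b \<xi>))"
    using entropy_decrease[OF N b assms(1) \<open>s < t\<close>] by metis
  moreover have "0 \<le> (t - s) * (p * (p - 1) / b\<^sup>2 * dirichlet_energy (trunc_grad N b \<xi>))"
    using assms(2) p dirichlet_energy_nonneg by (intro mult_nonneg_nonneg) auto
  ultimately show ?thesis unfolding mult_minus_left by linarith
qed simp

lemma moment_mono:
  assumes "{s..t} \<subseteq> I" "s \<le> t" and p: "p > 1" "p + m - 1 > 0"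
  shows "moment p t \<le> moment p s"
proof (rule tendsto_le[OF sequentially_bot])
  show "(\<lambda>n. entropy p (real n) s) \<longlonglongrightarrow> moment p s" "(\<lambda>n. entropy p (real n) t) \<longlonglongrightarrow> moment p t"
    using assms by (auto intro: entropy_tendsto_moment)
  show "\<forall>\<^sub>F n in sequentially. entropy p (real n) t \<le> entropy p (real n) s"
    using eventually_gt_at_top[of 0] by eventually_elim (use assms in \<open>auto intro: entropy_mono\<close>)
qed

lemma moment_le_integral_trunc:
  assumes t: "t \<in> I" and N: "N > 0" and b: "b > 0" "b \<le> p"
    and M: "\<And>x. x \<in> B \<Longrightarrow> u t x \<le> M" "M \<le> N"
  shows "moment p t - (p / b) * (2 / N) powr b * (M powr b) powr (p / b - 1) * measure lborel B
    \<le> (LBINT x. \<bar>trunc N b t x\<bar> powr (p / b))"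
proof -
  let ?q = "p / b"
  let ?d = "?q * (2 / N) powr b * (M powr b) powr (?q - 1)"
  have q: "?q \<ge> 1" using b by simp
  have iB: "integrable lborel (\<lambda>x. ?d * indicator B x)"
    by (intro integrable_mult_right integrable_indicator_ball)
  obtain r where r: "continuous_on UNIV (trunc N b t)" "\<And>x. r < norm x \<Longrightarrow> trunc N b t x = 0"
    using C1cE[OF test_function_trunc(2)[OF N t]] by metis
  have iv: "integrable lborel (\<lambda>x. \<bar>trunc N b t x\<bar> powr ?q)"
    using q r by (intro integrable_bounded_support[where r = r] continuous_on_powr' continuous_intros) auto
  have "moment p t \<le> (LBINT x. \<bar>trunc N b t x\<bar> powr ?q + ?d * indicator B x)"
    unfolding moment_def
  proof (rule integral_mono)
    show "integrable lborel (zero_ext B (\<lambda>x. u t x powr p))"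
      using integrable_moment[OF t] b by simp
    show "integrable lborel (\<lambda>x. \<bar>trunc N b t x\<bar> powr ?q + ?d * indicator B x)"
      by (intro Bochner_Integration.integrable_add iB iv)
    fix x
    show "zero_ext B (\<lambda>x. u t x powr p) x \<le> \<bar>trunc N b t x\<bar> powr ?q + ?d * indicator B x"
    proof (cases "x \<in> B")
      case True
      have u: "0 < u t x" by (rule pos_u[OF t True])
      have "(u t x powr b) powr ?q - ?q * (2 / N) powr b * (M powr b) powr (?q - 1) \<le> cutpow b N (u t x) powr ?q"
        using u M(1)[OF True] M(2) q b(1) cutpow_nonneg[OF N b(1)] cutpow_lower[OF N b(1), of "u t x"]
        by (intro powr_lower_of_shift powr_mono2) auto
      then show ?thesis
        using True b(1) cutpow_nonneg[OF N b(1)]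
        by (simp add: zero_ext_def trunc_def powr_powr)
    qed (simp add: zero_ext_def)
  qed
  also have "\<dots> = (LBINT x. \<bar>trunc N b t x\<bar> powr ?q) + ?d * measure lborel B"
    using iB iv by (simp add: emeasure_lborel_ball_finite)
  finally show ?thesis by simp
qed

text \<open>The mean value theorem provides a time \<open>\<xi>\<close> at which the interpolation inequality is applied to the
truncated power. Since the moment decreases, its value at \<open>\<xi>\<close> may be replaced by that at \<open>t\<close>, and
the limit \<open>N \<longlonglongrightarrow> \<infinity>\<close> only concerns the fixed times \<open>s\<close> and \<open>t\<close>.\<close>

lemma moment_step_inequality:
  fixes p :: real
  defines "\<theta> \<equiv> real DIM('a) * (1 - m) / 2 / p"
  defines "G \<equiv> (poincare_const (ball (0::'a) 1) * \<rho>) powr (2 * (1 - \<theta>)) * sobolev_const TYPE('a) powr (2 * \<theta>)"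
  assumes st: "{s..t} \<subseteq> I" "s < t" and p: "p > 1" "p > real DIM('a) * (1 - m) / 2"
    and dim: "DIM('a) \<ge> 3" and "m < 1" and \<rho>: "\<rho> > 0"
  shows "moment p t - moment p s
    \<le> - (t - s) * (4 * p * (p - 1) / (p + m - 1)\<^sup>2 / G) * moment p t powr (1 - (1 - m) / p)"
proof -
  define d where "d = real DIM('a)"
  have d: "d \<ge> 3" using dim by (simp add: d_def)
  have "3 * (1 - m) \<le> d * (1 - m)" using d \<open>m < 1\<close> by (intro mult_right_mono) auto
  then have pm: "p + m - 1 > 0" using p \<open>m < 1\<close> unfolding d_def by simp
  define b where "b = (p + m - 1) / 2"
  have b: "b > 0" "2 * b = p + m - 1" "b \<le> p" using pm \<open>m < 1\<close> p by (simp_all add: b_def)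
  define q where "q = p / b"
  have \<theta>: "0 \<le> \<theta>" "\<theta> \<le> 1" using p \<open>m < 1\<close> by (simp_all add: \<theta>_def)
  have "1 / q = 1 / 2 - \<theta> / d"
    using p b(1) d unfolding q_def \<theta>_def d_def[symmetric] by (simp add: b_def field_simps)
  then have q: "1 / q = 1 / 2 - \<theta> / real DIM('a)" by (simp add: d_def)
  have q2: "2 / q = 1 - (1 - m) / p" using p by (simp add: q_def b_def field_simps)
  have q2pos: "2 / q > 0" using b p by (simp add: q_def)
  have P: "poincare_const (ball (0::'a) 1) * \<rho> > 0" by (rule mult_pos_pos[OF poincare_const_pos \<rho>])
  have S: "sobolev_const TYPE('a) > 0" by (rule sobolev_const_pos[OF dim])
  have "x powr a > 0" if "x > 0" for x a :: real using that by simp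
  from mult_pos_pos[OF this[OF P] this[OF S]] have G: "G > 0" unfolding G_def .
  define k where "k = p * (p - 1) / b\<^sup>2"
  have k: "k \<ge> 0" using p by (simp add: k_def)
  have kb: "k = 4 * p * (p - 1) / (p + m - 1)\<^sup>2" by (simp add: k_def b_def power_divide)
  obtain M where M: "\<And>\<tau> x. \<tau> \<in> {s..t} \<Longrightarrow> x \<in> B \<Longrightarrow> u \<tau> x \<le> M"
    using bounded_u[OF st(1)] by metis
  \<comment> \<open>the error of replacing the power by its truncation, from \<open>moment_le_integral_trunc\<close>\<close>
  define \<omega> where "\<omega> N = q * (2 / N) powr b * (M powr b) powr (q - 1) * measure lborel B" for N
  have tI: "t \<in> I" "s \<in> I" using st by auto
  have est: "entropy p N t - entropy p N s \<le> - (t - s) * (k / G) * max 0 (moment p t - \<omega> N) powr (2 / q)"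
    if N: "N > 0" "M \<le> N" for N
  proof -
    obtain \<xi> where \<xi>: "s < \<xi>" "\<xi> < t"
      "entropy p N t - entropy p N s = - (t - s) * (p * (p - 1) / b\<^sup>2 * dirichlet_energy (trunc_grad N b \<xi>))"
      using entropy_decrease[OF N(1) b(1,2) st] by metis
    have \<xi>I: "\<xi> \<in> I" "{\<xi>..t} \<subseteq> I" using \<xi> st by auto
    note tf = test_function_trunc[OF N(1) \<xi>I(1), of b]
    have "dirichlet_energy (\<lambda>e. dir_deriv e (trunc N b \<xi>)) = dirichlet_energy (trunc_grad N b \<xi>)"
      unfolding dirichlet_energy_def by (intro sum.cong refl) (simp add: C1c_dir_deriv[OF tf(2)])
    then have gn: "(LBINT x. \<bar>trunc N b \<xi> x\<bar> powr q) powr (2 / q) \<le> G * dirichlet_energy (trunc_grad N b \<xi>)"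
      using gagliardo_nirenberg_ball[OF tf(1) \<rho> dim \<theta> q] by (simp add: G_def)
    have "moment p t - \<omega> N \<le> moment p \<xi> - \<omega> N"
      using moment_mono[OF \<xi>I(2) _ p(1) pm] \<xi> by simp
    also have "\<dots> \<le> (LBINT x. \<bar>trunc N b \<xi> x\<bar> powr q)"
      using moment_le_integral_trunc[OF \<xi>I(1) N(1) b(1,3) M N(2)] \<xi> by (simp add: \<omega>_def q_def)
    finally have "max 0 (moment p t - \<omega> N) \<le> (LBINT x. \<bar>trunc N b \<xi> x\<bar> powr q)"
      by (auto intro: integral_nonneg_AE)
    then have "max 0 (moment p t - \<omega> N) powr (2 / q) \<le> (LBINT x. \<bar>trunc N b \<xi> x\<bar> powr q) powr (2 / q)"
      using q2pos by (intro powr_mono2) auto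
    also note gn
    finally have "(t - s) * (k / G) * max 0 (moment p t - \<omega> N) powr (2 / q)
        \<le> (t - s) * (k / G) * (G * dirichlet_energy (trunc_grad N b \<xi>))"
      using st(2) k G by (intro mult_left_mono) auto
    also have "\<dots> = (t - s) * (k * dirichlet_energy (trunc_grad N b \<xi>))" using G by simp
    finally show ?thesis
      unfolding \<xi>(3) k_def[symmetric] mult_minus_left by linarith
  qed
  have "moment p t - moment p s \<le> - (t - s) * (k / G) * max 0 (moment p t - 0) powr (2 / q)"
  proof (rule tendsto_le[OF sequentially_bot])
    show "(\<lambda>n. entropy p (real n) t - entropy p (real n) s) \<longlonglongrightarrow> moment p t - moment p s"
      by (intro tendsto_diff entropy_tendsto_moment tI p)
    have "(\<lambda>n. \<omega> (real n)) \<longlonglongrightarrow> q * 0 * (M powr b) powr (q - 1) * measure lborel B"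
      unfolding \<omega>_def by (intro tendsto_intros powr_over_n_tendsto_0 b)
    then have \<omega>: "(\<lambda>n. \<omega> (real n)) \<longlonglongrightarrow> 0" by simp
    have "(\<lambda>n. max 0 (moment p t - \<omega> (real n)) powr (2 / q)) \<longlonglongrightarrow> max 0 (moment p t - 0) powr (2 / q)"
      using q2pos by (intro tendsto_powr' tendsto_max tendsto_diff tendsto_const \<omega>) auto
    then show "(\<lambda>n. - (t - s) * (k / G) * max 0 (moment p t - \<omega> (real n)) powr (2 / q))
        \<longlonglongrightarrow> - (t - s) * (k / G) * max 0 (moment p t - 0) powr (2 / q)"
      by (intro tendsto_mult tendsto_const)
    show "\<forall>\<^sub>F n in sequentially. entropy p (real n) t - entropy p (real n) s
        \<le> - (t - s) * (k / G) * max 0 (moment p t - \<omega> (real n)) powr (2 / q)"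
      using eventually_ge_at_top[of "nat \<lceil>M\<rceil>"] eventually_gt_at_top[of 0]
      by eventually_elim (rule est; linarith)
  qed
  moreover have "max 0 (moment p t - 0) = moment p t"
    using moment_pos[OF tI(1) _ \<rho>, of p] p by simp
  ultimately show ?thesis by (simp only: kb q2)
qed

end

section \<open>Solutions of the Dirichlet problem\<close>

context positive_fde
begin

lemma moment_powr_decay:
  fixes p :: real
  defines "\<theta> \<equiv> real DIM('a) * (1 - m) / 2 / p"
  defines "G \<equiv> (poincare_const (ball (0::'a) 1) * \<rho>) powr (2 * (1 - \<theta>)) * sobolev_const TYPE('a) powr (2 * \<theta>)"
  assumes st: "{s..t} \<subseteq> I" "s < t" and p: "p > 1" "p > real DIM('a) * (1 - m) / 2"
    and dim: "DIM('a) \<ge> 3" and m: "m < 1" and \<rho>: "\<rho> > 0"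
  shows "moment p t powr ((1 - m) / p) - moment p s powr ((1 - m) / p)
    \<le> - (4 * (1 - m) * (p - 1) / (p + m - 1)\<^sup>2 / G) * (t - s)"
proof -
  let ?\<kappa> = "4 * p * (p - 1) / (p + m - 1)\<^sup>2 / G"
  have G: "G \<ge> 0" by (simp add: G_def)
  have "moment p t powr ((1 - m) / p) - moment p s powr ((1 - m) / p)
      \<le> - ?\<kappa> * ((1 - m) / p) * (t - s)"
  proof (rule powr_decay_of_step_inequality)
    show "0 < moment p \<tau>" if "s \<le> \<tau>" "\<tau> \<le> t" for \<tau>
      using that st p \<rho> by (intro moment_pos) auto
    show "0 \<le> ?\<kappa>" using p G by simp
    fix s' t' assume *: "s \<le> s'" "s' < t'" "t' \<le> t"
    then have "{s'..t'} \<subseteq> I" using st by auto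
    from moment_step_inequality[OF this *(2) p dim m \<rho>]
    show "moment p t' - moment p s' \<le> - (t' - s') * ?\<kappa> * moment p t' powr (1 - (1 - m) / p)"
      by (simp add: G_def \<theta>_def)
  qed (use st p m in auto)
  also have "?\<kappa> * ((1 - m) / p) = 4 * (1 - m) * (p - 1) / (p + m - 1)\<^sup>2 / G"
    using p by simp
  then have "- ?\<kappa> * ((1 - m) / p) = - (4 * (1 - m) * (p - 1) / (p + m - 1)\<^sup>2 / G)" by simp
  finally show ?thesis .
qed

lemma Lp_norm_eq_moment:
  assumes "t \<in> I" and "p > 0"
  shows "Lp_norm p B (u t) = moment p t powr (1 / p)"
proof -
  have i: "integrable lborel (zero_ext B (\<lambda>x. u t x powr p))"
    by (rule integrable_moment[OF assms])
  have "set_lebesgue_integral lebesgue B (\<lambda>x. norm (u t x) powr p)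
      = (\<integral>x. zero_ext B (\<lambda>x. u t x powr p) x \<partial>lebesgue)"
    unfolding set_lebesgue_integral_def
  proof (intro arg_cong[where f = "integral\<^sup>L lebesgue"] ext)
    show "indicat_real B x *\<^sub>R (norm (u t x) powr p) = zero_ext B (\<lambda>x. u t x powr p) x" for x
      using pos_u[OF assms(1), of x] by (cases "x \<in> B") (auto simp: zero_ext_def)
  qed
  also have "\<dots> = moment p t"
    unfolding moment_def using i by (intro integral_completion) auto
  finally show ?thesis by (simp add: Lp_norm_def)
qed

lemma entropy_eq_set_integral:
  assumes "t \<in> I" and p: "p > 1" and N: "N > 0"
  shows "entropy p N t = set_lebesgue_integral lebesgue B (\<lambda>x. entropy0 p N (u t x))"
proof -
  have "set_lebesgue_integral lebesgue B (\<lambda>x. entropy0 p N (u t x))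
      = (\<integral>x. zero_ext B (\<lambda>x. entropy0 p N (u t x)) x \<partial>lebesgue)"
    unfolding set_lebesgue_integral_def
    by (intro arg_cong[where f = "integral\<^sup>L lebesgue"]) (auto simp: zero_ext_def indicator_def)
  also have "\<dots> = entropy p N t"
    unfolding entropy_def using integrable_entropy[OF assms] by (intro integral_completion) auto
  finally show ?thesis ..
qed

end

text \<open>Lets the continuity in \<open>L^1\<close> at the initial time act on the truncated entropies.\<close>

lemma lipschitz_set_integral:
  fixes f g :: "'a::euclidean_space \<Rightarrow> real" and \<Phi> :: "real \<Rightarrow> real"
  assumes \<Phi>: "\<And>x y. \<bar>\<Phi> x - \<Phi> y\<bar> \<le> L * \<bar>x - y\<bar>" "\<Phi> 0 = 0" and c: "continuous_on UNIV \<Phi>"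
    and f: "f \<in> Lp_space 1 S" and g: "g \<in> Lp_space 1 S"
  shows "set_integrable lebesgue S (\<lambda>x. \<Phi> (f x))"
    and "set_lebesgue_integral lebesgue S (\<lambda>x. \<Phi> (f x))
      \<le> set_lebesgue_integral lebesgue S (\<lambda>x. \<Phi> (g x)) + L * Lp_norm 1 S (\<lambda>x. f x - g x)"
proof -
  have [measurable]: "\<Phi> \<in> borel_measurable borel" using c by (rule borel_measurable_continuous_onI)
  have fi: "integrable lebesgue (\<lambda>x. \<bar>indicator S x *\<^sub>R f x\<bar>)"
    and fm[measurable]: "(\<lambda>x. indicator S x *\<^sub>R f x) \<in> borel_measurable lebesgue"
    if "f \<in> Lp_space 1 S" for f :: "'a \<Rightarrow> real"
  proof -
    have "(\<lambda>x. \<bar>indicator S x *\<^sub>R f x\<bar>) = (\<lambda>x. indicator S x *\<^sub>R (norm (f x) powr 1))"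
      by (auto simp: indicator_def)
    with that show "integrable lebesgue (\<lambda>x. \<bar>indicator S x *\<^sub>R f x\<bar>)"
      unfolding Lp_space_def set_integrable_def by simp
    from that show "(\<lambda>x. indicator S x *\<^sub>R f x) \<in> borel_measurable lebesgue"
      unfolding Lp_space_def set_borel_measurable_def by simp
  qed
  have eq: "(\<lambda>x. indicator S x *\<^sub>R \<Phi> (f x)) = (\<lambda>x. \<Phi> (indicator S x *\<^sub>R f x))" for f
    using \<Phi>(2) by (auto simp: indicator_def)
  have int: "integrable lebesgue (\<lambda>x. \<Phi> (indicator S x *\<^sub>R f x))" if "f \<in> Lp_space 1 S" for f
  proof (rule Bochner_Integration.integrable_bound)
    show "integrable lebesgue (\<lambda>x. L * \<bar>indicator S x *\<^sub>R f x\<bar>)"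
      using fi[OF that] by (rule integrable_mult_right)
    show "(\<lambda>x. \<Phi> (indicator S x *\<^sub>R f x)) \<in> borel_measurable lebesgue"
      using measurable_compose[OF fm[OF that], of \<Phi>] by simp
    have "\<bar>\<Phi> y\<bar> \<le> \<bar>L * \<bar>y\<bar>\<bar>" for y
      using \<Phi>(1)[of y 0] \<Phi>(2) by simp
    then show "AE x in lebesgue. norm (\<Phi> (indicator S x *\<^sub>R f x)) \<le> norm (L * \<bar>indicator S x *\<^sub>R f x\<bar>)"
      by (intro AE_I2) (simp only: real_norm_def)
  qed
  show "set_integrable lebesgue S (\<lambda>x. \<Phi> (f x))"
    unfolding set_integrable_def eq by (rule int[OF f])
  have id: "integrable lebesgue (\<lambda>x. \<bar>indicator S x *\<^sub>R f x - indicator S x *\<^sub>R g x\<bar>)"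
  proof (rule Bochner_Integration.integrable_bound)
    show "integrable lebesgue (\<lambda>x. \<bar>indicator S x *\<^sub>R f x\<bar> + \<bar>indicator S x *\<^sub>R g x\<bar>)"
      by (intro Bochner_Integration.integrable_add fi f g)
    show "(\<lambda>x. \<bar>indicator S x *\<^sub>R f x - indicator S x *\<^sub>R g x\<bar>) \<in> borel_measurable lebesgue"
      using fm[OF f] fm[OF g] by measurable
    show "AE x in lebesgue. norm \<bar>indicator S x *\<^sub>R f x - indicator S x *\<^sub>R g x\<bar>
        \<le> norm (\<bar>indicator S x *\<^sub>R f x\<bar> + \<bar>indicator S x *\<^sub>R g x\<bar>)"
      by (intro AE_I2) auto
  qed
  have N: "Lp_norm 1 S (\<lambda>x. f x - g x) = (\<integral>x. \<bar>indicator S x *\<^sub>R f x - indicator S x *\<^sub>R g x\<bar> \<partial>lebesgue)"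
  proof -
    have "set_lebesgue_integral lebesgue S (\<lambda>x. norm (f x - g x) powr 1)
        = (\<integral>x. \<bar>indicator S x *\<^sub>R f x - indicator S x *\<^sub>R g x\<bar> \<partial>lebesgue)"
      unfolding set_lebesgue_integral_def
      by (intro arg_cong[where f = "integral\<^sup>L lebesgue"]) (auto simp: indicator_def)
    then show ?thesis by (simp add: Lp_norm_def integral_nonneg_AE)
  qed
  have "set_lebesgue_integral lebesgue S (\<lambda>x. \<Phi> (f x))
      \<le> (\<integral>x. \<Phi> (indicator S x *\<^sub>R g x) + L * \<bar>indicator S x *\<^sub>R f x - indicator S x *\<^sub>R g x\<bar> \<partial>lebesgue)"
    unfolding set_lebesgue_integral_def eq
  proof (rule integral_mono)
    show "integrable lebesgue (\<lambda>x. \<Phi> (indicator S x *\<^sub>R g x)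
        + L * \<bar>indicator S x *\<^sub>R f x - indicator S x *\<^sub>R g x\<bar>)"
      by (intro Bochner_Integration.integrable_add integrable_mult_right id int g)
    show "\<Phi> (indicator S x *\<^sub>R f x)
        \<le> \<Phi> (indicator S x *\<^sub>R g x) + L * \<bar>indicator S x *\<^sub>R f x - indicator S x *\<^sub>R g x\<bar>" for x
      using \<Phi>(1)[of "indicator S x *\<^sub>R f x" "indicator S x *\<^sub>R g x"] by linarith
  qed (rule int[OF f])
  also have "\<dots> = set_lebesgue_integral lebesgue S (\<lambda>x. \<Phi> (g x)) + L * Lp_norm 1 S (\<lambda>x. f x - g x)"
    unfolding N set_lebesgue_integral_def eq
    using int[OF g] id by simp
  finally show "set_lebesgue_integral lebesgue S (\<lambda>x. \<Phi> (f x))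
      \<le> set_lebesgue_integral lebesgue S (\<lambda>x. \<Phi> (g x)) + L * Lp_norm 1 S (\<lambda>x. f x - g x)" .
qed

text \<open>Convergence in \<open>L^1\<close> alone bounds the initial moment from above, by Fatou's lemma, and not from
below. The reverse comparison holds for each truncated entropy: it decreases in time, is continuous at
time \<open>0\<close>, and is initially at most the moment. At time \<open>t\<close> it tends to the moment as \<open>N \<longlonglongrightarrow> \<infinity>\<close>.\<close>

lemma (in positive_fde) moment_le_initial:
  assumes I: "{0<..t} \<subseteq> I" "t > 0" and p: "p > 1" "p + m - 1 > 0"
    and L1: "\<And>\<tau>. \<tau> \<in> insert 0 {0<..t} \<Longrightarrow> u \<tau> \<in> Lp_space 1 B"
    and lim: "((\<lambda>\<tau>. Lp_norm 1 B (\<lambda>x. u \<tau> x - u 0 x)) \<longlongrightarrow> 0) (at 0 within {0<..t})"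
    and Lp: "set_integrable lebesgue B (\<lambda>x. norm (u 0 x) powr p)"
  shows "moment p t \<le> set_lebesgue_integral lebesgue B (\<lambda>x. norm (u 0 x) powr p)"
proof -
  let ?s = "\<lambda>n. t / real (Suc n)"
  have s: "?s n \<in> {0<..t}" for n using I(2) by (auto simp: field_simps)
  have s_lim: "filterlim ?s (at 0 within {0<..t}) sequentially"
    unfolding filterlim_at using s LIMSEQ_Suc[OF lim_const_over_n[of t]] I(2)
    by (auto intro!: always_eventually)
  have ent: "entropy p N t \<le> set_lebesgue_integral lebesgue B (\<lambda>x. norm (u 0 x) powr p)" if N: "N > 0" for N
  proof -
    let ?\<Phi> = "entropy0 p N" and ?L = "p * (N + 1) powr (p - 1)"
    let ?E = "set_lebesgue_integral lebesgue B (\<lambda>x. ?\<Phi> (u 0 x))"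
    have \<Phi>0: "?\<Phi> 0 = 0" using N by (intro entropy0_eq_0[OF N]) simp
    note lip = lipschitz_set_integral[OF entropy0_lipschitz[OF N p(1)] \<Phi>0 continuous_entropy0[OF N]]
    have "entropy p N t \<le> ?E + ?L * Lp_norm 1 B (\<lambda>x. u (?s n) x - u 0 x)" for n
    proof -
      have "{?s n..t} \<subseteq> {0<..t}" using s[of n] by auto
      then have sI: "?s n \<in> I" "{?s n..t} \<subseteq> I" "?s n \<le> t" using s[of n] I(1) by auto
      have "entropy p N t \<le> entropy p N (?s n)"
        by (rule entropy_mono[OF sI(2,3) p N])
      also have "\<dots> = set_lebesgue_integral lebesgue B (\<lambda>x. ?\<Phi> (u (?s n) x))"
        by (rule entropy_eq_set_integral[OF sI(1) p(1) N])
      also have "\<dots> \<le> ?E + ?L * Lp_norm 1 B (\<lambda>x. u (?s n) x - u 0 x)"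
        using s[of n] by (intro lip(2) L1) auto
      finally show ?thesis .
    qed
    moreover have "(\<lambda>n. ?E + ?L * Lp_norm 1 B (\<lambda>x. u (?s n) x - u 0 x)) \<longlonglongrightarrow> ?E + ?L * 0"
      by (intro tendsto_intros filterlim_compose[OF lim s_lim])
    ultimately have "entropy p N t \<le> ?E + ?L * 0"
      by (intro tendsto_lowerbound[of _ _ sequentially]) auto
    also have "\<dots> \<le> set_lebesgue_integral lebesgue B (\<lambda>x. norm (u 0 x) powr p)"
    proof -
      have "?E \<le> set_lebesgue_integral lebesgue B (\<lambda>x. norm (u 0 x) powr p)"
      proof (rule set_integral_mono)
        show "set_integrable lebesgue B (\<lambda>x. ?\<Phi> (u 0 x))"
          by (rule lip(1)[OF L1 L1]) auto
        fix x
        show "?\<Phi> (u 0 x) \<le> norm (u 0 x) powr p"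
        proof (cases "u 0 x \<ge> 0")
          case True
          then show ?thesis using entropy0_le[OF N p(1) True] by simp
        next
          case False
          then have "?\<Phi> (u 0 x) = 0" using N
            by (intro entropy0_eq_0[OF N]) (simp add: order_trans[of _ 0])
          then show ?thesis by simp
        qed
      qed (rule Lp)
      then show ?thesis by simp
    qed
    finally show ?thesis .
  qed
  have "t \<in> I" using I by auto
  show ?thesis
  proof (rule tendsto_upperbound[OF entropy_tendsto_moment[OF \<open>t \<in> I\<close> p(1)]])
    show "\<forall>\<^sub>F n in sequentially. entropy p (real n) t
        \<le> set_lebesgue_integral lebesgue B (\<lambda>x. norm (u 0 x) powr p)"
      using eventually_gt_at_top[of 0] by eventually_elim (use ent in auto)
  qed simp
qed

lemma laplacian_fde_nonlin:
  fixes v :: "'a::euclidean_space \<Rightarrow> real"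
  assumes S: "open S" and pos: "\<And>x. x \<in> S \<Longrightarrow> 0 < v x"
    and d1: "\<And>b x. b \<in> Basis \<Longrightarrow> x \<in> S \<Longrightarrow> ((\<lambda>h. v (x + h *\<^sub>R b)) has_real_derivative D1 b x) (at 0)"
    and d2: "\<And>b x. b \<in> Basis \<Longrightarrow> x \<in> S \<Longrightarrow> ((\<lambda>h. D1 b (x + h *\<^sub>R b)) has_real_derivative D2 b x) (at 0)"
    and x: "x \<in> S"
  shows "laplacian (\<lambda>y. fde_nonlin m (v y)) x
    = (\<Sum>b\<in>Basis. (m - 1) * v x powr (m - 2) * (D1 b x)\<^sup>2 + v x powr (m - 1) * D2 b x)"
  unfolding laplacian_def
proof (rule sum.cong[OF refl])
  fix b :: 'a assume b: "b \<in> Basis"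
  let ?w = "\<lambda>y. v y powr (m - 1) * D1 b y"
  have \<phi>: "(fde_nonlin m has_real_derivative r powr (m - 1)) (at r)" if "r > 0" for r
  proof (cases "m = 0")
    case True
    then show ?thesis
      unfolding fde_nonlin_def[abs_def] using that
      by (auto intro!: derivative_eq_intros simp: powr_minus divide_inverse)
  next
    case False
    then have "((\<lambda>r. r powr m / m) has_real_derivative m * r powr (m - 1) / m) (at r)"
      by (intro DERIV_cdivide has_real_derivative_powr that)
    then show ?thesis using False by (simp add: fde_nonlin_def[abs_def])
  qed
  have w: "dir_deriv b (\<lambda>y. fde_nonlin m (v y)) y = ?w y" if "y \<in> S" for y
    unfolding dir_deriv_def
    using DERIV_chain2[OF \<phi> d1[OF b that]] pos[OF that] by (intro DERIV_imp_deriv) simp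
  have "\<forall>\<^sub>F h in nhds 0. x + h *\<^sub>R b \<in> S"
    using S x by (rule eventually_line_in_open)
  then have ev: "\<forall>\<^sub>F h in nhds 0. dir_deriv b (\<lambda>y. fde_nonlin m (v y)) (x + h *\<^sub>R b) = ?w (x + h *\<^sub>R b)"
    by eventually_elim (rule w)
  have "((\<lambda>r. r powr (m - 1)) has_real_derivative (m - 1) * v x powr (m - 2)) (at (v (x + 0 *\<^sub>R b)))"
    using has_real_derivative_powr[OF pos[OF x], of "m - 1"] by simp
  from DERIV_chain2[OF this d1[OF b x]]
  have "((\<lambda>h. ?w (x + h *\<^sub>R b)) has_real_derivative
      (m - 1) * v x powr (m - 2) * (D1 b x)\<^sup>2 + v x powr (m - 1) * D2 b x) (at 0)"
    by (rule DERIV_cong[OF DERIV_mult[OF _ d2[OF b x]]]) (simp add: power2_eq_square)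
  then have "((\<lambda>h. dir_deriv b (\<lambda>y. fde_nonlin m (v y)) (x + h *\<^sub>R b)) has_real_derivative
      (m - 1) * v x powr (m - 2) * (D1 b x)\<^sup>2 + v x powr (m - 1) * D2 b x) (at 0)"
    by (subst DERIV_cong_ev[OF refl ev refl])
  then show "dir_deriv b (dir_deriv b (\<lambda>y. fde_nonlin m (v y))) x
      = (m - 1) * v x powr (m - 2) * (D1 b x)\<^sup>2 + v x powr (m - 1) * D2 b x"
    unfolding dir_deriv_def[of b "dir_deriv b _"] by (rule DERIV_imp_deriv)
qed

lemma smooth_on_space_derivatives:
  fixes u :: "real \<Rightarrow> 'a::euclidean_space \<Rightarrow> real"
  assumes "smooth_on (I \<times> S) (\<lambda>(t, x). u t x)"
  shows "\<exists>D1 D2 :: 'a \<Rightarrow> real \<times> 'a \<Rightarrow> real. \<forall>b\<in>Basis.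
      continuous_on (I \<times> S) (D1 b) \<and> continuous_on (I \<times> S) (D2 b) \<and>
      (\<forall>t\<in>I. \<forall>x\<in>S. ((\<lambda>h. u t (x + h *\<^sub>R b)) has_real_derivative D1 b (t, x)) (at 0) \<and>
        ((\<lambda>h. D1 b (t, x + h *\<^sub>R b)) has_real_derivative D2 b (t, x)) (at 0))"
proof -
  let ?U = "\<lambda>(t, x). u t x"
  have "Ck_on (Suc (Suc 0)) (I \<times> S) ?U" using assms unfolding smooth_on_def by blast
  then have C: "\<forall>e\<in>Basis. \<exists>g. (\<forall>z\<in>I \<times> S. ((\<lambda>h. ?U (z + h *\<^sub>R e)) has_real_derivative g z) (at 0)) \<and>
      Ck_on (Suc 0) (I \<times> S) g"
    unfolding Ck_on.simps(2)[of "Suc 0"] by blast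
  define P :: "'a \<Rightarrow> (real \<times> 'a \<Rightarrow> real) \<Rightarrow> (real \<times> 'a \<Rightarrow> real) \<Rightarrow> bool" where
    "P b g1 g2 \<longleftrightarrow> continuous_on (I \<times> S) g1 \<and> continuous_on (I \<times> S) g2 \<and>
      (\<forall>t\<in>I. \<forall>x\<in>S. ((\<lambda>h. u t (x + h *\<^sub>R b)) has_real_derivative g1 (t, x)) (at 0) \<and>
        ((\<lambda>h. g1 (t, x + h *\<^sub>R b)) has_real_derivative g2 (t, x)) (at 0))" for b g1 g2
  have "\<exists>g1 g2. P b g1 g2" if "b \<in> Basis" for b :: 'a
  proof -
    have e: "(0, b) \<in> (Basis :: (real \<times> 'a) set)" using that by (simp add: Basis_prod_def)
    obtain g1 where g1: "\<And>z. z \<in> I \<times> S \<Longrightarrow> ((\<lambda>h. ?U (z + h *\<^sub>R (0, b))) has_real_derivative g1 z) (at 0)"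
      "Ck_on (Suc 0) (I \<times> S) g1"
      using C e by blast
    obtain g2 where g2: "\<And>z. z \<in> I \<times> S \<Longrightarrow> ((\<lambda>h. g1 (z + h *\<^sub>R (0, b))) has_real_derivative g2 z) (at 0)"
      "continuous_on (I \<times> S) g2"
      using g1(2) e unfolding Ck_on.simps by blast
    have "continuous_on (I \<times> S) g1" using g1(2) by simp
    then show ?thesis
      unfolding P_def using g1(1) g2 by (intro exI[of _ g1] exI[of _ g2]) force
  qed
  then have "\<forall>b\<in>Basis. \<exists>g1 g2. P b g1 g2" by blast
  from bchoice[OF this] obtain D1 where "\<forall>b\<in>Basis. \<exists>g2. P b (D1 b) g2" by blast
  from bchoice[OF this] obtain D2 where "\<forall>b\<in>Basis. P b (D1 b) (D2 b)" by blast
  then show ?thesis unfolding P_def by blast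
qed

lemma fde_dirichlet_solution_positive_fde:
  fixes c :: "'a::euclidean_space"
  assumes "fde_dirichlet_solution m (ball c \<rho>) T u0 u" and \<rho>: "\<rho> > 0"
  obtains D1 D2 where "positive_fde m \<rho> c {t. 0 < t \<and> ereal t < T} u D1 D2"
proof -
  let ?I = "{t. 0 < t \<and> ereal t < T}"
  have sm: "smooth_on (?I \<times> ball c \<rho>) (\<lambda>(t, x). u t x)"
    and pos: "\<And>t x. t \<in> ?I \<Longrightarrow> x \<in> ball c \<rho> \<Longrightarrow> 0 < u t x"
    and eqn: "\<And>t x. t \<in> ?I \<Longrightarrow> x \<in> ball c \<rho> \<Longrightarrow>
      ((\<lambda>\<tau>. u \<tau> x) has_real_derivative laplacian (\<lambda>y. fde_nonlin m (u t y)) x) (at t)"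
    and cont: "continuous_on (?I \<times> closure (ball c \<rho>)) (\<lambda>(t, x). u t x)"
    and bdry: "\<And>t x. t \<in> ?I \<Longrightarrow> x \<in> frontier (ball c \<rho>) \<Longrightarrow> u t x = 0"
    using assms(1) unfolding fde_dirichlet_solution_def Let_def by blast+
  obtain D1 D2 :: "'a \<Rightarrow> real \<times> 'a \<Rightarrow> real" where D: "\<forall>b\<in>Basis.
      continuous_on (?I \<times> ball c \<rho>) (D1 b) \<and> continuous_on (?I \<times> ball c \<rho>) (D2 b) \<and>
      (\<forall>t\<in>?I. \<forall>x\<in>ball c \<rho>. ((\<lambda>h. u t (x + h *\<^sub>R b)) has_real_derivative D1 b (t, x)) (at 0) \<and>
        ((\<lambda>h. D1 b (t, x + h *\<^sub>R b)) has_real_derivative D2 b (t, x)) (at 0))"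
    using smooth_on_space_derivatives[OF sm] by blast
  have "positive_fde m \<rho> c ?I u D1 D2"
  proof
    show "continuous_on (?I \<times> cball c \<rho>) (\<lambda>(t, x). u t x)" using cont \<rho> by simp
    show "u t x = 0" if "t \<in> ?I" "x \<in> sphere c \<rho>" for t x
      using bdry[of t x] that \<rho> by simp
    fix t x assume t: "t \<in> ?I" and x: "x \<in> ball c \<rho>"
    have "laplacian (\<lambda>y. fde_nonlin m (u t y)) x
        = (\<Sum>b\<in>Basis. (m - 1) * u t x powr (m - 2) * (D1 b (t, x))\<^sup>2 + u t x powr (m - 1) * D2 b (t, x))"
      by (rule laplacian_fde_nonlin[where v = "u t" and ?D1.0 = "\<lambda>b x. D1 b (t, x)"
          and ?D2.0 = "\<lambda>b x. D2 b (t, x)", OF open_ball])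
        (use pos D t x in blast)+
    with eqn[OF t x] show "((\<lambda>\<tau>. u \<tau> x) has_real_derivative
        (\<Sum>b\<in>Basis. (m - 1) * u t x powr (m - 2) * (D1 b (t, x))\<^sup>2 + u t x powr (m - 1) * D2 b (t, x))) (at t)"
      by simp
  qed (use pos D in auto)
  then show ?thesis by (rule that)
qed

theorem proposition1p7:
  fixes m \<alpha> R p d pc SS PP K :: real
    and c :: "real ^ 'n"
    and T :: ereal
    and u0 :: "real ^ 'n \<Rightarrow> real"
    and u :: "real \<Rightarrow> real ^ 'n \<Rightarrow> real"
  defines "d \<equiv> real CARD('n)"
    and "pc \<equiv> d * (1 - m) / 2"
    and "SS \<equiv> sobolev_const TYPE(real ^ 'n)"
    and "PP \<equiv> poincare_const (ball (0 :: real ^ 'n) 1)"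
    and "K \<equiv> 4 * (1 - m) * (p - 1) / (p + m - 1)\<^sup>2
               * (PP * \<alpha> * R) powr (- 2 * (1 - pc / p)) * SS powr (- 2 * pc / p)"
  assumes "CARD('n) \<ge> 3" and "m < 1" and "\<alpha> \<ge> 1" and "R > 0" and "p > max pc 1"
    and "u0 \<in> Lp_space p (ball c (\<alpha> * R))"
    and "AE x in lebesgue. x \<in> ball c (\<alpha> * R) \<longrightarrow> 0 \<le> u0 x"
    and "AE x in lebesgue. x \<in> ball c (\<alpha> * R) - ball c R \<longrightarrow> u0 x = 0"
    and "fde_dirichlet_solution m (ball c (\<alpha> * R)) T u0 u"
    and "extinction_time (ball c (\<alpha> * R)) u T"
  shows "K > 0 \<and>
    (\<forall>s t. 0 \<le> s \<and> s \<le> t \<and> ereal t \<le> T \<longrightarrow>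
       Lp_norm p (ball c (\<alpha> * R)) (u t) powr (1 - m)
         - Lp_norm p (ball c (\<alpha> * R)) (u s) powr (1 - m) \<le> - K * (t - s))"
proof -
  define \<rho> where "\<rho> = \<alpha> * R"
  let ?B = "ball c \<rho>"
  define I where "I = {t. 0 < t \<and> ereal t < T}"
  define J where "J = {t. 0 \<le> t \<and> ereal t \<le> T}"
  define G where "G = (PP * \<rho>) powr (2 * (1 - pc / p)) * SS powr (2 * (pc / p))"
  define F where "F t = Lp_norm p ?B (u t) powr (1 - m)" for t
  have \<rho>: "\<rho> > 0" using assms by (simp add: \<rho>_def)
  have p: "p > 1" "p > pc" using assms(10) by auto
  have dim: "DIM(real ^ 'n) \<ge> 3" using assms(6) by simp
  have d: "d \<ge> 3" using assms(6) by (simp add: d_def)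
  have m: "m < 1" by fact
  have "3 * (1 - m) \<le> d * (1 - m)" using d m by (intro mult_right_mono) auto
  then have pm: "p + m - 1 > 0" using p m by (simp add: pc_def)
  have PP: "PP * \<rho> > 0" unfolding PP_def by (rule mult_pos_pos[OF poincare_const_pos \<rho>])
  have SS: "SS > 0" unfolding SS_def by (rule sobolev_const_pos[OF dim])
  have sol: "fde_dirichlet_solution m ?B T u0 u" and ext: "extinction_time ?B u T"
    using assms(14,15) by (simp_all add: \<rho>_def)
  have K: "K = 4 * (1 - m) * (p - 1) / (p + m - 1)\<^sup>2 / G"
  proof -
    have "(PP * \<rho>) powr (- 2 * (1 - pc / p)) = inverse ((PP * \<rho>) powr (2 * (1 - pc / p)))"
      using powr_minus[of "PP * \<rho>" "2 * (1 - pc / p)"] by simp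
    moreover have "SS powr (- 2 * pc / p) = inverse (SS powr (2 * (pc / p)))"
      using powr_minus[of SS "2 * (pc / p)"] by simp
    ultimately show ?thesis
      by (simp add: K_def G_def \<rho>_def mult.assoc divide_inverse)
  qed
  have "G > 0"
  proof -
    have "x powr a > 0" if "x > 0" for x a :: real using that by simp
    from mult_pos_pos[OF this[OF PP] this[OF SS]] show ?thesis unfolding G_def .
  qed
  then have K_pos: "K > 0" unfolding K using p pm m by simp
  obtain D1 D2 where "positive_fde m \<rho> c I u D1 D2"
    using fde_dirichlet_solution_positive_fde[OF sol \<rho>] unfolding I_def by metis
  then interpret positive_fde m \<rho> c I u D1 D2 .
  have Icc: "{s..t} \<subseteq> I" if "0 < s" "t \<in> I" for s t
    using that by (auto simp: I_def intro: le_less_trans[rotated])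
  have F_moment: "F t = moment p t powr ((1 - m) / p)" if "t \<in> I" for t
    using Lp_norm_eq_moment[OF that, of p] p by (simp add: F_def powr_powr)
  have inner: "F t - F s \<le> - K * (t - s)" if "0 < s" "s < t" "t \<in> I" for s t
  proof -
    have "s \<in> I" using Icc[OF that(1,3)] that(2) by auto
    have "p > real DIM(real ^ 'n) * (1 - m) / 2" using p(2) by (simp add: pc_def d_def)
    from moment_powr_decay[OF Icc[OF that(1,3)] that(2) p(1) this dim m \<rho>]
    show ?thesis
      using F_moment[OF \<open>s \<in> I\<close>] F_moment[OF that(3)]
      by (simp add: K G_def PP_def SS_def pc_def d_def)
  qed
  have initial: "F t \<le> F 0" if t: "t \<in> I" for t
  proof -
    have "t > 0" "ereal t < T" using t by (auto simp: I_def)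
    then have sub: "{0<..t} \<subseteq> I" "{0..t} \<subseteq> J"
      unfolding I_def J_def by (auto intro: le_less_trans[rotated] less_imp_le order_trans[rotated])
    have L1: "\<And>\<tau>. \<tau> \<in> J \<Longrightarrow> u \<tau> \<in> Lp_space 1 ?B"
      and lim: "\<And>\<tau>. \<tau> \<in> J \<Longrightarrow> ((\<lambda>\<sigma>. Lp_norm 1 ?B (\<lambda>x. u \<sigma> x - u \<tau> x)) \<longlongrightarrow> 0) (at \<tau> within J)"
      and u0: "AE x in lebesgue. x \<in> ?B \<longrightarrow> u 0 x = u0 x"
      using sol unfolding fde_dirichlet_solution_def Let_def J_def by blast+
    have 0: "0 \<in> J" using sub(2) \<open>t > 0\<close> by auto
    have Lp: "set_integrable lebesgue ?B (\<lambda>x. norm (u 0 x) powr p)"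
    proof -
      have u0m: "(\<lambda>x. indicator ?B x *\<^sub>R u0 x) \<in> borel_measurable lebesgue"
        and u0i: "integrable lebesgue (\<lambda>x. indicator ?B x *\<^sub>R norm (u0 x) powr p)"
        using assms(11) by (auto simp: Lp_space_def set_borel_measurable_def set_integrable_def \<rho>_def)
      have um: "(\<lambda>x. indicator ?B x *\<^sub>R u 0 x) \<in> borel_measurable lebesgue"
        using L1[OF 0] by (auto simp: Lp_space_def set_borel_measurable_def)
      have eq: "(\<lambda>x. indicator ?B x *\<^sub>R norm (v x) powr p) = (\<lambda>x. norm (indicator ?B x *\<^sub>R v x) powr p)"
        for v :: "real ^ 'n \<Rightarrow> real"
        by (auto simp: indicator_def)
      have "integrable lebesgue (\<lambda>x. indicator ?B x *\<^sub>R norm (u 0 x) powr p)"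
      proof (rule integrable_cong_AE_imp[OF u0i])
        show "(\<lambda>x. indicator ?B x *\<^sub>R norm (u 0 x) powr p) \<in> borel_measurable lebesgue"
          unfolding eq using um by measurable
        show "AE x in lebesgue. indicator ?B x *\<^sub>R norm (u0 x) powr p = indicator ?B x *\<^sub>R norm (u 0 x) powr p"
          using u0 by eventually_elim (auto simp: indicator_def)
      qed
      then show ?thesis by (simp add: set_integrable_def)
    qed
    have "moment p t \<le> set_lebesgue_integral lebesgue ?B (\<lambda>x. norm (u 0 x) powr p)"
    proof (rule moment_le_initial[OF sub(1) \<open>t > 0\<close> p(1) pm])
      show "u \<tau> \<in> Lp_space 1 (ball c \<rho>)" if "\<tau> \<in> insert 0 {0<..t}" for \<tau>
      proof -
        have "\<tau> \<in> J" using that sub(2) \<open>t > 0\<close> by auto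
        then show ?thesis by (rule L1)
      qed
      show "((\<lambda>\<tau>. Lp_norm 1 (ball c \<rho>) (\<lambda>x. u \<tau> x - u 0 x)) \<longlongrightarrow> 0) (at 0 within {0<..t})"
        using lim[OF 0] sub(2) by (elim tendsto_within_subset) auto
    qed (rule Lp)
    moreover have "0 \<le> moment p t" using moment_pos[OF t _ \<rho>, of p] p by simp
    ultimately have "moment p t powr ((1 - m) / p)
        \<le> set_lebesgue_integral lebesgue ?B (\<lambda>x. norm (u 0 x) powr p) powr ((1 - m) / p)"
      using p m by (intro powr_mono2) auto
    then show ?thesis
      unfolding F_moment[OF t] by (simp add: F_def Lp_norm_def powr_powr)
  qed
  \<comment> \<open>start times \<open>s = 0\<close> are reached through \<open>r \<longlonglongrightarrow> 0\<close>, with \<open>initial\<close> in place of continuity\<close>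
  have open_decay: "F t - F s \<le> - K * (t - s)" if "0 \<le> s" "s < t" "t \<in> I" for s t
  proof (cases "s = 0")
    case False
    then show ?thesis using inner that by simp
  next
    case True
    have "F t - F 0 \<le> - K * (t - t / real (Suc (Suc n)))" for n
    proof -
      let ?r = "t / real (Suc (Suc n))"
      have r: "0 < ?r" "?r < t" using that True by (simp_all add: field_simps add_pos_nonneg)
      then have "?r \<in> I" using Icc[OF r(1) that(3)] by auto
      then show ?thesis using inner[OF r that(3)] initial[of ?r] by linarith
    qed
    moreover have "(\<lambda>n. - K * (t - t / real (Suc (Suc n)))) \<longlonglongrightarrow> - K * (t - 0)"
      by (intro tendsto_intros LIMSEQ_Suc[OF LIMSEQ_Suc[OF lim_const_over_n]])
    ultimately show ?thesis
      using True by (auto intro!: tendsto_lowerbound[of _ _ sequentially])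
  qed
  have "F t - F s \<le> - K * (t - s)" if "0 \<le> s" "s \<le> t" "ereal t \<le> T" for s t
  proof (cases "s = t \<or> t \<in> I")
    case True
    then show ?thesis using open_decay[of s t] that by fastforce
  next
    case False
    then have "s < t" and T: "T = ereal t" using that by (auto simp: I_def)
    \<comment> \<open>at the extinction time the norm is zero, and before it the norm is nonnegative\<close>
    have "AE x in lebesgue. x \<in> ?B \<longrightarrow> u t x = 0"
      using ext T by (simp add: extinction_time_def vanishes_on_def)
    then have "AE x in lebesgue. indicator ?B x *\<^sub>R norm (u t x) powr p = 0"
      by eventually_elim (auto simp: indicator_def)
    then have "Lp_norm p ?B (u t) = 0"
      unfolding Lp_norm_def set_lebesgue_integral_def by (simp add: integral_eq_zero_AE)
    then have Ft: "F t = 0" by (simp add: F_def)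
    have "- F s \<le> - K * (t - (t - s) / real (Suc (Suc n)) - s)" for n
    proof -
      let ?r = "t - (t - s) / real (Suc (Suc n))"
      have "(t - s) / real (Suc (Suc n)) < (t - s) / 1" "0 < (t - s) / real (Suc (Suc n))"
        using \<open>s < t\<close> by (intro divide_strict_left_mono divide_pos_pos; simp)+
      then have r: "s < ?r" "?r < t" by simp_all
      then have "?r \<in> I" using that(1) T by (auto simp: I_def)
      from open_decay[OF that(1) r(1) this] have "F ?r - F s \<le> - K * (?r - s)" .
      moreover have "0 \<le> F ?r" by (simp add: F_def)
      ultimately show ?thesis by linarith
    qed
    moreover have "(\<lambda>n. - K * (t - (t - s) / real (Suc (Suc n)) - s)) \<longlonglongrightarrow> - K * (t - 0 - s)"
      by (intro tendsto_intros LIMSEQ_Suc[OF LIMSEQ_Suc[OF lim_const_over_n]])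
    ultimately have "- F s \<le> - K * (t - 0 - s)"
      by (intro tendsto_lowerbound[of _ _ sequentially]) auto
    then show ?thesis using Ft by simp
  qed
  with K_pos show ?thesis by (simp add: F_def \<rho>_def)
qed

end
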